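(* Let $p$ be a prime, $F$ a field of characteristic $p$, $n=2m$ with $m\ge 1$, and let $\mathfrak{a}(n)_p$ be any one of the Lie algebras $\mathfrak{h}(n)_p$, $\mathfrak{h}^{(2)}(n)_p$, $\mathfrak{po}(n)_p$, $\mathfrak{po}^{(2)}(n)_p$ over $F$, equipped with the symmetric grading. Let $N=\dim\mathfrak{a}(n)_p$. Then for all integers $0\le k\le N$ and all integers $g$, the cohomology of degree $k$ in grade $g$ is isomorphic, as an $F$-vector space, to the homology of degree $N-k$ in the same grade $g$: $$H^k_{g}\left(\mathfrak{a}(n)_p\right)\cong\left(H^{N-k}_{g}\left(\mathfrak{a}(n)_p\right)\right)^{\prime}=H_{N-k,g}\left(\mathfrak{a}(n)_p\right),$$ where $'$ denotes the dual vector space (and the last equality is the canonical identification of the homology with the dual of the cohomology for finite-dimensional complexes).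
   Context: Divided powers. Let $x_1,\dots,x_n$ be indeterminates, $n=2m$. The divided power algebra over $F$ has basis $\mathbf{x}^{(\mathbf{r})}=x_1^{(r_1)}\cdots x_n^{(r_n)}$, $\mathbf{r}\in\mathbb{Z}_{\ge 0}^n$ (where $x_i^{(r)}$ plays the role of $x_i^r/r!$), with product $\mathbf{x}^{(\mathbf{r})}\mathbf{x}^{(\mathbf{s})}=\binom{\mathbf{r}+\mathbf{s}}{\mathbf{r}}\mathbf{x}^{(\mathbf{r}+\mathbf{s})}$, $\binom{\mathbf{r}+\mathbf{s}}{\mathbf{r}}=\prod_i\binom{r_i+s_i}{r_i}$, and derivations $\partial_i x_i^{(r)}=x_i^{(r-1)}$ (with $x_i^{(-1)}=0$), $\partial_i x_j^{(r)}=0$ for $j\ne i$. The Poisson bracket is $\{f,h\}=\sum_{i=1}^m(\partial_i f\,\partial_{i+m}h-\partial_{i+m}f\,\partial_i h)$, corresponding to the symplectic form $\omega=\sum_{i=1}^m dx_i\wedge dx_{i+m}$. Algebras. The truncated Poisson algebra is $$\mathfrak{po}(n)_p=\mathrm{span}\{\mathbf{x}^{(\mathbf{r})}\mid 0\le r_i<p\}\oplus\mathrm{span}\{x_1^{(p)},\dots,x_n^{(p)}\}$$ with the Poisson bracket (dimension $p^n+n$). The truncated Hamiltonian algebra $\mathfrak{h}(n)_p$ is its quotient by the central subspace of constants $F\cdot 1$, i.e. it has basis $\{\mathbf{x}^{(\mathbf{r})}\mid 0\le r_i<p,\ 0<\sum_i r_i\}\cup\{x_1^{(p)},\dots,x_n^{(p)}\}$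 with the Poisson bracket taken modulo constants (dimension $p^n+n-1$). The algebra $\mathfrak{h}^{(2)}(n)_p$ is the subalgebra of $\mathfrak{h}(n)_p$ spanned by $\{\mathbf{x}^{(\mathbf{r})}\mid 0\le r_i<p,\ 0<\sum_i r_i<n(p-1)\}$ (dimension $p^n-2$). The algebra $\mathfrak{po}^{(2)}(n)_p$ is the corresponding Poisson algebra, i.e. the preimage of $\mathfrak{h}^{(2)}(n)_p$ in $\mathfrak{po}(n)_p$, spanned by $\{\mathbf{x}^{(\mathbf{r})}\mid 0\le r_i<p,\ 0\le\sum_i r_i<n(p-1)\}$. Symmetric grading. This is the $\mathbb{Z}$-grading induced by $\deg x_i=-1$ and $\deg x_{i+m}=1$ for $1\le i\le m$; thus $\mathbf{x}^{(\mathbf{r})}$ has grade $\sum_{i=1}^m(r_{i+m}-r_i)$. The bracket preserves this grading, so $\mathfrak{a}(n)_p=\bigoplus_i L_i$ is a $\mathbb{Z}$-graded Lie algebra. Graded (co)homology. $C_k(\mathfrak{a})=\Lambda^k\mathfrak{a}$ with the Chevalley–Eilenberg boundary (trivial coefficients $F$); $C_{k,g}(\mathfrak{a})$ is spanned by $a_1\wedge\cdots\wedge a_k$ with $a_j\in L_{g_j}$, $g_1+\cdots+g_k=g$; $H_{k,g}(\mathfrak{a})$ is the $k$-th homology of the subcomplex $C_{*,g}(\mathfrak{a})$. $C^k(\mathfrak{a})$ denotes the space of alternating $k$-linear forms on $\mathfrak{a}$ with values in the trivial module $F$ (the dual of $\Lambda^k\mathfrak{a}$), with the Chevalley–Eilenberg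 differential. $C^k_g(\mathfrak{a})$ is the subspace of cochains vanishing on $L_{g_1}\times\cdots\times L_{g_k}$ whenever $g_1+\cdots+g_k\neq g$, i.e. the dual of $C_{k,g}(\mathfrak{a})$. For each $g$, $C^*_g(\mathfrak{a})$ is a subcomplex, and $H^k_g(\mathfrak{a})$ is its $k$-th cohomology. *)

theory Defs
  imports Complex_Main "HOL-Computational_Algebra.Primes" "HOL-Library.Poly_Mapping" "HOL-Library.Function_Algebras"
begin

section \<open>Vector spaces, quotients and duals\<close>

text \<open>Finitely supported functions and plain functions with values in a field are vector spaces
  under pointwise scaling.\<close>

abbreviation "lookup \<equiv> Poly_Mapping.lookup"
abbreviation "keys \<equiv> Poly_Mapping.keys"
abbreviation "single \<equiv> Poly_Mapping.single"

definition pm_scale :: "'a::field \<Rightarrow> ('k \<Rightarrow>\<^sub>0 'a) \<Rightarrow> ('k \<Rightarrow>\<^sub>0 'a)" where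
  "pm_scale c f = Poly_Mapping.map (\<lambda>a. c * a) f"

lemma lookup_pm_scale [simp]: "lookup (pm_scale c f) x = c * lookup f x"
  by (simp add: pm_scale_def Poly_Mapping.map.rep_eq when_def)

interpretation pm: vector_space "pm_scale :: 'a::field \<Rightarrow> ('k \<Rightarrow>\<^sub>0 'a) \<Rightarrow> ('k \<Rightarrow>\<^sub>0 'a)"
  by unfold_locales (auto intro!: poly_mapping_eqI simp: lookup_add algebra_simps)

definition fun_scale :: "'a::field \<Rightarrow> ('b \<Rightarrow> 'a) \<Rightarrow> ('b \<Rightarrow> 'a)" where
  "fun_scale c f = (\<lambda>x. c * f x)"

record ('a, 'v) vspace =
  vcarrier :: "'v set"
  vadd :: "'v \<Rightarrow> 'v \<Rightarrow> 'v"
  vsmult :: "'a \<Rightarrow> 'v \<Rightarrow> 'v"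

text \<open>The quotient of a subspace \<open>Z\<close> by a subspace \<open>B\<close>; its elements are the cosets of \<open>B\<close>.\<close>

definition coset :: "'v::ab_group_add set \<Rightarrow> 'v \<Rightarrow> 'v set" where
  "coset B z = {z + b | b. b \<in> B}"

definition quot_space ::
  "('a \<Rightarrow> 'v \<Rightarrow> 'v) \<Rightarrow> 'v::ab_group_add set \<Rightarrow> 'v set \<Rightarrow> ('a, 'v set) vspace" where
  "quot_space scale Z B =
     \<lparr> vcarrier = coset B ` Z,
       vadd = (\<lambda>X Y. {x + y | x y. x \<in> X \<and> y \<in> Y}),
       vsmult = (\<lambda>c X. {scale c x + b | x b. x \<in> X \<and> b \<in> B}) \<rparr>"

text \<open>Linear functionals are normalised to vanish outside the carrier, so that the dual space
  contains each functional exactly once.\<close>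

definition dual_space :: "('a::field, 'v) vspace \<Rightarrow> ('a, 'v \<Rightarrow> 'a) vspace" where
  "dual_space V =
     \<lparr> vcarrier = {\<phi>. (\<forall>x\<in>vcarrier V. \<forall>y\<in>vcarrier V. \<phi> (vadd V x y) = \<phi> x + \<phi> y)
                    \<and> (\<forall>c. \<forall>x\<in>vcarrier V. \<phi> (vsmult V c x) = c * \<phi> x)
                    \<and> (\<forall>x. x \<notin> vcarrier V \<longrightarrow> \<phi> x = 0)},
       vadd = (\<lambda>\<phi> \<psi>. \<phi> + \<psi>),
       vsmult = fun_scale \<rparr>"

definition linear_iso ::
  "('a, 'v) vspace \<Rightarrow> ('a, 'w) vspace \<Rightarrow> ('v \<Rightarrow> 'w) \<Rightarrow> bool" where
  "linear_iso V W T \<longleftrightarrow>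
     bij_betw T (vcarrier V) (vcarrier W)
   \<and> (\<forall>x\<in>vcarrier V. \<forall>y\<in>vcarrier V. T (vadd V x y) = vadd W (T x) (T y))
   \<and> (\<forall>c. \<forall>x\<in>vcarrier V. T (vsmult V c x) = vsmult W c (T x))"

definition isomorphic :: "('a, 'v) vspace \<Rightarrow> ('a, 'w) vspace \<Rightarrow> bool" where
  "isomorphic V W \<longleftrightarrow> (\<exists>T. linear_iso V W T)"


section \<open>Homology and cohomology of a graded Lie algebra\<close>

record 'v graded_lie =
  lie_carrier :: "'v set"
  lie_bracket :: "'v \<Rightarrow> 'v \<Rightarrow> 'v"
  lie_piece :: "int \<Rightarrow> 'v set"

text \<open>\<open>homogeneous A xs gs\<close>: the \<open>j\<close>-th entry of \<open>xs\<close> lies in the piece of degree \<open>gs ! j\<close>.\<close>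

definition homogeneous :: "'v graded_lie \<Rightarrow> 'v list \<Rightarrow> int list \<Rightarrow> bool" where
  "homogeneous A xs gs \<longleftrightarrow> list_all2 (\<lambda>x j. x \<in> lie_piece A j) xs gs"

text \<open>The exterior power \<open>\<Lambda>\<^sup>k \<aa>\<close> is the free vector space on \<open>k\<close>-tuples of elements of \<open>\<aa>\<close>
  (a tuple \<open>xs\<close> standing for its wedge product) modulo the span of \<open>wedge_relations A k\<close>:
  multilinearity, and vanishing on tuples with a repeated entry.\<close>

definition wedge_relations ::
  "('k \<Rightarrow>\<^sub>0 'a::field) graded_lie \<Rightarrow> nat \<Rightarrow> (('k \<Rightarrow>\<^sub>0 'a) list \<Rightarrow>\<^sub>0 'a) set" where
  "wedge_relations A k =
     {single (us @ (x + y) # vs) 1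
        - single (us @ x # vs) 1 - single (us @ y # vs) 1 | us vs x y.
        length us + 1 + length vs = k \<and> set us \<union> set vs \<union> {x, y} \<subseteq> lie_carrier A}
   \<union> {single (us @ pm_scale c x # vs) 1
        - pm_scale c (single (us @ x # vs) 1) | us vs c x.
        length us + 1 + length vs = k \<and> set us \<union> set vs \<union> {x} \<subseteq> lie_carrier A}
   \<union> {single xs 1 | xs.
        length xs = k \<and> set xs \<subseteq> lie_carrier A \<and> \<not> distinct xs}"

text \<open>Subspaces of \<open>\<Lambda>\<^sup>k \<aa>\<close> are represented by their preimages in the free vector space, i.e. by
  subspaces containing the relations; \<open>chains A k g\<close> is the preimage of \<open>C\<^sub>k\<^sub>,\<^sub>g(\<aa>)\<close>.\<close>

definition chains ::
  "('k \<Rightarrow>\<^sub>0 'a::field) graded_lie \<Rightarrow> nat \<Rightarrow> int \<Rightarrow> (('k \<Rightarrow>\<^sub>0 'a) list \<Rightarrow>\<^sub>0 'a) set" where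
  "chains A k g =
     pm.span ({single xs 1 | xs gs.
                 length xs = k \<and> homogeneous A xs gs \<and> sum_list gs = g}
              \<union> wedge_relations A k)"

text \<open>\<open>contract A xs i j\<close> is the tuple \<open>[x\<^sub>i, x\<^sub>j], x\<^sub>0, \<dots>\<close> with \<open>x\<^sub>i\<close> and \<open>x\<^sub>j\<close> omitted.\<close>

definition contract :: "'v graded_lie \<Rightarrow> 'v list \<Rightarrow> nat \<Rightarrow> nat \<Rightarrow> 'v list" where
  "contract A xs i j = lie_bracket A (xs ! i) (xs ! j) # nths xs (- {i, j})"

definition ce_boundary ::
  "('k \<Rightarrow>\<^sub>0 'a::field) graded_lie \<Rightarrow> (('k \<Rightarrow>\<^sub>0 'a) list \<Rightarrow>\<^sub>0 'a) \<Rightarrow> (('k \<Rightarrow>\<^sub>0 'a) list \<Rightarrow>\<^sub>0 'a)" where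
  "ce_boundary A z =
     (\<Sum>xs\<in>keys z. pm_scale (lookup z xs)
        (\<Sum>j<length xs. \<Sum>i<j. single (contract A xs i j) ((-1) ^ (i + j))))"

text \<open>For \<open>k = 0\<close> the condition on the boundary is void, since \<open>ce_boundary\<close> is then \<open>0\<close>.\<close>

definition cycles ::
  "('k \<Rightarrow>\<^sub>0 'a::field) graded_lie \<Rightarrow> nat \<Rightarrow> int \<Rightarrow> (('k \<Rightarrow>\<^sub>0 'a) list \<Rightarrow>\<^sub>0 'a) set" where
  "cycles A k g = {z \<in> chains A k g. ce_boundary A z \<in> pm.span (wedge_relations A (k - 1))}"

definition boundaries ::
  "('k \<Rightarrow>\<^sub>0 'a::field) graded_lie \<Rightarrow> nat \<Rightarrow> int \<Rightarrow> (('k \<Rightarrow>\<^sub>0 'a) list \<Rightarrow>\<^sub>0 'a) set" where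
  "boundaries A k g = pm.span (ce_boundary A ` chains A (Suc k) g \<union> wedge_relations A k)"

definition homology ::
  "('k \<Rightarrow>\<^sub>0 'a::field) graded_lie \<Rightarrow> nat \<Rightarrow> int \<Rightarrow> ('a, (('k \<Rightarrow>\<^sub>0 'a) list \<Rightarrow>\<^sub>0 'a) set) vspace" where
  "homology A k g = quot_space pm_scale (cycles A k g) (boundaries A k g)"

text \<open>Alternating \<open>k\<close>-linear forms on \<open>\<aa>\<close>, normalised to vanish on lists which are not \<open>k\<close>-tuples
  of elements of \<open>\<aa>\<close>.\<close>

definition alternating_forms ::
  "('k \<Rightarrow>\<^sub>0 'a::field) graded_lie \<Rightarrow> nat \<Rightarrow> (('k \<Rightarrow>\<^sub>0 'a) list \<Rightarrow> 'a) set" where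
  "alternating_forms A k =
     {f. (\<forall>xs. \<not> (length xs = k \<and> set xs \<subseteq> lie_carrier A) \<longrightarrow> f xs = 0)
       \<and> (\<forall>us vs x y. length us + 1 + length vs = k \<and> set us \<union> set vs \<union> {x, y} \<subseteq> lie_carrier A
            \<longrightarrow> f (us @ (x + y) # vs) = f (us @ x # vs) + f (us @ y # vs))
       \<and> (\<forall>us vs c x. length us + 1 + length vs = k \<and> set us \<union> set vs \<union> {x} \<subseteq> lie_carrier A
            \<longrightarrow> f (us @ pm_scale c x # vs) = c * f (us @ x # vs))
       \<and> (\<forall>xs. length xs = k \<and> set xs \<subseteq> lie_carrier A \<and> \<not> distinct xs \<longrightarrow> f xs = 0)}"

definition cochains ::
  "('k \<Rightarrow>\<^sub>0 'a::field) graded_lie \<Rightarrow> nat \<Rightarrow> int \<Rightarrow> (('k \<Rightarrow>\<^sub>0 'a) list \<Rightarrow> 'a) set" where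
  "cochains A k g =
     {f \<in> alternating_forms A k.
        \<forall>xs gs. length xs = k \<and> homogeneous A xs gs \<and> sum_list gs \<noteq> g \<longrightarrow> f xs = 0}"

definition ce_differential ::
  "('k \<Rightarrow>\<^sub>0 'a::field) graded_lie \<Rightarrow> (('k \<Rightarrow>\<^sub>0 'a) list \<Rightarrow> 'a) \<Rightarrow> (('k \<Rightarrow>\<^sub>0 'a) list \<Rightarrow> 'a)" where
  "ce_differential A f =
     (\<lambda>xs. if set xs \<subseteq> lie_carrier A
           then (\<Sum>j<length xs. \<Sum>i<j. (-1) ^ (i + j) * f (contract A xs i j)) else 0)"

definition cocycles ::
  "('k \<Rightarrow>\<^sub>0 'a::field) graded_lie \<Rightarrow> nat \<Rightarrow> int \<Rightarrow> (('k \<Rightarrow>\<^sub>0 'a) list \<Rightarrow> 'a) set" where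
  "cocycles A k g = {f \<in> cochains A k g. ce_differential A f = 0}"

definition coboundaries ::
  "('k \<Rightarrow>\<^sub>0 'a::field) graded_lie \<Rightarrow> nat \<Rightarrow> int \<Rightarrow> (('k \<Rightarrow>\<^sub>0 'a) list \<Rightarrow> 'a) set" where
  "coboundaries A k g = (if k = 0 then {0} else ce_differential A ` cochains A (k - 1) g)"

definition cohomology ::
  "('k \<Rightarrow>\<^sub>0 'a::field) graded_lie \<Rightarrow> nat \<Rightarrow> int \<Rightarrow> ('a, (('k \<Rightarrow>\<^sub>0 'a) list \<Rightarrow> 'a) set) vspace" where
  "cohomology A k g = quot_space fun_scale (cocycles A k g) (coboundaries A k g)"

text \<open>The canonical map from homology to the dual of cohomology, given by evaluating a
  representing cocycle on a representing cycle.\<close>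

definition kronecker ::
  "('k \<Rightarrow>\<^sub>0 'a::field) graded_lie \<Rightarrow> nat \<Rightarrow> int \<Rightarrow> (('k \<Rightarrow>\<^sub>0 'a) list \<Rightarrow>\<^sub>0 'a) set
     \<Rightarrow> (('k \<Rightarrow>\<^sub>0 'a) list \<Rightarrow> 'a) set \<Rightarrow> 'a" where
  "kronecker A k g X = (\<lambda>\<Phi>. if \<Phi> \<in> vcarrier (cohomology A k g)
     then (THE t. \<exists>z\<in>X. \<exists>f\<in>\<Phi>. t = (\<Sum>xs\<in>keys z. lookup z xs * f xs)) else 0)"


section \<open>Divided powers and the truncated Poisson and Hamiltonian algebras\<close>

text \<open>An exponent is a finitely supported \<open>r\<close> with \<open>r\<^sub>i = lookup r i\<close>; the indeterminates are
  numbered \<open>1, \<dots>, 2m\<close>. The basis element \<open>x\<^sup>(\<^sup>r\<^sup>)\<close> is \<open>single r 1\<close>. The multiplication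
  that the library puts on this type is that of ordinary polynomials and is not used.\<close>

type_synonym exponent = "nat \<Rightarrow>\<^sub>0 nat"
type_synonym 'a divpow = "exponent \<Rightarrow>\<^sub>0 'a"

definition divmono :: "exponent \<Rightarrow> 'a::field divpow" where
  "divmono r = single r 1"

definition multibinom :: "exponent \<Rightarrow> exponent \<Rightarrow> nat" where
  "multibinom r s = (\<Prod>i\<in>keys (r + s). (lookup r i + lookup s i) choose lookup r i)"

definition dp_mult :: "'a::field divpow \<Rightarrow> 'a divpow \<Rightarrow> 'a divpow" where
  "dp_mult f h = (\<Sum>r\<in>keys f. \<Sum>s\<in>keys h.
     pm_scale (lookup f r * lookup h s * of_nat (multibinom r s)) (divmono (r + s)))"

definition dp_deriv :: "nat \<Rightarrow> 'a::field divpow \<Rightarrow> 'a divpow" where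
  "dp_deriv i f = (\<Sum>r\<in>keys f.
     if lookup r i = 0 then 0
     else pm_scale (lookup f r) (divmono (r - single i 1)))"

text \<open>On basis elements these are the defining formulas of the divided power algebra.\<close>

lemma dp_mult_divmono:
  "dp_mult (divmono r) (divmono s) =
     (pm_scale (of_nat (multibinom r s)) (divmono (r + s)) :: 'a::field divpow)"
  by (simp add: dp_mult_def divmono_def)

lemma dp_deriv_divmono:
  "(dp_deriv i (divmono r) :: 'a::field divpow) =
     (if lookup r i = 0 then 0 else divmono (r - single i 1))"
  by (simp add: dp_deriv_def divmono_def)

lemma multibinom_eq_prod:
  assumes "finite I" "keys r \<subseteq> I" "keys s \<subseteq> I"
  shows "multibinom r s = (\<Prod>i\<in>I. (lookup r i + lookup s i) choose lookup r i)"
  unfolding multibinom_def using assms keys_add[of r s]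
  by (intro prod.mono_neutral_left) (auto simp: in_keys_iff lookup_add)

definition poisson :: "nat \<Rightarrow> 'a::field divpow \<Rightarrow> 'a divpow \<Rightarrow> 'a divpow" where
  "poisson m f h = (\<Sum>i=1..m.
     dp_mult (dp_deriv i f) (dp_deriv (i + m) h) - dp_mult (dp_deriv (i + m) f) (dp_deriv i h))"

text \<open>The Poisson bracket modulo constants: the quotient by the constants is identified with the
  elements without constant term.\<close>

definition ham_bracket :: "nat \<Rightarrow> 'a::field divpow \<Rightarrow> 'a divpow \<Rightarrow> 'a divpow" where
  "ham_bracket m f h = poisson m f h - pm_scale (lookup (poisson m f h) 0) (divmono 0)"

definition total_degree :: "exponent \<Rightarrow> nat" where
  "total_degree r = (\<Sum>i\<in>keys r. lookup r i)"

definition sym_grade :: "nat \<Rightarrow> exponent \<Rightarrow> int" where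
  "sym_grade m r = (\<Sum>i=1..m. int (lookup r (i + m)) - int (lookup r i))"

definition truncated_exponents :: "nat \<Rightarrow> nat \<Rightarrow> exponent set" where
  "truncated_exponents m p = {r. keys r \<subseteq> {1..2 * m} \<and> (\<forall>i. lookup r i < p)}"

definition pth_exponents :: "nat \<Rightarrow> nat \<Rightarrow> exponent set" where
  "pth_exponents m p = {single i p | i. i \<in> {1..2 * m}}"

definition graded_algebra ::
  "nat \<Rightarrow> exponent set \<Rightarrow> ('a::field divpow \<Rightarrow> 'a divpow \<Rightarrow> 'a divpow) \<Rightarrow> 'a divpow graded_lie" where
  "graded_algebra m R br =
     \<lparr> lie_carrier = pm.span (divmono ` R),
       lie_bracket = br,
       lie_piece = (\<lambda>g. pm.span (divmono ` {r \<in> R. sym_grade m r = g})) \<rparr>"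

text \<open>The algebras \<open>\<pp>\<oo>(n)\<^sub>p\<close>, \<open>\<hh>(n)\<^sub>p\<close>, \<open>\<hh>\<^sup>(\<^sup>2\<^sup>)(n)\<^sub>p\<close> and \<open>\<pp>\<oo>\<^sup>(\<^sup>2\<^sup>)(n)\<^sub>p\<close> for \<open>n = 2m\<close>.\<close>

definition po :: "nat \<Rightarrow> nat \<Rightarrow> 'a::field divpow graded_lie" where
  "po m p = graded_algebra m (truncated_exponents m p \<union> pth_exponents m p) (poisson m)"

definition ham :: "nat \<Rightarrow> nat \<Rightarrow> 'a::field divpow graded_lie" where
  "ham m p = graded_algebra m
     ({r \<in> truncated_exponents m p. 0 < total_degree r} \<union> pth_exponents m p) (ham_bracket m)"

definition ham2 :: "nat \<Rightarrow> nat \<Rightarrow> 'a::field divpow graded_lie" where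
  "ham2 m p = graded_algebra m
     {r \<in> truncated_exponents m p. 0 < total_degree r \<and> total_degree r < 2 * m * (p - 1)}
     (ham_bracket m)"

definition po2 :: "nat \<Rightarrow> nat \<Rightarrow> 'a::field divpow graded_lie" where
  "po2 m p = graded_algebra m
     {r \<in> truncated_exponents m p. total_degree r < 2 * m * (p - 1)} (poisson m)"

end

theory Submission
  imports Defs
begin

text \<open>Write a chain of the Lie algebra in the basis of wedge products of basis elements, indexed by
  subsets of the finite index set \<open>R\<close>. In terms of the creation and annihilation operators
  \<open>\<epsilon>\<^sub>r\<close>, \<open>\<iota>\<^sub>r\<close> the boundary is \<open>\<Sum> [e\<^sub>r, e\<^sub>s] \<and> \<iota>\<^sub>r \<iota>\<^sub>s\<close> over \<open>r < s\<close>, and the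
  differential is its transpose. The Hodge star, i.e. complementation of subsets with a suitable
  sign, exchanges \<open>\<epsilon>\<^sub>r\<close> and \<open>\<iota>\<^sub>r\<close>; since the algebra is unimodular, it therefore carries the boundary
  to the differential up to sign, so that cohomology of degree \<open>k\<close> and grade \<open>g\<close> is homology of
  degree \<open>N - k\<close> and grade \<open>G - g\<close>, where \<open>G\<close> is the sum of all grades. Finally the exchange of
  \<open>x\<^sub>i\<close> and \<open>x\<^sub>i\<^sub>+\<^sub>m\<close>, with a sign, is an automorphism which reverses the grading: hence \<open>G = 0\<close>, and
  the grade \<open>- g\<close> may be replaced by \<open>g\<close>.\<close>

section \<open>Linear functionals and quotient spaces\<close>

text \<open>Chains live in the infinite-dimensional free space on all tuples, so coordinates are
  legitimate only once the span of the wedge relations is known to be the kernel of the coordinate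
  map. Separation gives this: a functional that kills the relations is an alternating form, and such
  a form is determined by its values on increasing basis tuples.

  One commutation rule, Cartan's formula for the boundary and exterior multiplication by a vector,
  determines the boundary recursively on wedge products; the vanishing of its square and its
  agreement with the formula on tuples both follow by induction.

  Characteristic 2 is allowed, so a sum over pairs is never treated as half of a full double sum,
  and vanishing diagonals are recorded separately from antisymmetry.

  Unimodularity is again due to the exchange of conjugate indeterminates: the trace of the adjoint
  map of a basis element is 0 or a difference of two sums over \<open>R\<close> which the exchange
  identifies. Hence what mainly has to be checked for each of the four algebras is that
  \<open>R\<close> is finite, stable under the exchange and closed under the bracket.\<close>

lemma vector_space_field: "vector_space ((*) :: 'a::field \<Rightarrow> 'a \<Rightarrow> 'a)"
  by unfold_locales (auto simp: algebra_simps)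

lemma vector_space_fun_scale: "vector_space (fun_scale :: 'a::field \<Rightarrow> ('b \<Rightarrow> 'a) \<Rightarrow> 'b \<Rightarrow> 'a)"
  by unfold_locales (auto simp: fun_scale_def fun_eq_iff algebra_simps)

lemma pm_scale_single [simp]: "pm_scale c (single x d) = single x (c * d)"
  by (auto intro!: poly_mapping_eqI simp: lookup_single when_def)

lemma keys_pm_scale_subset: "keys (pm_scale c z) \<subseteq> keys z"
  by (auto simp: in_keys_iff)

text \<open>All functions on the basis form the full dual of the finitely supported functions; this
  is the evaluation, and it is the value that \<open>kronecker\<close> takes on
  representatives.\<close>

definition pairing :: "('k \<Rightarrow>\<^sub>0 'a::field) \<Rightarrow> ('k \<Rightarrow> 'a) \<Rightarrow> 'a" where
  "pairing z f = (\<Sum>x\<in>keys z. lookup z x * f x)"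

lemma pairing_superset:
  assumes "finite X" "keys z \<subseteq> X"
  shows "pairing z f = (\<Sum>x\<in>X. lookup z x * f x)"
  unfolding pairing_def using assms
  by (intro sum.mono_neutral_left) (auto simp: in_keys_iff)

lemma pairing_add_left: "pairing (z + w) f = pairing z f + pairing w f"
proof -
  let ?X = "keys z \<union> keys w"
  have "keys (z + w) \<subseteq> ?X" by (rule keys_add)
  then show ?thesis
    by (simp add: pairing_superset[of ?X] lookup_add algebra_simps sum.distrib)
qed

lemma pairing_scale_left: "pairing (pm_scale c z) f = c * pairing z f"
  by (simp add: pairing_superset[OF finite_keys keys_pm_scale_subset]
        pairing_def[of z] sum_distrib_left mult.assoc)

lemma pairing_zero_left [simp]: "pairing 0 f = 0"
  by (simp add: pairing_def)

lemma pairing_uminus_left: "pairing (- z) f = - pairing z f"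
  by (metis add_eq_0_iff pairing_add_left pairing_zero_left)

lemma pairing_diff_left: "pairing (z - w) f = pairing z f - pairing w f"
  by (metis add_uminus_conv_diff pairing_add_left pairing_uminus_left)

lemma pairing_sum_left: "pairing (sum z I) f = (\<Sum>i\<in>I. pairing (z i) f)"
  by (induction I rule: infinite_finite_induct) (auto simp: pairing_add_left)

lemma pairing_single [simp]: "pairing (single x c) f = c * f x"
  by (cases "c = 0") (auto simp: pairing_def)

lemma pairing_add_right: "pairing z (f + h) = pairing z f + pairing z h"
  by (simp add: pairing_def sum.distrib algebra_simps)

lemma pairing_diff_right: "pairing z (f - h) = pairing z f - pairing z h"
  by (simp add: pairing_def sum_subtractf algebra_simps)

lemma pairing_scale_right: "pairing z (fun_scale c f) = c * pairing z f"
  by (simp add: pairing_def sum_distrib_left fun_scale_def algebra_simps)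

lemma pairing_sum_right: "pairing z (\<lambda>x. \<Sum>i\<in>I. f i x) = (\<Sum>i\<in>I. pairing z (f i))"
  unfolding pairing_def by (simp add: sum_distrib_left sum.swap[of _ I])

lemma pairing_cong:
  assumes "\<And>x. x \<in> keys z \<Longrightarrow> f x = h x"
  shows "pairing z f = pairing z h"
  using assms by (auto simp: pairing_def intro!: sum.cong)

lemma pm_expand: "z = (\<Sum>x\<in>keys z. single x (lookup z x))"
  by (rule poly_mapping_eqI)
    (auto simp: lookup_sum lookup_single when_def in_keys_iff)

lemma pairing_span_eq_0:
  assumes "z \<in> pm.span B" "\<And>b. b \<in> B \<Longrightarrow> pairing b f = 0"
  shows "pairing z f = 0"
  using assms
  by (induction rule: pm.span_induct_alt) (auto simp: pairing_add_left pairing_scale_left)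

text \<open>A maximal independent subset of \<open>B\<close> together with \<open>z\<close> is
  independent, so some linear map is 1 at \<open>z\<close> and 0 on that subset. Every linear map to
  the field is \<open>pairing\<close> with its values on the unit vectors.\<close>

lemma separating_functional:
  fixes z :: "'k \<Rightarrow>\<^sub>0 'a::field"
  assumes "z \<notin> pm.span B"
  obtains f where "\<And>b. b \<in> B \<Longrightarrow> pairing b f = 0" "pairing z f \<noteq> 0"
proof -
  interpret K: vector_space "(*) :: 'a \<Rightarrow> 'a \<Rightarrow> 'a" by (rule vector_space_field)
  interpret VP: vector_space_pair "pm_scale :: 'a \<Rightarrow> ('k \<Rightarrow>\<^sub>0 'a) \<Rightarrow> _" "(*) :: 'a \<Rightarrow> 'a \<Rightarrow> 'a" ..
  obtain C where C: "C \<subseteq> B" "pm.independent C" "B \<subseteq> pm.span C"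
    using pm.maximal_independent_subset by metis
  have "pm.span C = pm.span B"
    by (metis C(1,3) pm.span_mono pm.span_span subset_antisym)
  with assms have zC: "z \<notin> pm.span C" by simp
  then have "pm.independent (insert z C)"
    using C(2) by (rule pm.independent_insertI)
  then obtain g where g: "Vector_Spaces.linear pm_scale (*) g" "\<forall>x\<in>insert z C. g x = (if x = z then 1 else 0)"
    using VP.linear_independent_extend[of _ "\<lambda>x. if x = z then 1 else 0"] by blast
  have zC': "z \<notin> C" using zC pm.span_base by auto
  have g_eq: "g w = pairing w (\<lambda>x. g (single x 1))" for w
  proof -
    have "g w = g (\<Sum>x\<in>keys w. pm_scale (lookup w x) (single x 1))"
      using pm_expand[of w] by simp
    also have "\<dots> = (\<Sum>x\<in>keys w. lookup w x * g (single x 1))"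
      by (simp only: VP.linear_sum[OF g(1)] VP.linear_scale[OF g(1)])
    finally show ?thesis by (simp add: pairing_def)
  qed
  show thesis
  proof (rule that[of "\<lambda>x. g (single x 1)"])
    show "pairing z (\<lambda>x. g (single x 1)) \<noteq> 0" using g(2) by (simp flip: g_eq)
    fix b assume "b \<in> B"
    then have "b \<in> pm.span C" using C(3) by auto
    then have "g b = 0"
      using VP.linear_eq_0_on_span[OF g(1), of C] g(2) zC' by (metis insertI2)
    then show "pairing b (\<lambda>x. g (single x 1)) = 0" by (simp flip: g_eq)
  qed
qed

text \<open>Turns a functional that is additive and homogeneous on a subspace only, such as one
  induced on cocycles by a functional on cohomology, into a linear map on the whole space.\<close>

lemma extend_functional:
  fixes scale :: "'a::field \<Rightarrow> 'v::ab_group_add \<Rightarrow> 'v"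
  assumes "vector_space scale" and "module.subspace scale Z"
    and add: "\<And>x y. x \<in> Z \<Longrightarrow> y \<in> Z \<Longrightarrow> g (x + y) = g x + g y"
    and scl: "\<And>c x. x \<in> Z \<Longrightarrow> g (scale c x) = c * g x"
  obtains h where "\<And>x y. h (x + y) = h x + h y" "\<And>c x. h (scale c x) = c * h x"
    "\<And>x. x \<in> Z \<Longrightarrow> h x = g x"
proof -
  interpret V: vector_space scale by fact
  interpret K: vector_space "(*) :: 'a \<Rightarrow> 'a \<Rightarrow> 'a" by (rule vector_space_field)
  interpret VP: vector_space_pair scale "(*) :: 'a \<Rightarrow> 'a \<Rightarrow> 'a" ..
  obtain C where C: "C \<subseteq> Z" "V.independent C" "Z \<subseteq> V.span C"
    using V.maximal_independent_subset by metis
  obtain h where h: "Vector_Spaces.linear scale (*) h" "\<forall>x\<in>C. h x = g x"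
    using VP.linear_independent_extend[OF C(2)] by blast
  have hadd: "h (x + y) = h x + h y" and hscl: "h (scale c x) = c * h x" for x y c
    using VP.linear_add[OF h(1)] VP.linear_scale[OF h(1)] by auto
  have "x \<in> Z \<and> h x = g x" if "x \<in> V.span C" for x
    using that
  proof (induction rule: V.span_induct_alt)
    case base
    have "g 0 = g (scale 0 0)" by simp
    also have "\<dots> = 0" using scl[of 0 0] V.subspace_0[OF assms(2)] by simp
    finally show ?case using VP.linear_0[OF h(1)] V.subspace_0[OF assms(2)] by simp
  next
    case (step c x y)
    then show ?case
      using C(1) h(2) assms(2) by (auto simp: hadd hscl add scl V.subspace_add V.subspace_scale)
  qed
  then show thesis using that[of h] hadd hscl C(3) by blast
qed

section \<open>Isomorphisms between quotient spaces\<close>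

lemma isomorphic_trans: "isomorphic U V \<Longrightarrow> isomorphic V W \<Longrightarrow> isomorphic U W"
  unfolding isomorphic_def linear_iso_def
proof safe
  fix T S
  assume T: "bij_betw T (vcarrier U) (vcarrier V)"
    "\<forall>x\<in>vcarrier U. \<forall>y\<in>vcarrier U. T (vadd U x y) = vadd V (T x) (T y)"
    "\<forall>c. \<forall>x\<in>vcarrier U. T (vsmult U c x) = vsmult V c (T x)"
    and S: "bij_betw S (vcarrier V) (vcarrier W)"
    "\<forall>x\<in>vcarrier V. \<forall>y\<in>vcarrier V. S (vadd V x y) = vadd W (S x) (S y)"
    "\<forall>c. \<forall>x\<in>vcarrier V. S (vsmult V c x) = vsmult W c (S x)"
  have "T x \<in> vcarrier V" if "x \<in> vcarrier U" for x using T(1) that by (auto simp: bij_betw_def)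
  then show "\<exists>R. bij_betw R (vcarrier U) (vcarrier W) \<and>
      (\<forall>x\<in>vcarrier U. \<forall>y\<in>vcarrier U. R (vadd U x y) = vadd W (R x) (R y)) \<and>
      (\<forall>c. \<forall>x\<in>vcarrier U. R (vsmult U c x) = vsmult W c (R x))"
    using T S by (intro exI[of _ "S \<circ> T"]) (auto intro: bij_betw_trans)
qed

context vector_space
begin

lemma coset_eq_iff:
  assumes "subspace B"
  shows "coset B z = coset B w \<longleftrightarrow> z - w \<in> B"
proof
  assume "coset B z = coset B w"
  moreover have "z \<in> coset B z" using subspace_0[OF assms] by (force simp: coset_def)
  ultimately obtain b where "b \<in> B" "z = w + b" by (auto simp: coset_def)
  then show "z - w \<in> B" by simp
next
  assume *: "z - w \<in> B"
  have "z + b = w + (z - w + b)" "w + b = z + (b - (z - w))" for b by simp_all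
  then show "coset B z = coset B w"
    using subspace_add[OF assms *] subspace_diff[OF assms _ *] unfolding coset_def by blast
qed

lemma mem_coset_iff:
  assumes "subspace B"
  shows "x \<in> coset B z \<longleftrightarrow> x - z \<in> B"
  by (auto simp: coset_def) (metis add.commute diff_add_cancel)

lemma coset_add:
  assumes "subspace B"
  shows "{x + y | x y. x \<in> coset B z \<and> y \<in> coset B w} = coset B (z + w)" (is "?L = ?R")
proof
  show "?L \<subseteq> ?R"
  proof clarify
    fix x y assume "x \<in> coset B z" "y \<in> coset B w"
    then have "(x - z) + (y - w) \<in> B"
      using assms by (intro subspace_add) (auto simp: mem_coset_iff)
    then show "x + y \<in> ?R" using assms by (simp add: mem_coset_iff algebra_simps)
  qed
  show "?R \<subseteq> ?L"
  proof
    fix v assume "v \<in> ?R"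
    then have "v - w \<in> coset B z" "w \<in> coset B w"
      using assms subspace_0 by (auto simp: mem_coset_iff algebra_simps)
    then show "v \<in> ?L" by (metis (mono_tags, lifting) diff_add_cancel mem_Collect_eq)
  qed
qed

lemma coset_scale:
  assumes "subspace B"
  shows "{scale c x + b | x b. x \<in> coset B z \<and> b \<in> B} = coset B (scale c z)" (is "?L = ?R")
proof
  show "?L \<subseteq> ?R"
  proof clarify
    fix x b assume "x \<in> coset B z" "b \<in> B"
    then have "scale c (x - z) + b \<in> B"
      using assms by (intro subspace_add subspace_scale) (auto simp: mem_coset_iff)
    then show "scale c x + b \<in> ?R"
      using assms by (simp add: mem_coset_iff algebra_simps)
  qed
  show "?R \<subseteq> ?L"
    using subspace_0[OF assms] by (force simp: coset_def)
qed

end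

text \<open>The map \<open>D\<close> on representatives only has to be onto modulo
  \<open>B'\<close>, so it may land in preferred representatives; this suits maps that pass through
  coordinates.\<close>

lemma quot_space_isomorphic:
  assumes "vector_space s" "vector_space t"
    and "module.subspace s Z" "module.subspace s B"
    and "module.subspace t Z'" "module.subspace t B'"
    and add: "\<And>x y. D (x + y) = D x + D y" and scl: "\<And>c x. D (s c x) = t c (D x)"
    and mem: "\<And>z. z \<in> Z \<Longrightarrow> D z \<in> Z'"
    and ker: "\<And>z. z \<in> Z \<Longrightarrow> D z \<in> B' \<longleftrightarrow> z \<in> B"
    and onto: "\<And>w. w \<in> Z' \<Longrightarrow> \<exists>z\<in>Z. w - D z \<in> B'"
  shows "isomorphic (quot_space s Z B) (quot_space t Z' B')"
proof -
  interpret V: vector_space s by fact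
  interpret W: vector_space t by fact
  \<comment> \<open>Any representative may be chosen: by \<open>ker\<close>, the class of
    \<open>D z\<close> depends only on the class of \<open>z\<close>.\<close>
  define T where "T X = coset B' (D (SOME z. z \<in> Z \<and> coset B z = X))" for X
  have D_diff: "D (x - y) = D x - D y" for x y
    using add[of "x - y" y] by (simp add: algebra_simps)
  have eq: "coset B' (D z) = coset B' (D w) \<longleftrightarrow> coset B z = coset B w"
    if "z \<in> Z" "w \<in> Z" for z w
    using ker[of "z - w"] that assms(3-6)
    by (simp add: V.coset_eq_iff W.coset_eq_iff V.subspace_diff D_diff)
  have T: "T (coset B z) = coset B' (D z)" if "z \<in> Z" for z
    unfolding T_def using someI[of "\<lambda>x. x \<in> Z \<and> coset B x = coset B z" z] that eq by blast
  have "bij_betw T (coset B ` Z) (coset B' ` Z')"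
    unfolding bij_betw_def
  proof
    show "inj_on T (coset B ` Z)" by (auto intro!: inj_onI simp: T eq)
    show "T ` coset B ` Z = coset B' ` Z'"
    proof safe
      fix w assume "w \<in> Z'"
      then obtain z where z: "z \<in> Z" "w - D z \<in> B'" using onto by blast
      then have "coset B' w = T (coset B z)" using assms(6) by (simp add: T W.coset_eq_iff)
      then show "coset B' w \<in> T ` coset B ` Z" using z by blast
    qed (auto simp: T mem)
  qed
  moreover have "T (coset B (x + y)) = coset B' (D x + D y)" if "x \<in> Z" "y \<in> Z" for x y
    using that assms(3) by (simp add: T V.subspace_add add)
  moreover have "T (coset B (s c x)) = coset B' (t c (D x))" if "x \<in> Z" for x c
    using that assms(3) by (simp add: T V.subspace_scale scl)
  ultimately show ?thesis
    unfolding isomorphic_def linear_iso_def quot_space_def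
    by (intro exI[of _ T])
      (auto simp: T V.coset_add[OF assms(4)] V.coset_scale[OF assms(4)]
        W.coset_add[OF assms(6)] W.coset_scale[OF assms(6)])
qed

section \<open>Creation and annihilation operators\<close>

interpretation fn: vector_space "fun_scale :: 'a::field \<Rightarrow> ('b \<Rightarrow> 'a) \<Rightarrow> 'b \<Rightarrow> 'a"
  by (rule vector_space_fun_scale)

interpretation fn2: vector_space_pair "fun_scale :: 'a::field \<Rightarrow> ('b \<Rightarrow> 'a) \<Rightarrow> 'b \<Rightarrow> 'a"
  "fun_scale :: 'a \<Rightarrow> ('c \<Rightarrow> 'a) \<Rightarrow> 'c \<Rightarrow> 'a" ..

abbreviation linear_op :: "(('b \<Rightarrow> 'a::field) \<Rightarrow> ('c \<Rightarrow> 'a)) \<Rightarrow> bool" where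
  "linear_op \<equiv> Vector_Spaces.linear fun_scale fun_scale"

lemma linear_opI:
  assumes "\<And>v w. T (v + w) = T v + T w" "\<And>c v. T (fun_scale c v) = fun_scale c (T v)"
  shows "linear_op T"
  using assms by (simp add: Vector_Spaces.linear_iff vector_space_fun_scale)

lemma fun_scale_apply [simp]: "fun_scale c v x = c * v x"
  by (simp add: fun_scale_def)

lemma sum_fun_apply [simp]: "(\<Sum>i\<in>I. f i) x = (\<Sum>i\<in>I. f i x)"
  by (induction I rule: infinite_finite_induct) auto

text \<open>Off the diagonal the terms cancel in pairs. In characteristic 2 antisymmetry does not
  force the diagonal to vanish, so this is a separate hypothesis.\<close>

lemma antisymmetric_sum_eq_0:
  fixes a :: "'i \<Rightarrow> 'i \<Rightarrow> 'v::ab_group_add"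
  assumes "finite I" "\<And>i. i \<in> I \<Longrightarrow> a i i = 0" "\<And>i j. i \<in> I \<Longrightarrow> j \<in> I \<Longrightarrow> a i j = - a j i"
  shows "(\<Sum>i\<in>I. \<Sum>j\<in>I. a i j) = 0"
  using assms
proof (induction I rule: finite_induct)
  case (insert x I)
  have 1: "(\<Sum>i\<in>I. a i x) = (\<Sum>i\<in>I. - a x i)"
    by (intro sum.cong refl insert.prems(2)) auto
  have 2: "(\<Sum>i\<in>I. \<Sum>j\<in>I. a i j) = 0"
    by (intro insert.IH insert.prems) auto
  have 3: "a x x = 0" by (rule insert.prems) simp
  show ?case
    using insert.hyps by (simp add: sum.distrib 1 2 3 sum_negf)
next
  case empty
  show ?case by simp
qed

locale fock =
  fixes R :: "'k::linorder set"
  assumes finite_R: "finite R"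
begin

text \<open>The sign of moving \<open>r\<close> past the smaller elements of \<open>S\<close>.
  Intersecting with the finite \<open>R\<close> keeps the count meaningful for every set, so the
  operators act on functions of arbitrary sets.\<close>

definition sg :: "'k \<Rightarrow> 'k set \<Rightarrow> 'a::field" where
  "sg r S = (-1) ^ card {s \<in> R \<inter> S. s < r}"

definition eps :: "'k \<Rightarrow> ('k set \<Rightarrow> 'a::field) \<Rightarrow> 'k set \<Rightarrow> 'a" where
  "eps r v = (\<lambda>S. if r \<in> S then sg r S * v (S - {r}) else 0)"

definition iota :: "'k \<Rightarrow> ('k set \<Rightarrow> 'a::field) \<Rightarrow> 'k set \<Rightarrow> 'a" where
  "iota r v = (\<lambda>S. if r \<in> S then 0 else sg r S * v (insert r S))"

lemma sg_square [simp]: "sg r S * sg r S = (1 :: 'a::field)"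
  by (simp add: sg_def flip: power_mult_distrib)

lemma sg_square' [simp]: "sg r S * (sg r S * x) = (x :: 'a::field)"
  by (simp flip: mult.assoc)

lemma sg_insert:
  assumes "s \<in> R" "s \<notin> S"
  shows "sg r (insert s S) = (if s < r then - sg r S else sg r S :: 'a::field)"
proof (cases "s < r")
  case True
  then have "{t \<in> R \<inter> insert s S. t < r} = insert s {t \<in> R \<inter> S. t < r}" using assms by auto
  then show ?thesis using True assms finite_R by (simp add: sg_def)
next
  case False
  then have "{t \<in> R \<inter> insert s S. t < r} = {t \<in> R \<inter> S. t < r}" by auto
  then show ?thesis using False by (simp add: sg_def)
qed

lemma sg_insert_self [simp]: "sg r (insert r S) = sg r S"
proof -
  have "{s \<in> R \<inter> insert r S. s < r} = {s \<in> R \<inter> S. s < r}" by auto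
  then show ?thesis by (simp only: sg_def)
qed

lemma sg_remove_self [simp]: "sg r (S - {r}) = sg r S"
proof -
  have "{s \<in> R \<inter> (S - {r}). s < r} = {s \<in> R \<inter> S. s < r}" by auto
  then show ?thesis by (simp only: sg_def)
qed

lemma sg_remove:
  assumes "s \<in> R" "s \<in> S"
  shows "sg r (S - {s}) = (if s < r then - sg r S else sg r S :: 'a::field)"
proof -
  have "insert s (S - {s}) = S" using assms(2) by auto
  then have "sg r S = (if s < r then - sg r (S - {s}) else sg r (S - {s}) :: 'a)"
    using sg_insert[of s "S - {s}" r, where 'a = 'a] assms by simp
  then show ?thesis by (metis minus_minus)
qed

lemma linear_eps: "linear_op (eps r)"
  by (rule linear_opI) (auto simp: eps_def fun_eq_iff algebra_simps)

lemma linear_iota: "linear_op (iota r)"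
  by (rule linear_opI) (auto simp: iota_def fun_eq_iff algebra_simps)

lemmas eps_linear = fn2.linear_add[OF linear_eps] fn2.linear_scale[OF linear_eps]
  fn2.linear_sum[OF linear_eps] fn2.linear_diff[OF linear_eps] fn2.linear_neg[OF linear_eps]
  fn2.linear_0[OF linear_eps]

lemmas iota_linear = fn2.linear_add[OF linear_iota] fn2.linear_scale[OF linear_iota]
  fn2.linear_sum[OF linear_iota] fn2.linear_diff[OF linear_iota] fn2.linear_neg[OF linear_iota]
  fn2.linear_0[OF linear_iota]

lemma eps_eps_same [simp]: "eps r (eps r v) = 0"
  by (auto simp: eps_def fun_eq_iff)

lemma eps_eps:
  fixes v :: "'k set \<Rightarrow> 'a::field"
  assumes "r \<in> R" "s \<in> R"
  shows "eps r (eps s v) = - eps s (eps r v)"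
proof (cases "r = s")
  case False
  show ?thesis
  proof
    fix S
    show "eps r (eps s v) S = (- eps s (eps r v)) S"
    proof (cases "r \<in> S \<and> s \<in> S")
      case True
      \<comment> \<open>Exactly one of the two signs changes, as one of the indices is the smaller;
        this is the source of the minus sign.\<close>
      have 1: "sg s (S - {r}) = (if r < s then - sg s S else sg s S :: 'a)"
        and 2: "sg r (S - {s}) = (if s < r then - sg r S else sg r S :: 'a)"
        using assms True by (simp_all only: sg_remove)
      have 3: "S - {r} - {s} = S - {s} - {r}" by auto
      from True False show ?thesis
        by (simp add: eps_def 1 2 3 not_less_iff_gr_or_eq)
    qed (auto simp: eps_def)
  qed
qed simp

text \<open>The canonical anticommutation relation, from which the later commutation rules are
  derived. For equal indices one of the two products vanishes at each set and the other is the
  identity; for distinct ones exactly one sign flips, as in \<open>eps_eps\<close>.\<close>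

lemma iota_eps:
  fixes v :: "'k set \<Rightarrow> 'a::field"
  assumes "r \<in> R" "s \<in> R"
  shows "iota r (eps s v) = (if r = s then v else 0) - eps s (iota r v)"
proof (cases "r = s")
  case True
  show ?thesis
    unfolding True by (auto simp: iota_def eps_def fun_eq_iff insert_absorb)
next
  case False
  show ?thesis
  proof
    fix S
    show "iota r (eps s v) S = ((if r = s then v else 0) - eps s (iota r v)) S"
    proof (cases "r \<notin> S \<and> s \<in> S")
      case True
      have 1: "sg s (insert r S) = (if r < s then - sg s S else sg s S :: 'a)"
        and 2: "sg r (S - {s}) = (if s < r then - sg r S else sg r S :: 'a)"
        using assms True by (simp_all add: sg_remove sg_insert)
      have 3: "insert r S - {s} = insert r (S - {s})" using False by auto
      from True False show ?thesis
        by (simp add: eps_def iota_def 1 2 3 not_less_iff_gr_or_eq)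
    qed (use False in \<open>auto simp: eps_def iota_def\<close>)
  qed
qed

text \<open>Adding and removing \<open>r\<close> matches the subsets without \<open>r\<close> with
  those containing it, and both operators carry the same sign across this matching.\<close>

lemma eps_adjoint:
  assumes "r \<in> R"
  shows "(\<Sum>S\<in>Pow R. u S * eps r v S) = (\<Sum>S\<in>Pow R. iota r u S * v S)"
proof -
  have "(\<Sum>S\<in>Pow R. u S * eps r v S) = (\<Sum>S\<in>{S\<in>Pow R. r \<in> S}. u S * eps r v S)"
    by (intro sum.mono_neutral_right) (auto simp: finite_R eps_def)
  also have "\<dots> = (\<Sum>S\<in>{S\<in>Pow R. r \<notin> S}. iota r u S * v S)"
    using assms
    by (intro sum.reindex_bij_witness[of _ "insert r" "\<lambda>S. S - {r}"])
      (auto simp: eps_def iota_def insert_absorb algebra_simps)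
  also have "\<dots> = (\<Sum>S\<in>Pow R. iota r u S * v S)"
    by (intro sum.mono_neutral_left) (auto simp: finite_R iota_def)
  finally show ?thesis .
qed

section \<open>Exterior multiplication by a vector and its transpose\<close>

definition ext :: "('k \<Rightarrow>\<^sub>0 'a::field) \<Rightarrow> ('k set \<Rightarrow> 'a) \<Rightarrow> 'k set \<Rightarrow> 'a" where
  "ext x v = (\<Sum>r\<in>R. fun_scale (lookup x r) (eps r v))"

text \<open>Contraction with the covector that has the same coordinates as \<open>x\<close> in the
  given basis; this makes it the transpose of \<open>ext x\<close>, see
  \<open>ext_adjoint\<close>.\<close>

definition con :: "('k \<Rightarrow>\<^sub>0 'a::field) \<Rightarrow> ('k set \<Rightarrow> 'a) \<Rightarrow> 'k set \<Rightarrow> 'a" where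
  "con x v = (\<Sum>r\<in>R. fun_scale (lookup x r) (iota r v))"

lemma linear_ext: "linear_op (ext x)"
  by (rule linear_opI)
    (auto simp: ext_def eps_linear fn.scale_right_distrib sum.distrib fn.scale_sum_right
      mult.commute)

lemma linear_con: "linear_op (con x)"
  by (rule linear_opI)
    (auto simp: con_def iota_linear fn.scale_right_distrib sum.distrib fn.scale_sum_right
      mult.commute)

lemmas ext_linear = fn2.linear_add[OF linear_ext] fn2.linear_scale[OF linear_ext]
  fn2.linear_sum[OF linear_ext] fn2.linear_diff[OF linear_ext] fn2.linear_neg[OF linear_ext]
  fn2.linear_0[OF linear_ext]

lemmas con_linear = fn2.linear_add[OF linear_con] fn2.linear_scale[OF linear_con]
  fn2.linear_sum[OF linear_con] fn2.linear_diff[OF linear_con] fn2.linear_neg[OF linear_con]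
  fn2.linear_0[OF linear_con]

lemma ext_add: "ext (x + y) v = ext x v + ext y v"
  by (simp add: ext_def lookup_add fn.scale_left_distrib sum.distrib)

lemma ext_pm_scale: "ext (pm_scale c x) v = fun_scale c (ext x v)"
  by (simp add: ext_def fn.scale_sum_right)

lemma ext_0_left [simp]: "ext 0 v = 0"
  by (simp add: ext_def)

lemma ext_sum: "ext (sum x I) v = (\<Sum>i\<in>I. ext (x i) v)"
  by (induction I rule: infinite_finite_induct) (auto simp: ext_add)

lemma ext_single:
  assumes "r \<in> R"
  shows "ext (single r 1) v = eps r v"
proof -
  have "ext (single r 1) v = (\<Sum>s\<in>R. if s = r then eps r v else 0)"
    unfolding ext_def by (intro sum.cong) (auto simp: lookup_single)
  then show ?thesis using assms finite_R by simp
qed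

lemma ext_ext_same: "ext x (ext x v) = 0"
proof -
  have "ext x (ext x v) =
      (\<Sum>r\<in>R. \<Sum>s\<in>R. fun_scale (lookup x r * lookup x s) (eps r (eps s v)))"
    by (simp add: ext_def eps_linear fn.scale_sum_right)
  also have "\<dots> = 0"
  proof (rule antisymmetric_sum_eq_0[OF finite_R])
    fix r s assume "r \<in> R" "s \<in> R"
    then show "fun_scale (lookup x r * lookup x s) (eps r (eps s v))
        = - fun_scale (lookup x s * lookup x r) (eps s (eps r v))"
      by (subst eps_eps) (simp_all add: mult.commute)
  qed simp
  finally show ?thesis .
qed

lemma ext_ext: "ext x (ext y v) = - ext y (ext x v)"
proof -
  have "ext (x + y) (ext (x + y) v) = 0" by (rule ext_ext_same)
  then have "ext x (ext y v) + ext y (ext x v) = 0"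
    by (simp add: ext_add ext_linear ext_ext_same add.commute)
  then show ?thesis by (simp add: eq_neg_iff_add_eq_0)
qed

lemma iota_ext:
  assumes "r \<in> R"
  shows "iota r (ext x v) = fun_scale (lookup x r) v - ext x (iota r v)"
proof -
  have "iota r (ext x v) = (\<Sum>s\<in>R. fun_scale (lookup x s) (if r = s then v else 0)
      - fun_scale (lookup x s) (eps s (iota r v)))"
    using assms by (simp add: ext_def iota_linear iota_eps fn.scale_right_diff_distrib)
  also have "\<dots> = (\<Sum>s\<in>R. if r = s then fun_scale (lookup x r) v else 0) - ext x (iota r v)"
    unfolding ext_def sum_subtractf by (intro arg_cong2[of _ _ _ _ "(-)"] sum.cong) auto
  finally show ?thesis using assms finite_R by simp
qed

lemma con_eps:
  assumes "s \<in> R"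
  shows "con x (eps s v) = fun_scale (lookup x s) v - eps s (con x v)"
proof -
  have "con x (eps s v) = (\<Sum>r\<in>R. fun_scale (lookup x r) (if r = s then v else 0)
      - fun_scale (lookup x r) (eps s (iota r v)))"
    using assms by (simp add: con_def iota_linear iota_eps fn.scale_right_diff_distrib)
  also have "\<dots> = (\<Sum>r\<in>R. if r = s then fun_scale (lookup x s) v else 0) - eps s (con x v)"
    unfolding con_def sum_subtractf eps_linear
    by (intro arg_cong2[of _ _ _ _ "(-)"] sum.cong) auto
  finally show ?thesis using assms finite_R by simp
qed

lemma ext_adjoint:
  "(\<Sum>S\<in>Pow R. u S * ext x v S) = (\<Sum>S\<in>Pow R. con x u S * v S)"
proof -
  have "(\<Sum>S\<in>Pow R. u S * ext x v S) = (\<Sum>r\<in>R. lookup x r * (\<Sum>S\<in>Pow R. u S * eps r v S))"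
    by (simp add: ext_def sum_distrib_left sum.swap[of _ R] algebra_simps)
  also have "\<dots> = (\<Sum>r\<in>R. lookup x r * (\<Sum>S\<in>Pow R. iota r u S * v S))"
    by (intro sum.cong) (simp_all add: eps_adjoint)
  also have "\<dots> = (\<Sum>S\<in>Pow R. con x u S * v S)"
    by (simp add: con_def sum_distrib_left sum_distrib_right sum.swap[of _ R] algebra_simps)
  finally show ?thesis .
qed

lemma iota_adjoint:
  assumes "r \<in> R"
  shows "(\<Sum>S\<in>Pow R. u S * iota r v S) = (\<Sum>S\<in>Pow R. eps r u S * v S)"
  using eps_adjoint[OF assms, of v u] by (simp add: mult.commute)

section \<open>Wedge products of tuples in coordinates\<close>

primrec wedge :: "('k \<Rightarrow>\<^sub>0 'a::field) list \<Rightarrow> 'k set \<Rightarrow> 'a" where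
  "wedge [] = (\<lambda>S. if S = {} then 1 else 0)"
| "wedge (x # xs) = ext x (wedge xs)"

lemma iota_wedge_Nil [simp]: "iota r (wedge []) = 0"
  by (auto simp: iota_def fun_eq_iff)

text \<open>The front factor \<open>x\<close> anticommutes past \<open>us\<close> until it meets the
  second copy of \<open>x\<close>.\<close>

lemma ext_wedge_append: "ext x (wedge (us @ x # vs)) = 0"
proof (induction us)
  case (Cons u us)
  then show ?case
    by (simp only: append_Cons wedge.simps ext_ext[of x u] ext_linear minus_zero)
qed (simp add: ext_ext_same)

lemma wedge_append_linear:
  "wedge (us @ (x + y) # vs) = wedge (us @ x # vs) + wedge (us @ y # vs)"
  "wedge (us @ pm_scale c x # vs) = fun_scale c (wedge (us @ x # vs))"
  by (induction us) (simp_all add: ext_add ext_pm_scale ext_linear)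

lemma wedge_not_distinct:
  assumes "\<not> distinct xs"
  shows "wedge xs = 0"
  using assms
proof (induction xs)
  case (Cons x xs)
  show ?case
  proof (cases "x \<in> set xs")
    case True
    then obtain us vs where "xs = us @ x # vs" by (blast dest: split_list)
    then show ?thesis by (simp add: ext_wedge_append)
  next
    case False
    then have "wedge xs = 0" using Cons by auto
    then show ?thesis by (simp only: wedge.simps ext_linear)
  qed
qed simp

definition basis_tuple :: "'k set \<Rightarrow> ('k \<Rightarrow>\<^sub>0 'a::field) list" where
  "basis_tuple S = map (\<lambda>r. single r 1) (sorted_list_of_set S)"

lemma length_basis_tuple [simp]: "length (basis_tuple S) = card S"
  by (simp add: basis_tuple_def)

lemma set_basis_tuple: "S \<subseteq> R \<Longrightarrow> set (basis_tuple S) = (\<lambda>r. single r 1) ` S"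
  using finite_subset[OF _ finite_R] by (simp add: basis_tuple_def)

lemma wedge_sorted:
  assumes "sorted xs" "distinct xs" "set xs \<subseteq> R"
  shows "wedge (map (\<lambda>r. single r 1) xs) = (\<lambda>S. if S = set xs then 1 else 0 :: 'a::field)"
  using assms
proof (induction xs)
  case (Cons r xs)
  \<comment> \<open>In an increasing list the head lies below all later entries, so it is inserted
    without a sign.\<close>
  have "sg r S = (1 :: 'a)" if "S = insert r (set xs)" for S
  proof -
    have "{s \<in> R \<inter> S. s < r} = {}" using Cons.prems(1) that by auto
    then show ?thesis by (simp only: sg_def card.empty power_0)
  qed
  note sg = this
  have iff: "r \<in> S \<and> S - {r} = set xs \<longleftrightarrow> S = insert r (set xs)" for S
    using Cons.prems(2) by auto
  have "wedge (map (\<lambda>r. single r 1) (r # xs)) = eps r (\<lambda>S. if S = set xs then 1 else 0 :: 'a)"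
    using Cons by (simp add: ext_single)
  also have "\<dots> = (\<lambda>S. if S = set (r # xs) then 1 else 0)"
  proof
    fix S
    show "eps r (\<lambda>S. if S = set xs then 1 else 0 :: 'a) S = (if S = set (r # xs) then 1 else 0)"
      unfolding eps_def using iff[of S] sg[of S] by (auto simp del: sg_insert_self)
  qed
  finally show ?case .
qed simp

lemma wedge_basis_tuple:
  assumes "S \<subseteq> R"
  shows "wedge (basis_tuple S) = (\<lambda>T. if T = S then 1 else 0 :: 'a::field)"
  using assms finite_subset[OF assms finite_R] wedge_sorted[of "sorted_list_of_set S"]
  by (simp add: basis_tuple_def)

section \<open>Degree and grade of coordinate functions\<close>

definition homog :: "('k \<Rightarrow> int) \<Rightarrow> nat \<Rightarrow> int \<Rightarrow> ('k set \<Rightarrow> 'a::field) \<Rightarrow> bool" where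
  "homog gr k g v \<longleftrightarrow> (\<forall>S. v S \<noteq> 0 \<longrightarrow> S \<subseteq> R \<and> card S = k \<and> sum gr S = g)"

lemma homog_add: "homog gr k g v \<Longrightarrow> homog gr k g w \<Longrightarrow> homog gr k g (v + w)"
  unfolding homog_def
proof (intro allI impI)
  fix S
  assume v: "\<forall>S. v S \<noteq> 0 \<longrightarrow> S \<subseteq> R \<and> card S = k \<and> sum gr S = g"
    and w: "\<forall>S. w S \<noteq> 0 \<longrightarrow> S \<subseteq> R \<and> card S = k \<and> sum gr S = g"
    and "(v + w) S \<noteq> 0"
  then have "v S \<noteq> 0 \<or> w S \<noteq> 0" by auto
  then show "S \<subseteq> R \<and> card S = k \<and> sum gr S = g" using v w by blast
qed

lemma homog_0 [simp]: "homog gr k g 0"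
  by (simp add: homog_def)

lemma homog_scale: "homog gr k g v \<Longrightarrow> homog gr k g (fun_scale c v)"
  by (auto simp: homog_def)

lemma homog_neg: "homog gr k g v \<Longrightarrow> homog gr k g (- v)"
  by (auto simp: homog_def)

lemma homog_sum: "(\<And>i. i \<in> I \<Longrightarrow> homog gr k g (v i)) \<Longrightarrow> homog gr k g (sum v I)"
  by (induction I rule: infinite_finite_induct) (auto simp: homog_add)

lemma homog_eps:
  assumes "homog gr k g v" "r \<in> R"
  shows "homog gr (Suc k) (gr r + g) (eps r v)"
  unfolding homog_def
proof (intro allI impI)
  fix S assume "eps r v S \<noteq> 0"
  then have "r \<in> S" "v (S - {r}) \<noteq> 0" by (auto simp: eps_def split: if_splits)
  with assms have "S - {r} \<subseteq> R" "card (S - {r}) = k" "sum gr (S - {r}) = g"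
    by (auto simp: homog_def)
  moreover have "S \<subseteq> R" using calculation(1) assms(2) by auto
  moreover have "finite S" using calculation(4) finite_R by (rule finite_subset)
  moreover have "sum gr S = gr r + sum gr (S - {r})" "card S = Suc (card (S - {r}))"
    using \<open>finite S\<close> \<open>r \<in> S\<close> by (simp_all only: sum.remove card_Suc_Diff1)
  ultimately show "S \<subseteq> R \<and> card S = Suc k \<and> sum gr S = gr r + g"
    by simp
qed

lemma homog_iota:
  assumes "homog gr (Suc k) (gr r + g) v" "r \<in> R"
  shows "homog gr k g (iota r v)"
  unfolding homog_def
proof (intro allI impI)
  fix S assume "iota r v S \<noteq> 0"
  then have "r \<notin> S" "v (insert r S) \<noteq> 0" by (auto simp: iota_def split: if_splits)
  with assms have "S \<subseteq> R" "card (insert r S) = Suc k" "sum gr (insert r S) = gr r + g"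
    by (auto simp: homog_def)
  moreover have "finite S" using calculation(1) finite_R by (rule finite_subset)
  ultimately show "S \<subseteq> R \<and> card S = k \<and> sum gr S = g"
    using \<open>r \<notin> S\<close> by auto
qed

lemma homog_ext:
  assumes "homog gr k g v" "keys x \<subseteq> {r \<in> R. gr r = h}"
  shows "homog gr (Suc k) (h + g) (ext x v)"
  unfolding ext_def
proof (rule homog_sum)
  fix r assume r: "r \<in> R"
  show "homog gr (Suc k) (h + g) (fun_scale (lookup x r) (eps r v))"
    using assms homog_eps[OF assms(1) r]
    by (cases "r \<in> keys x") (auto simp: in_keys_iff intro: homog_scale)
qed

lemma homog_wedge:
  assumes "list_all2 (\<lambda>x h. keys x \<subseteq> {r \<in> R. gr r = h}) xs gs"
  shows "homog gr (length xs) (sum_list gs) (wedge xs)"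
  using assms
proof (induction rule: list_all2_induct)
  case Nil
  then show ?case by (auto simp: homog_def)
qed (auto intro: homog_ext)

text \<open>There is nothing above the top degree \<open>card R\<close>; this disposes of the
  boundaries that correspond to cohomology of degree 0.\<close>

lemma homog_empty:
  assumes "homog gr k g v" "card R < k"
  shows "v = 0"
proof
  fix S
  show "v S = 0 S"
    using assms card_mono[OF finite_R, of S] by (auto simp: homog_def)
qed

section \<open>The Hodge star\<close>

definition star_sign :: "'k set \<Rightarrow> 'a::field" where
  "star_sign S = (\<Prod>s\<in>S. sg s R)"

definition star :: "('k set \<Rightarrow> 'a::field) \<Rightarrow> 'k set \<Rightarrow> 'a" where
  "star v = (\<lambda>S. if S \<subseteq> R then star_sign S * v (R - S) else 0)"

lemma star_sign_square [simp]: "star_sign S * star_sign S = (1 :: 'a::field)"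
  by (simp add: star_sign_def flip: prod.distrib)

lemma linear_star: "linear_op star"
  by (rule linear_opI) (auto simp: star_def fun_eq_iff algebra_simps)

lemmas star_linear = fn2.linear_add[OF linear_star] fn2.linear_scale[OF linear_star]
  fn2.linear_sum[OF linear_star] fn2.linear_diff[OF linear_star] fn2.linear_neg[OF linear_star]
  fn2.linear_0[OF linear_star]

text \<open>The elements of \<open>R\<close> below \<open>r\<close> are shared between
  \<open>S\<close> and its complement. The discrepancy \<open>sg r R\<close> does not depend on
  \<open>S\<close>, which is why \<open>star_sign\<close> is a product of these factors over the
  elements of \<open>S\<close>.\<close>

lemma sg_compl:
  "sg r (R - S) = sg r R * (sg r S :: 'a::field)"
proof -
  have "{s \<in> R. s < r} = {s \<in> R \<inter> S. s < r} \<union> {s \<in> R \<inter> (R - S). s < r}" by auto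
  moreover have "card \<dots> = card {s \<in> R \<inter> S. s < r} + card {s \<in> R \<inter> (R - S). s < r}"
    by (rule card_Un_disjoint) (auto simp: finite_R)
  ultimately have "sg r R = (sg r S * sg r (R - S) :: 'a)" by (simp add: sg_def power_add)
  then show ?thesis by (simp add: mult.commute mult.left_commute)
qed

lemma star_iota:
  assumes "r \<in> R"
  shows "star (iota r v) = eps r (star v)"
proof
  fix S
  show "star (iota r v) S = eps r (star v) S"
  proof (cases "S \<subseteq> R \<and> r \<in> S")
    case True
    then have fin: "finite S" using finite_R finite_subset by blast
    have "R - (S - {r}) = insert r (R - S)" using True by auto
    moreover have "star_sign S = (sg r R * star_sign (S - {r}) :: 'a)"
      using True fin by (simp add: star_sign_def prod.remove[of S r])
    ultimately show ?thesis
      using True by (auto simp: star_def iota_def eps_def sg_compl algebra_simps)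
  qed (use assms in \<open>auto simp: star_def iota_def eps_def\<close>)
qed

lemma star_eps:
  assumes "r \<in> R"
  shows "star (eps r v) = iota r (star v)"
proof
  fix S
  show "star (eps r v) S = iota r (star v) S"
  proof (cases "S \<subseteq> R \<and> r \<notin> S")
    case True
    then have fin: "finite S" using finite_R finite_subset by blast
    have "R - insert r S = R - S - {r}" by auto
    moreover have "star_sign (insert r S) = (sg r R * star_sign S :: 'a)"
      using True fin by (simp add: star_sign_def)
    ultimately show ?thesis
      using True assms by (auto simp: star_def iota_def eps_def sg_compl algebra_simps)
  qed (use assms in \<open>auto simp: star_def iota_def eps_def\<close>)
qed

lemma star_ext: "star (ext x v) = con x (star v)"
  by (simp add: ext_def con_def star_linear star_eps)

text \<open>The signs of \<open>S\<close> and of its complement multiply to that of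
  \<open>R\<close>, a constant. So the star is its own inverse up to the global sign
  \<open>star_sign R\<close>.\<close>

lemma star_star:
  assumes "\<And>S. v S \<noteq> 0 \<Longrightarrow> S \<subseteq> R"
  shows "star (star v) = fun_scale (star_sign R) v"
proof
  fix S
  show "star (star v) S = fun_scale (star_sign R) v S"
  proof (cases "S \<subseteq> R")
    case True
    then have "R - (R - S) = S" by auto
    moreover have "star_sign R = (star_sign (R - S) * star_sign S :: 'a)"
      unfolding star_sign_def using True finite_R by (rule prod.subset_diff)
    ultimately show ?thesis using True by (simp add: star_def)
  qed (use assms[of S] in \<open>auto simp: star_def\<close>)
qed

lemma homog_star:
  assumes "homog gr k g v"
  shows "homog gr (card R - k) (sum gr R - g) (star v)"
  unfolding homog_def
proof (intro allI impI)
  fix S assume "star v S \<noteq> 0"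
  then have S: "S \<subseteq> R" "v (R - S) \<noteq> 0" by (auto simp: star_def split: if_splits)
  then have "card (R - S) = k" "sum gr (R - S) = g" using assms by (auto simp: homog_def)
  moreover have "card S + card (R - S) = card R"
    using S(1) finite_R by (simp add: card_Diff_subset card_mono finite_subset)
  moreover have "sum gr R = sum gr (R - S) + sum gr S"
    using S(1) finite_R by (rule sum.subset_diff)
  ultimately show "S \<subseteq> R \<and> card S = card R - k \<and> sum gr S = sum gr R - g"
    using S(1) by auto
qed

end

section \<open>The Chevalley--Eilenberg operators on the exterior algebra\<close>

text \<open>These rules are kept out of the simplifier below, where identities are between vectors
  and operators are moved by linearity; evaluation at a point is invoked explicitly.\<close>

lemmas pointwise =
  plus_fun_apply zero_fun_apply minus_apply uminus_apply fun_scale_apply sum_fun_apply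

declare pointwise [simp del]

text \<open>The boundary sums over \<open>r < s\<close> only, since halving a full double sum is
  impossible in characteristic 2. This rule lets symmetrised sums over such pairs be read as full
  double sums.\<close>

lemma sum_pairs:
  fixes h :: "'i::linorder \<Rightarrow> 'i \<Rightarrow> 'v::ab_group_add"
  assumes "finite I" "\<And>i. i \<in> I \<Longrightarrow> h i i = 0"
  shows "(\<Sum>i\<in>I. \<Sum>j\<in>I. h i j) = (\<Sum>i\<in>I. \<Sum>j\<in>{j\<in>I. i < j}. h i j + h j i)"
proof -
  have "(\<Sum>j\<in>I. h i j) = (\<Sum>j\<in>{j\<in>I. i < j}. h i j) + (\<Sum>j\<in>{j\<in>I. j < i}. h i j)"
    if "i \<in> I" for i
  proof -
    have I: "I = insert i ({j\<in>I. i < j} \<union> {j\<in>I. j < i})" using that by auto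
    have "(\<Sum>j\<in>I. h i j) = h i i + (\<Sum>j\<in>{j\<in>I. i < j} \<union> {j\<in>I. j < i}. h i j)"
      by (subst I, subst sum.insert) (use assms(1) in auto)
    also have "\<dots> = (\<Sum>j\<in>{j\<in>I. i < j}. h i j) + (\<Sum>j\<in>{j\<in>I. j < i}. h i j)"
      by (subst sum.union_disjoint) (use assms that in auto)
    finally show ?thesis .
  qed
  then have "(\<Sum>i\<in>I. \<Sum>j\<in>I. h i j) =
      (\<Sum>i\<in>I. \<Sum>j\<in>{j\<in>I. i < j}. h i j) + (\<Sum>i\<in>I. \<Sum>j\<in>{j\<in>I. j < i}. h i j)"
    by (simp add: sum.distrib)
  also have "(\<Sum>i\<in>I. \<Sum>j\<in>{j\<in>I. j < i}. h i j) = (\<Sum>i\<in>I. \<Sum>j\<in>{j\<in>I. i < j}. h j i)"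
    by (rule sum.swap_restrict) (use assms in auto)
  finally show ?thesis by (simp add: sum.distrib)
qed

text \<open>Bilinearity, the alternating law and Jacobi are asked for on the whole ambient space,
  where the brackets are defined; only the carrier, closure, the grading and unimodularity refer to
  \<open>R\<close>. Jacobi takes the form that adjoint maps are derivations, and
  \<open>unimodular\<close> says that their traces vanish.\<close>

locale graded_lie_basis = fock R for R :: "'k::linorder set" +
  fixes A :: "('k \<Rightarrow>\<^sub>0 'a::field) graded_lie" and gr :: "'k \<Rightarrow> int"
  assumes carrier_eq: "lie_carrier A = {x. keys x \<subseteq> R}"
    and piece_eq: "lie_piece A g = {x. keys x \<subseteq> {r \<in> R. gr r = g}}"
    and br_add_left: "lie_bracket A (x + y) z = lie_bracket A x z + lie_bracket A y z"
    and br_add_right: "lie_bracket A x (y + z) = lie_bracket A x y + lie_bracket A x z"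
    and br_scale_left: "lie_bracket A (pm_scale c x) y = pm_scale c (lie_bracket A x y)"
    and br_scale_right: "lie_bracket A x (pm_scale c y) = pm_scale c (lie_bracket A x y)"
    and br_self: "lie_bracket A x x = 0"
    and jacobi: "lie_bracket A x (lie_bracket A y z) =
      lie_bracket A (lie_bracket A x y) z + lie_bracket A y (lie_bracket A x z)"
    and br_basis: "r \<in> R \<Longrightarrow> s \<in> R \<Longrightarrow>
      keys (lie_bracket A (single r 1) (single s 1)) \<subseteq> {t \<in> R. gr t = gr r + gr s}"
    and unimodular: "s \<in> R \<Longrightarrow>
      (\<Sum>r\<in>R. lookup (lie_bracket A (single s 1) (single r 1)) r) = 0"
begin

abbreviation br :: "('k \<Rightarrow>\<^sub>0 'a) \<Rightarrow> ('k \<Rightarrow>\<^sub>0 'a) \<Rightarrow> ('k \<Rightarrow>\<^sub>0 'a)" where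
  "br \<equiv> lie_bracket A"

abbreviation e :: "'k \<Rightarrow> 'k \<Rightarrow>\<^sub>0 'a" where
  "e r \<equiv> single r 1"

lemma br_swap: "br x y = - br y x"
proof -
  have "br (x + y) (x + y) = 0" by (rule br_self)
  then have "br x y + br y x = 0"
    by (simp add: br_add_left br_add_right br_self[of x] br_self[of y] add.commute)
  then show ?thesis by (simp add: eq_neg_iff_add_eq_0)
qed

lemma br_zero_left [simp]: "br 0 y = 0"
  using br_scale_left[of 0 0 y] by simp

lemma br_zero_right [simp]: "br x 0 = 0"
  using br_scale_right[of x 0 0] by simp

lemma br_sum_right: "br x (sum y I) = (\<Sum>i\<in>I. br x (y i))"
  by (induction I rule: infinite_finite_induct) (auto simp: br_add_right)

lemma br_sum_left: "br (sum x I) y = (\<Sum>i\<in>I. br (x i) y)"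
  by (induction I rule: infinite_finite_induct) (auto simp: br_add_left)

lemma expand_basis:
  assumes "keys x \<subseteq> R"
  shows "x = (\<Sum>r\<in>R. pm_scale (lookup x r) (e r))"
proof (rule poly_mapping_eqI)
  fix t
  show "lookup x t = lookup (\<Sum>r\<in>R. pm_scale (lookup x r) (e r)) t"
    using assms finite_R
    by (cases "t \<in> R") (auto simp: lookup_sum lookup_single when_def in_keys_iff)
qed

lemma keys_sum_subset: "(\<And>i. i \<in> I \<Longrightarrow> keys (x i) \<subseteq> X) \<Longrightarrow> keys (sum x I) \<subseteq> X"
  using keys_sum[of x I] by blast

lemma br_expand:
  assumes "keys x \<subseteq> R" "keys y \<subseteq> R"
  shows "br x y = (\<Sum>r\<in>R. \<Sum>s\<in>R. pm_scale (lookup x r * lookup y s) (br (e r) (e s)))"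
proof -
  have "br x y = br (\<Sum>r\<in>R. pm_scale (lookup x r) (e r)) (\<Sum>s\<in>R. pm_scale (lookup y s) (e s))"
    using expand_basis[OF assms(1)] expand_basis[OF assms(2)] by simp
  also have "\<dots> = (\<Sum>r\<in>R. \<Sum>s\<in>R. pm_scale (lookup x r * lookup y s) (br (e r) (e s)))"
    by (simp only: br_sum_left br_sum_right br_scale_left br_scale_right pm.scale_sum_right
        pm.scale_scale, subst sum.swap, simp only: mult.commute)
  finally show ?thesis .
qed

lemma br_closed:
  assumes "keys x \<subseteq> R" "keys y \<subseteq> R"
  shows "keys (br x y) \<subseteq> R"
  unfolding br_expand[OF assms]
proof (intro keys_sum_subset)
  fix r s assume "r \<in> R" "s \<in> R"
  then show "keys (pm_scale (lookup x r * lookup y s) (br (e r) (e s))) \<subseteq> R"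
    using br_basis[of r s] keys_pm_scale_subset[of _ "br (e r) (e s)"] by blast
qed

section \<open>The adjoint action on the exterior algebra, the boundary and the differential\<close>

definition ad :: "('k \<Rightarrow>\<^sub>0 'a) \<Rightarrow> ('k set \<Rightarrow> 'a) \<Rightarrow> 'k set \<Rightarrow> 'a" where
  "ad x v = (\<Sum>r\<in>R. ext (br x (e r)) (iota r v))"

definition bnd :: "('k set \<Rightarrow> 'a) \<Rightarrow> 'k set \<Rightarrow> 'a" where
  "bnd v = (\<Sum>r\<in>R. \<Sum>s\<in>{s\<in>R. r < s}. ext (br (e r) (e s)) (iota r (iota s v)))"

text \<open>The transpose of \<open>bnd\<close>: each factor is replaced by its transpose and the
  order is reversed.\<close>

definition cobnd :: "('k set \<Rightarrow> 'a) \<Rightarrow> 'k set \<Rightarrow> 'a" where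
  "cobnd u = (\<Sum>r\<in>R. \<Sum>s\<in>{s\<in>R. r < s}. eps s (eps r (con (br (e r) (e s)) u)))"

lemma linear_ad: "linear_op (ad x)"
  by (rule linear_opI)
    (simp_all add: ad_def ext_linear iota_linear sum.distrib fn.scale_sum_right)

lemma linear_bnd: "linear_op bnd"
  by (rule linear_opI)
    (simp_all add: bnd_def ext_linear iota_linear sum.distrib fn.scale_sum_right)

lemma linear_cobnd: "linear_op cobnd"
  by (rule linear_opI)
    (simp_all add: cobnd_def con_linear eps_linear sum.distrib fn.scale_sum_right)

lemmas ad_linear = fn2.linear_add[OF linear_ad] fn2.linear_scale[OF linear_ad]
  fn2.linear_sum[OF linear_ad] fn2.linear_diff[OF linear_ad] fn2.linear_neg[OF linear_ad]
  fn2.linear_0[OF linear_ad]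

lemmas bnd_linear = fn2.linear_add[OF linear_bnd] fn2.linear_scale[OF linear_bnd]
  fn2.linear_sum[OF linear_bnd] fn2.linear_diff[OF linear_bnd] fn2.linear_neg[OF linear_bnd]
  fn2.linear_0[OF linear_bnd]

lemmas cobnd_linear = fn2.linear_add[OF linear_cobnd] fn2.linear_scale[OF linear_cobnd]
  fn2.linear_sum[OF linear_cobnd] fn2.linear_diff[OF linear_cobnd] fn2.linear_neg[OF linear_cobnd]
  fn2.linear_0[OF linear_cobnd]

lemma ext_br_right:
  assumes "keys y \<subseteq> R"
  shows "(\<Sum>r\<in>R. fun_scale (lookup y r) (ext (br x (e r)) v)) = ext (br x y) v"
proof -
  have "ext (br x y) v = ext (br x (\<Sum>r\<in>R. pm_scale (lookup y r) (e r))) v"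
    using expand_basis[OF assms] by simp
  then show ?thesis
    by (simp only: br_sum_right br_scale_right ext_sum ext_pm_scale)
qed

text \<open>Moving \<open>iota r\<close> past \<open>ext y\<close> leaves behind the coordinate of
  \<open>y\<close> at \<open>r\<close>, and these terms add up to the bracket; so the adjoint action
  is a derivation of the wedge product.\<close>

lemma ad_ext:
  assumes "keys y \<subseteq> R"
  shows "ad x (ext y v) = ext (br x y) v + ext y (ad x v)"
proof -
  have "ad x (ext y v) = (\<Sum>r\<in>R. fun_scale (lookup y r) (ext (br x (e r)) v)
      - ext (br x (e r)) (ext y (iota r v)))"
    unfolding ad_def by (intro sum.cong) (simp_all add: iota_ext ext_linear)
  also have "\<dots> = (\<Sum>r\<in>R. fun_scale (lookup y r) (ext (br x (e r)) v)
      + ext y (ext (br x (e r)) (iota r v)))"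
    by (intro sum.cong refl) (subst ext_ext, simp)
  also have "\<dots> = ext (br x y) v + ext y (ad x v)"
    by (simp add: sum.distrib ext_br_right[OF assms] ad_def ext_linear)
  finally show ?thesis .
qed

text \<open>Cartan's formula. Moving \<open>ext y\<close> past both annihilators produces the terms
  in which one of them meets \<open>y\<close>; over all pairs these add up to minus the adjoint
  action of \<open>y\<close>.\<close>

lemma bnd_ext:
  assumes "keys y \<subseteq> R"
  shows "bnd (ext y v) = - ad y v - ext y (bnd v)"
proof -
  \<comment> \<open>The term in which \<open>iota s\<close> meets \<open>y\<close> while
    \<open>iota r\<close> survives; the opposite term is \<open>h s r\<close>, by antisymmetry of
    the bracket.\<close>
  define h where "h r s = fun_scale (lookup y s) (ext (br (e r) (e s)) (iota r v))" for r s
  have "ext (br (e r) (e s)) (iota r (iota s (ext y v)))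
      = (h r s + h s r) - ext y (ext (br (e r) (e s)) (iota r (iota s v)))"
    if "r \<in> R" "s \<in> R" for r s
  proof -
    have 1: "ext (br (e s) (e r)) w = - ext (br (e r) (e s)) w" for w
      unfolding br_swap[of "e s"]
      by (metis (no_types) add.right_inverse add_eq_0_iff ext_0_left ext_add)
    have "ext (br (e r) (e s)) (iota r (iota s (ext y v)))
      = h r s - fun_scale (lookup y r) (ext (br (e r) (e s)) (iota s v))
        + ext (br (e r) (e s)) (ext y (iota r (iota s v)))"
      using that by (simp add: iota_ext iota_linear ext_linear h_def)
    also have "ext (br (e r) (e s)) (ext y (iota r (iota s v)))
      = - ext y (ext (br (e r) (e s)) (iota r (iota s v)))"
      by (rule ext_ext)
    finally show ?thesis by (simp add: h_def 1)
  qed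
  then have "bnd (ext y v) = (\<Sum>r\<in>R. \<Sum>s\<in>{s\<in>R. r < s}. h r s + h s r) - ext y (bnd v)"
    by (simp add: bnd_def sum_subtractf ext_linear)
  also have "(\<Sum>r\<in>R. \<Sum>s\<in>{s\<in>R. r < s}. h r s + h s r) = (\<Sum>r\<in>R. \<Sum>s\<in>R. h r s)"
    by (rule sum_pairs[symmetric]) (auto simp: finite_R h_def br_self)
  also have "\<dots> = (\<Sum>r\<in>R. ext (br (e r) y) (iota r v))"
    by (simp add: h_def ext_br_right[OF assms])
  also have "\<dots> = (\<Sum>r\<in>R. - ext (br y (e r)) (iota r v))"
  proof (intro sum.cong refl)
    fix r
    show "ext (br (e r) y) (iota r v) = - ext (br y (e r)) (iota r v)"
      unfolding br_swap[of "e r"]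
      by (metis (no_types) add.right_inverse add_eq_0_iff ext_0_left ext_add)
  qed
  finally show ?thesis by (simp add: ad_def sum_negf)
qed

lemma ad_wedge_Nil [simp]: "ad x (wedge []) = 0"
  by (simp add: ad_def ext_linear del: wedge.simps)

lemma bnd_wedge_Nil [simp]: "bnd (wedge []) = 0"
  by (simp add: bnd_def ext_linear iota_linear del: wedge.simps)

text \<open>On a new factor \<open>z\<close> the derivation rule gives mixed terms that are
  symmetric in \<open>x\<close> and \<open>y\<close>, and the terms in which every bracket falls on
  \<open>z\<close> match by Jacobi.\<close>

lemma ad_ad:
  assumes "\<And>z. z \<in> set zs \<Longrightarrow> keys z \<subseteq> R" "keys x \<subseteq> R" "keys y \<subseteq> R"
  shows "ad x (ad y (wedge zs)) = ad (br x y) (wedge zs) + ad y (ad x (wedge zs))"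
  using assms(1)
proof (induction zs)
  case Nil
  show ?case by (simp add: ad_linear del: wedge.simps)
next
  case (Cons z zs)
  define w where "w = wedge zs"
  have z: "keys z \<subseteq> R" using Cons.prems by simp
  have IH: "ad x (ad y w) = ad (br x y) w + ad y (ad x w)"
    unfolding w_def using Cons by simp
  have "ad x (ad y (ext z w)) = ext (br x (br y z)) w + ext (br y z) (ad x w)
      + (ext (br x z) (ad y w) + ext z (ad x (ad y w)))"
    using z assms br_closed by (simp add: ad_ext ad_linear)
  moreover have "ad y (ad x (ext z w)) = ext (br y (br x z)) w + ext (br x z) (ad y w)
      + (ext (br y z) (ad x w) + ext z (ad y (ad x w)))"
    using z assms br_closed by (simp add: ad_ext ad_linear)
  moreover have "ad (br x y) (ext z w) = ext (br (br x y) z) w + ext z (ad (br x y) w)"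
    using z by (rule ad_ext)
  moreover have "ext (br x (br y z)) w = ext (br (br x y) z) w + ext (br y (br x z)) w"
    by (subst jacobi) (rule ext_add)
  ultimately have "ad x (ad y (ext z w)) = ad (br x y) (ext z w) + ad y (ad x (ext z w))"
    by (simp add: IH ext_linear)
  then show ?case by (simp add: w_def)
qed

text \<open>On a new factor \<open>z\<close>, Cartan's formula reduces the claim to the commutator
  \<open>ad_ad\<close> of the actions of \<open>x\<close> and \<open>z\<close>.\<close>

lemma bnd_ad:
  assumes "\<And>z. z \<in> set zs \<Longrightarrow> keys z \<subseteq> R" "keys x \<subseteq> R"
  shows "bnd (ad x (wedge zs)) = ad x (bnd (wedge zs))"
  using assms(1)
proof (induction zs)
  case Nil
  show ?case by (simp add: ad_linear bnd_linear del: wedge.simps)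
next
  case (Cons z zs)
  define w where "w = wedge zs"
  have z: "keys z \<subseteq> R" using Cons.prems by simp
  have IH: "bnd (ad x w) = ad x (bnd w)"
    unfolding w_def using Cons by simp
  have comm: "ad x (ad z w) = ad (br x z) w + ad z (ad x w)"
    unfolding w_def using Cons.prems assms(2) by (intro ad_ad) auto
  have "bnd (ad x (ext z w)) = - ad (br x z) w - ext (br x z) (bnd w)
      + (- ad z (ad x w) - ext z (ad x (bnd w)))"
    using z assms br_closed by (simp add: ad_ext bnd_ext bnd_linear IH)
  moreover have "ad x (bnd (ext z w)) =
      - ad x (ad z w) - (ext (br x z) (bnd w) + ext z (ad x (bnd w)))"
    using z assms by (simp add: ad_ext bnd_ext ad_linear)
  ultimately have "bnd (ad x (ext z w)) = ad x (bnd (ext z w))"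
    by (simp add: comm)
  then show ?case by (simp add: w_def)
qed

text \<open>When Cartan's formula is applied twice, the two terms with the adjoint action cancel by
  \<open>bnd_ad\<close> and the rest is the induction hypothesis.\<close>

lemma bnd_bnd_wedge:
  assumes "\<And>z. z \<in> set zs \<Longrightarrow> keys z \<subseteq> R"
  shows "bnd (bnd (wedge zs)) = 0"
  using assms
proof (induction zs)
  case Nil
  show ?case by (simp add: bnd_linear del: wedge.simps)
next
  case (Cons z zs)
  have z: "keys z \<subseteq> R" using Cons.prems by simp
  have "bnd (ad z (wedge zs)) = ad z (bnd (wedge zs))"
    using Cons.prems by (intro bnd_ad) auto
  moreover have "bnd (bnd (wedge zs)) = 0" using Cons by simp
  ultimately show ?case
    using z by (simp only: wedge.simps bnd_ext bnd_linear ext_linear) simp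
qed

section \<open>Agreement with the formulas on tuples\<close>

lemma nths_Cons_compl:
  "nths (y # ys) (- {0}) = ys"
  "nths (y # ys) (- {Suc i}) = y # nths ys (- {i})"
  "nths (y # ys) (- {0, Suc i}) = nths ys (- {i})"
  "nths (y # ys) (- {Suc i, Suc j}) = y # nths ys (- {i, j})"
proof -
  have *: "{j. Suc j \<in> - {0}} = UNIV" "{j. Suc j \<in> - {Suc i}} = - {i}"
    "{j. Suc j \<in> - {0, Suc i}} = - {i}" "{k. Suc k \<in> - {Suc i, Suc j}} = - {i, j}"
    by auto
  show "nths (y # ys) (- {0}) = ys"
  "nths (y # ys) (- {Suc i}) = y # nths ys (- {i})"
  "nths (y # ys) (- {0, Suc i}) = nths ys (- {i})"
  "nths (y # ys) (- {Suc i, Suc j}) = y # nths ys (- {i, j})"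
    unfolding nths_Cons * by (simp_all add: nths_all)
qed

text \<open>The sign counts the factors that the bracket at position \<open>i\<close> passes on its
  way to the front, one for each step of the induction.\<close>

lemma ad_wedge:
  assumes "\<And>y. y \<in> set ys \<Longrightarrow> keys y \<subseteq> R"
  shows "ad x (wedge ys) =
    (\<Sum>i<length ys. fun_scale ((-1) ^ i) (wedge (br x (ys ! i) # nths ys (- {i}))))"
  using assms
proof (induction ys)
  case Nil
  show ?case by (simp del: wedge.simps)
next
  case (Cons y ys)
  have y: "keys y \<subseteq> R" using Cons.prems by simp
  have "ext y (ad x (wedge ys)) = (\<Sum>i<length ys. ext y (fun_scale ((-1) ^ i)
      (wedge (br x (ys ! i) # nths ys (- {i})))))"
    using Cons by (simp add: ext_linear)
  also have "\<dots> = (\<Sum>i<length ys. fun_scale ((-1) ^ Suc i)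
      (wedge (br x (ys ! i) # y # nths ys (- {i}))))"
  proof (intro sum.cong refl)
    fix i
    have "ext y (ext (br x (ys ! i)) (wedge (nths ys (- {i})))) =
      - ext (br x (ys ! i)) (ext y (wedge (nths ys (- {i}))))" by (rule ext_ext)
    then show "ext y (fun_scale ((-1) ^ i) (wedge (br x (ys ! i) # nths ys (- {i})))) =
        fun_scale ((-1) ^ Suc i) (wedge (br x (ys ! i) # y # nths ys (- {i})))"
      by (simp add: ext_linear)
  qed
  finally show ?case
    using ad_ext[OF y, of x "wedge ys"]
    by (simp add: sum.lessThan_Suc_shift nths_Cons_compl del: sum.lessThan_Suc)
qed

text \<open>Both sides satisfy Cartan's recursion: the pairs that contain position 0 give the
  adjoint action of the head, and the remaining pairs give the boundary of the tail.\<close>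

lemma bnd_wedge:
  assumes "\<And>y. y \<in> set ys \<Longrightarrow> keys y \<subseteq> R"
  shows "bnd (wedge ys) =
    (\<Sum>j<length ys. \<Sum>i<j. fun_scale ((-1) ^ (i + j)) (wedge (contract A ys i j)))"
  using assms
proof (induction ys)
  case Nil
  show ?case by (simp del: wedge.simps)
next
  case (Cons y ys)
  have y: "keys y \<subseteq> R" using Cons.prems by simp
  let ?T = "\<lambda>zs i j. fun_scale ((-1) ^ (i + j)) (wedge (contract A zs i j))"
  have "ext y (bnd (wedge ys)) = (\<Sum>j<length ys. \<Sum>i<j. ext y (?T ys i j))"
    using Cons by (simp add: ext_linear)
  \<comment> \<open>Shifting both positions keeps the parity of their sum; the sign arises because
    the bracket is put in front of \<open>y\<close>.\<close>
  also have "\<dots> = (\<Sum>j<length ys. \<Sum>i<j. - ?T (y # ys) (Suc i) (Suc j))"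
  proof (intro sum.cong refl)
    fix i j
    have "ext y (ext (br (ys ! i) (ys ! j)) (wedge (nths ys (- {i, j})))) =
      - ext (br (ys ! i) (ys ! j)) (ext y (wedge (nths ys (- {i, j}))))" by (rule ext_ext)
    then show "ext y (?T ys i j) = - ?T (y # ys) (Suc i) (Suc j)"
      by (simp add: ext_linear contract_def nths_Cons_compl)
  qed
  finally have 1: "(\<Sum>j<length ys. \<Sum>i<j. ?T (y # ys) (Suc i) (Suc j)) = - ext y (bnd (wedge ys))"
    by (simp add: sum_negf)
  have 2: "(\<Sum>j<length ys. ?T (y # ys) 0 (Suc j)) = - ad y (wedge ys)"
  proof -
    have "ad y (wedge ys) =
      (\<Sum>i<length ys. fun_scale ((-1) ^ i) (wedge (br y (ys ! i) # nths ys (- {i}))))"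
      using Cons.prems by (intro ad_wedge) auto
    then show ?thesis
      by (simp add: contract_def nths_Cons_compl sum_negf)
  qed
  have "(\<Sum>j<length (y # ys). \<Sum>i<j. ?T (y # ys) i j) =
     (\<Sum>j<length ys. ?T (y # ys) 0 (Suc j)) + (\<Sum>j<length ys. \<Sum>i<j. ?T (y # ys) (Suc i) (Suc j))"
    by (simp only: length_Cons sum.lessThan_Suc_shift lessThan_0 sum.empty add_0 sum.distrib)
  also have "\<dots> = bnd (wedge (y # ys))"
    unfolding 1 2 using bnd_ext[OF y] by simp
  finally show ?case ..
qed

section \<open>Transposition, grading and the Hodge star\<close>

lemma bnd_adjoint:
  "(\<Sum>S\<in>Pow R. u S * bnd v S) = (\<Sum>S\<in>Pow R. cobnd u S * v S)"
proof -
  have "(\<Sum>S\<in>Pow R. u S * bnd v S) = (\<Sum>r\<in>R. \<Sum>s\<in>{s\<in>R. r < s}.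
      \<Sum>S\<in>Pow R. u S * ext (br (e r) (e s)) (iota r (iota s v)) S)"
    by (simp add: bnd_def pointwise sum_distrib_left sum.swap[of _ "Pow R"])
  also have "\<dots> = (\<Sum>r\<in>R. \<Sum>s\<in>{s\<in>R. r < s}.
      \<Sum>S\<in>Pow R. eps s (eps r (con (br (e r) (e s)) u)) S * v S)"
    by (rule sum.cong[OF refl], rule sum.cong[OF refl]) (simp add: ext_adjoint iota_adjoint)
  also have "\<dots> = (\<Sum>S\<in>Pow R. cobnd u S * v S)"
    by (simp add: cobnd_def pointwise sum_distrib_right sum.swap[of _ "Pow R"])
  finally show ?thesis .
qed

lemma homog_0_iota:
  assumes "homog gr 0 g v"
  shows "iota r v = 0"
proof
  fix S
  have "v (insert r S) = 0"
  proof (rule ccontr)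
    assume "v (insert r S) \<noteq> 0"
    then have "insert r S \<subseteq> R" "card (insert r S) = 0" using assms by (auto simp: homog_def)
    then show False using finite_R finite_subset by fastforce
  qed
  then show "iota r v S = 0 S" by (simp add: iota_def pointwise)
qed

lemma homog_0_bnd: "homog gr 0 g v \<Longrightarrow> bnd v = 0"
  by (simp add: bnd_def homog_0_iota iota_linear ext_linear)

lemma homog_bnd:
  assumes "homog gr (Suc k) g v"
  shows "homog gr k g (bnd v)"
  unfolding bnd_def
proof (intro homog_sum)
  fix r s assume r: "r \<in> R" and s: "s \<in> {s \<in> R. r < s}"
  have 1: "homog gr k (g - gr s) (iota s v)"
    using s assms by (intro homog_iota[of gr k s "g - gr s"]) auto
  show "homog gr k g (ext (br (e r) (e s)) (iota r (iota s v)))"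
  proof (cases k)
    \<comment> \<open>With \<open>k = 0\<close> the first annihilator already reaches degree 0, and
      the second one gives 0.\<close>
    case 0
    then show ?thesis using 1 by (simp add: homog_0_iota ext_linear)
  next
    case (Suc l)
    have "homog gr l (g - gr s - gr r) (iota r (iota s v))"
      using r 1 Suc by (intro homog_iota[of gr l r "g - gr s - gr r"]) auto
    from homog_ext[OF this br_basis[of r s]] show ?thesis using r s Suc by simp
  qed
qed

lemma homog_con:
  assumes "homog gr (Suc k) (h + g) v" "keys x \<subseteq> {r \<in> R. gr r = h}"
  shows "homog gr k g (con x v)"
  unfolding con_def
proof (rule homog_sum)
  fix r assume r: "r \<in> R"
  show "homog gr k g (fun_scale (lookup x r) (iota r v))"
    using assms homog_iota[of gr k r g v] r
    by (cases "r \<in> keys x") (auto simp: in_keys_iff intro!: homog_scale)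
qed

lemma homog_cobnd:
  assumes "homog gr k g v"
  shows "homog gr (Suc k) g (cobnd v)"
  unfolding cobnd_def
proof (intro homog_sum)
  fix r s assume r: "r \<in> R" and s: "s \<in> {s \<in> R. r < s}"
  show "homog gr (Suc k) g (eps s (eps r (con (br (e r) (e s)) v)))"
  proof (cases k)
    case 0
    then show ?thesis using assms by (simp add: con_def homog_0_iota eps_linear)
  next
    case (Suc l)
    have "homog gr l (g - (gr r + gr s)) (con (br (e r) (e s)) v)"
      using r s assms Suc br_basis[of r s] by (intro homog_con) auto
    then have "homog gr (Suc (Suc l)) (gr s + (gr r + (g - (gr r + gr s))))
      (eps s (eps r (con (br (e r) (e s)) v)))"
      using r s by (intro homog_eps) auto
    then show ?thesis using Suc by simp
  qed
qed

text \<open>Moving the contraction past the two creation operators produces the traces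
  of the adjoint maps, which vanish by unimodularity.\<close>

lemma cobnd_star: "cobnd (star v) = - star (bnd v)"
proof -
  define w where "w = star v"
  define h where "h r s = fun_scale (lookup (br (e r) (e s)) r) (eps s w)" for r s
  have "con (br (e r) (e s)) (eps r (eps s w))
      = (h r s + h s r) - eps s (eps r (con (br (e r) (e s)) w))"
    if "r \<in> R" "s \<in> R" for r s
  proof -
    have 1: "lookup (br (e s) (e r)) t = - lookup (br (e r) (e s)) t" for t
      unfolding br_swap[of "e s"] by simp
    have "con (br (e r) (e s)) (eps r (eps s w)) =
        h r s - fun_scale (lookup (br (e r) (e s)) s) (eps r w)
          + eps r (eps s (con (br (e r) (e s)) w))"
      using that by (simp add: con_eps eps_linear h_def)
    also have "eps r (eps s (con (br (e r) (e s)) w)) = - eps s (eps r (con (br (e r) (e s)) w))"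
      using that by (rule eps_eps)
    finally show ?thesis by (simp add: h_def 1)
  qed
  then have "star (bnd v) = (\<Sum>r\<in>R. \<Sum>s\<in>{s\<in>R. r < s}. h r s + h s r) - cobnd w"
    by (simp add: bnd_def cobnd_def star_linear star_ext star_iota sum_subtractf w_def)
  also have "(\<Sum>r\<in>R. \<Sum>s\<in>{s\<in>R. r < s}. h r s + h s r) = (\<Sum>r\<in>R. \<Sum>s\<in>R. h r s)"
    by (rule sum_pairs[symmetric]) (auto simp: finite_R h_def br_self)
  also have "\<dots> = (\<Sum>s\<in>R. fun_scale (\<Sum>r\<in>R. lookup (br (e r) (e s)) r) (eps s w))"
    by (subst sum.swap) (simp add: h_def fn.scale_sum_left)
  also have "\<dots> = 0"
  proof (intro sum.neutral ballI)
    fix s assume "s \<in> R"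
    have "(\<Sum>r\<in>R. lookup (br (e r) (e s)) r) = (\<Sum>r\<in>R. - lookup (br (e s) (e r)) r)"
    proof (intro sum.cong refl)
      fix r
      show "lookup (br (e r) (e s)) r = - lookup (br (e s) (e r)) r"
        unfolding br_swap[of "e r"] by simp
    qed
    also have "\<dots> = 0" using unimodular[OF \<open>s \<in> R\<close>] by (simp add: sum_negf)
    finally show "fun_scale (\<Sum>r\<in>R. lookup (br (e r) (e s)) r) (eps s w) = 0" by simp
  qed
  finally show ?thesis by (simp add: w_def)
qed

text \<open>This is \<open>cobnd_star\<close> conjugated by the star. The hypothesis bounds the
  supports by \<open>R\<close>, where the star can be inverted.\<close>

lemma bnd_star:
  assumes "homog gr k g u"
  shows "bnd (star u) = - star (cobnd u)"
proof -
  have supp: "u S \<noteq> 0 \<Longrightarrow> S \<subseteq> R" for S using assms by (auto simp: homog_def)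
  \<comment> \<open>In natural subtraction the degree is correct unless the star of \<open>u\<close>
    already has degree 0, in which case the boundary vanishes.\<close>
  have "homog gr (card R - k - 1) (sum gr R - g) (bnd (star u))"
    using homog_star[OF assms] by (cases "card R - k") (auto simp: homog_bnd homog_0_bnd)
  then have sub: "bnd (star u) S \<noteq> 0 \<Longrightarrow> S \<subseteq> R" for S by (auto simp: homog_def)
  have "fun_scale (star_sign R) (cobnd u) = - star (bnd (star u))"
    using cobnd_star[of "star u"] star_star[of u, OF supp] by (simp add: cobnd_linear)
  then have "star (fun_scale (star_sign R) (cobnd u)) = star (- star (bnd (star u)))" by simp
  then have "fun_scale (star_sign R) (star (cobnd u)) = - fun_scale (star_sign R) (bnd (star u))"
    using star_star[of "bnd (star u)", OF sub] by (simp add: star_linear)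
  then have "fun_scale (star_sign R) (fun_scale (star_sign R) (star (cobnd u)))
      = - fun_scale (star_sign R) (fun_scale (star_sign R) (bnd (star u)))"
    by (simp add: fn.scale_minus_right)
  then show ?thesis by simp
qed

text \<open>Transposes \<open>bnd_bnd_wedge\<close>, tested on increasing basis tuples, whose wedges
  are the unit vectors. Outside the subsets of \<open>R\<close> the support condition
  decides.\<close>

lemma cobnd_cobnd:
  assumes "homog gr k g u"
  shows "cobnd (cobnd u) = 0"
proof
  fix S
  have h: "homog gr (Suc (Suc k)) g (cobnd (cobnd u))"
    using assms by (intro homog_cobnd)
  show "cobnd (cobnd u) S = 0 S"
  proof (cases "S \<subseteq> R")
    case True
    have "\<And>z. z \<in> set (basis_tuple S :: ('k \<Rightarrow>\<^sub>0 'a) list) \<Longrightarrow> keys z \<subseteq> R"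
      using True by (auto simp: set_basis_tuple)
    from bnd_bnd_wedge[OF this] have 0: "bnd (bnd (wedge (basis_tuple S))) = (0 :: 'k set \<Rightarrow> 'a)" .
    have "cobnd (cobnd u) S = (\<Sum>T\<in>Pow R. if T = S then cobnd (cobnd u) S else 0)"
      using True finite_R by simp
    also have "\<dots> = (\<Sum>T\<in>Pow R. cobnd (cobnd u) T * wedge (basis_tuple S) T)"
      using True by (intro sum.cong refl) (simp add: wedge_basis_tuple)
    also have "\<dots> = 0"
      by (simp add: 0 pointwise flip: bnd_adjoint)
    finally show ?thesis by (simp add: pointwise)
  next
    case False
    then show ?thesis using h by (auto simp: homog_def pointwise)
  qed
qed

section \<open>Alternating forms and chains in coordinates\<close>

definition tuples :: "nat \<Rightarrow> ('k \<Rightarrow>\<^sub>0 'a) list set" where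
  "tuples k = {xs. length xs = k \<and> set xs \<subseteq> lie_carrier A}"

lemma carrier_iff [simp]: "x \<in> lie_carrier A \<longleftrightarrow> keys x \<subseteq> R"
  by (simp add: carrier_eq)

lemma carrier_add: "keys x \<subseteq> R \<Longrightarrow> keys y \<subseteq> R \<Longrightarrow> keys (x + y) \<subseteq> R"
  using keys_add[of x y] by blast

lemma carrier_scale: "keys x \<subseteq> R \<Longrightarrow> keys (pm_scale c x) \<subseteq> R"
  using keys_pm_scale_subset[of c x] by blast

lemma alternating_outside: "f \<in> alternating_forms A k \<Longrightarrow> xs \<notin> tuples k \<Longrightarrow> f xs = 0"
  by (simp add: alternating_forms_def tuples_def)

lemma alternating_add:
  "f \<in> alternating_forms A k \<Longrightarrow> length us + 1 + length vs = k \<Longrightarrow>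
    set us \<union> set vs \<union> {x, y} \<subseteq> lie_carrier A \<Longrightarrow>
    f (us @ (x + y) # vs) = f (us @ x # vs) + f (us @ y # vs)"
  unfolding alternating_forms_def by blast

lemma alternating_scale:
  "f \<in> alternating_forms A k \<Longrightarrow> length us + 1 + length vs = k \<Longrightarrow>
    set us \<union> set vs \<union> {x} \<subseteq> lie_carrier A \<Longrightarrow>
    f (us @ pm_scale c x # vs) = c * f (us @ x # vs)"
  unfolding alternating_forms_def by blast

lemma alternating_not_distinct:
  "f \<in> alternating_forms A k \<Longrightarrow> \<not> distinct xs \<Longrightarrow> f xs = 0"
  unfolding alternating_forms_def by blast

text \<open>Expand the vanishing value at a tuple with \<open>x + y\<close> twice. Outside
  \<open>tuples k\<close> both sides are 0 by the normalisation of forms.\<close>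

lemma alternating_swap:
  assumes f: "f \<in> alternating_forms A k"
  shows "f (us @ x # y # vs) = - f (us @ y # x # vs)"
proof (cases "us @ x # y # vs \<in> tuples k")
  case True
  then have len: "length us + 1 + length (y # vs) = k" "length us + 1 + length (z # vs) = k"
    "length (us @ [z]) + 1 + length vs = k" for z
    by (auto simp: tuples_def)
  have sub: "set us \<subseteq> lie_carrier A" "set vs \<subseteq> lie_carrier A" "x \<in> lie_carrier A" "y \<in> lie_carrier A"
    using True by (auto simp: tuples_def simp del: carrier_iff)
  then have "x + y \<in> lie_carrier A" using carrier_add by simp
  note sub = sub this
  have 1: "f (us @ (x + y) # (x + y) # vs) = 0" "f (us @ x # x # vs) = 0" "f (us @ y # y # vs) = 0"
    by (auto intro!: alternating_not_distinct[OF f])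
  have "f (us @ (x + y) # (x + y) # vs) = f (us @ x # (x + y) # vs) + f (us @ y # (x + y) # vs)"
    by (rule alternating_add[OF f len(2)]) (use sub in auto)
  moreover have "f ((us @ [z]) @ (x + y) # vs) = f ((us @ [z]) @ x # vs) + f ((us @ [z]) @ y # vs)"
    if "z \<in> lie_carrier A" for z
    by (rule alternating_add[OF f len(3)]) (use sub that in auto)
  from this[OF sub(3)] this[OF sub(4)]
  have "f (us @ x # (x + y) # vs) = f (us @ x # x # vs) + f (us @ x # y # vs)"
    "f (us @ y # (x + y) # vs) = f (us @ y # x # vs) + f (us @ y # y # vs)"
    by simp_all
  ultimately have "f (us @ x # y # vs) + f (us @ y # x # vs) = 0"
    using 1 by simp
  then show ?thesis by (simp add: eq_neg_iff_add_eq_0)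
next
  case False
  then have "us @ y # x # vs \<notin> tuples k" by (auto simp: tuples_def)
  with False show ?thesis using alternating_outside[OF f] by simp
qed

text \<open>Sorting \<open>r\<close> into the list costs one transposition per smaller entry. The
  prefix \<open>us\<close> is arbitrary because it absorbs the entries already passed.\<close>

lemma alternating_insort:
  assumes f: "f \<in> alternating_forms A k" and "sorted ss" "distinct ss"
  shows "f (us @ e r # map e ss) =
    (-1) ^ card {s \<in> set ss. s < r} * f (us @ map e (insort r ss))"
  using assms(2,3)
proof (induction ss arbitrary: us)
  case (Cons s ss)
  show ?case
  proof (cases "s < r")
    case True
    have "{t \<in> set (s # ss). t < r} = insert s {t \<in> set ss. t < r}" using True by auto
    then have card: "card {t \<in> set (s # ss). t < r} = Suc (card {t \<in> set ss. t < r})"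
      using Cons.prems by simp
    have "f (us @ e r # map e (s # ss)) = - f ((us @ [e s]) @ e r # map e ss)"
      using alternating_swap[OF f, of us "e r" "e s"] by simp
    also have "\<dots> = - ((-1) ^ card {t \<in> set ss. t < r} * f ((us @ [e s]) @ map e (insort r ss)))"
      using Cons by (subst Cons.IH) auto
    finally show ?thesis using True unfolding card by simp
  next
    case False
    then have "{t \<in> set (s # ss). t < r} = {}" using Cons.prems by auto
    then have "card {t \<in> set (s # ss). t < r} = 0" by (simp only: card.empty)
    moreover have "insort r (s # ss) = r # s # ss" using False by (simp add: not_less)
    ultimately show ?thesis by (simp only: power_0 mult_1 list.map)
  qed
qed simp

text \<open>The sign of sorting \<open>r\<close> into \<open>S\<close> is \<open>sg r S\<close>, and
  a repeated entry gives 0; so filling the first slot acts on the values at increasing tuples as an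
  annihilation operator.\<close>

lemma alternating_basis_tuple:
  assumes f: "f \<in> alternating_forms A k" and "r \<in> R" "S \<subseteq> R"
  shows "f (e r # basis_tuple S) = iota r (\<lambda>T. f (basis_tuple T)) S"
proof -
  have fin: "finite S" using assms finite_R finite_subset by blast
  show ?thesis
  proof (cases "r \<in> S")
    case True
    then have "e r \<in> set (basis_tuple S)" using assms by (simp add: set_basis_tuple)
    then have "f (e r # basis_tuple S) = 0" by (intro alternating_not_distinct[OF f]) simp
    then show ?thesis using True by (simp add: iota_def)
  next
    case False
    have "{s \<in> R \<inter> S. s < r} = {s \<in> set (sorted_list_of_set S). s < r}" using assms(3) fin by auto
    then show ?thesis
      using False fin alternating_insort[OF f, of "sorted_list_of_set S" "[]" r]
      by (simp add: iota_def basis_tuple_def sg_def sorted_list_of_set_insert_remove)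
  qed
qed

lemma alternating_Cons:
  assumes f: "f \<in> alternating_forms A (Suc k)" and x: "x \<in> lie_carrier A"
  shows "(\<lambda>ys. f (x # ys)) \<in> alternating_forms A k"
  unfolding alternating_forms_def
proof (intro CollectI conjI allI impI)
  fix us vs y z
  assume *: "length us + 1 + length vs = k \<and> set us \<union> set vs \<union> {y, z} \<subseteq> lie_carrier A"
  have "f ((x # us) @ (y + z) # vs) = f ((x # us) @ y # vs) + f ((x # us) @ z # vs)"
    by (rule alternating_add[OF f]) (use * x in auto)
  then show "f (x # us @ (y + z) # vs) = f (x # us @ y # vs) + f (x # us @ z # vs)" by simp
next
  fix us vs c y
  assume *: "length us + 1 + length vs = k \<and> set us \<union> set vs \<union> {y} \<subseteq> lie_carrier A"
  have "f ((x # us) @ pm_scale c y # vs) = c * f ((x # us) @ y # vs)"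
    by (rule alternating_scale[OF f]) (use * x in auto)
  then show "f (x # us @ pm_scale c y # vs) = c * f (x # us @ y # vs)" by simp
next
  fix ys assume "\<not> (length ys = k \<and> set ys \<subseteq> lie_carrier A)"
  then show "f (x # ys) = 0" by (intro alternating_outside[OF f]) (auto simp: tuples_def)
next
  fix ys assume "length ys = k \<and> set ys \<subseteq> lie_carrier A \<and> \<not> distinct ys"
  then show "f (x # ys) = 0" by (intro alternating_not_distinct[OF f]) auto
qed

lemma alternating_expand_head:
  assumes f: "f \<in> alternating_forms A (Suc k)" and x: "keys x \<subseteq> R" and ys: "ys \<in> tuples k"
  shows "f (x # ys) = (\<Sum>r\<in>R. lookup x r * f (e r # ys))"
proof -
  have scale: "f (pm_scale c z # ys) = c * f (z # ys)" if "keys z \<subseteq> R" for c z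
    using alternating_scale[OF f, of "[]" ys z c] ys that by (simp add: tuples_def)
  have zero: "f (0 # ys) = 0" using scale[of 0 0] by simp
  \<comment> \<open>Multilinearity holds only for entries in the carrier, so the induction over
    subsets of \<open>R\<close> carries the bound on the keys along.\<close>
  have "keys (\<Sum>r\<in>I. pm_scale (lookup x r) (e r)) \<subseteq> R \<and>
      f ((\<Sum>r\<in>I. pm_scale (lookup x r) (e r)) # ys) = (\<Sum>r\<in>I. lookup x r * f (e r # ys))"
    if "finite I" "I \<subseteq> R" for I
    using that
  proof (induction I rule: finite_induct)
    case (insert r I)
    let ?y = "\<Sum>r\<in>I. pm_scale (lookup x r) (e r)"
    have r: "keys (e r) \<subseteq> R" using insert.prems by simp
    have y: "keys ?y \<subseteq> R" and IH: "f (?y # ys) = (\<Sum>r\<in>I. lookup x r * f (e r # ys))"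
      using insert by auto
    have rx: "keys (pm_scale (lookup x r) (e r)) \<subseteq> R" using r by (rule carrier_scale)
    have "f ((pm_scale (lookup x r) (e r) + ?y) # ys)
        = f (pm_scale (lookup x r) (e r) # ys) + f (?y # ys)"
      using alternating_add[OF f, of "[]" ys "pm_scale (lookup x r) (e r)" ?y] rx y ys
      by (simp add: tuples_def)
    also have "f (pm_scale (lookup x r) (e r) # ys) = lookup x r * f (e r # ys)"
      using r by (rule scale)
    finally show ?case
      using carrier_add[OF rx y] insert.hyps by (simp add: IH del: pm_scale_single)
  qed (simp add: zero)
  from this[OF finite_R subset_refl] show ?thesis
    using expand_basis[OF x] by simp
qed

lemma basis_tuple_in_tuples: "S \<subseteq> R \<Longrightarrow> card S = k \<Longrightarrow> basis_tuple S \<in> tuples k"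
  by (auto simp: tuples_def set_basis_tuple)

text \<open>The zero grading isolates the degree, so that no entry has to be homogeneous.\<close>

lemma homog_wedge_length: "homog (\<lambda>_. 0) (length xs) 0 (wedge xs)"
proof (induction xs)
  case Nil
  show ?case by (auto simp: homog_def)
next
  case (Cons x xs)
  have "homog (\<lambda>_. 0) (Suc (length xs)) (0 + 0) (ext x (wedge xs))"
    unfolding ext_def
  proof (intro homog_sum homog_scale)
    fix r assume "r \<in> R"
    then show "homog (\<lambda>_. 0) (Suc (length xs)) (0 + 0) (eps r (wedge xs))"
      using homog_eps[OF Cons, of r] by simp
  qed
  then show ?case by simp
qed

lemma wedge_nonzero:
  assumes "wedge xs S \<noteq> 0"
  shows "S \<subseteq> R" "card S = length xs"
  using homog_wedge_length[of xs] assms unfolding homog_def by blast+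

text \<open>The values \<open>wedge xs S\<close> are the maximal minors of the coordinate matrix of
  \<open>xs\<close>. Filling the first slot is a contraction by
  \<open>alternating_basis_tuple\<close>, and transposing it moves the head back into the wedge
  product.\<close>

lemma alternating_expand:
  assumes "f \<in> alternating_forms A k" "xs \<in> tuples k"
  shows "f xs = (\<Sum>S\<in>Pow R. f (basis_tuple S) * wedge xs S)"
  using assms
proof (induction xs arbitrary: f k)
  case Nil
  have "(\<Sum>S\<in>Pow R. f (basis_tuple S) * wedge [] S) = (\<Sum>S\<in>Pow R. if S = {} then f [] else 0)"
    by (intro sum.cong) (auto simp: basis_tuple_def)
  then show ?case using finite_R by simp
next
  case (Cons x xs)
  from Cons.prems obtain l where k: "k = Suc l" by (auto simp: tuples_def)
  have x: "keys x \<subseteq> R" and xs: "xs \<in> tuples l" using Cons.prems k by (auto simp: tuples_def)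
  have f: "f \<in> alternating_forms A (Suc l)" using Cons.prems k by simp
  have "f (x # xs) = (\<Sum>r\<in>R. lookup x r * f (e r # xs))"
    using f x xs by (rule alternating_expand_head)
  also have "\<dots> = (\<Sum>r\<in>R. lookup x r * (\<Sum>S\<in>Pow R. iota r (\<lambda>T. f (basis_tuple T)) S * wedge xs S))"
  proof (intro sum.cong refl)
    fix r assume r: "r \<in> R"
    have "f (e r # xs) = (\<Sum>S\<in>Pow R. f (e r # basis_tuple S) * wedge xs S)"
      using alternating_Cons[OF f, of "e r"] r xs by (intro Cons.IH) auto
    also have "\<dots> = (\<Sum>S\<in>Pow R. iota r (\<lambda>T. f (basis_tuple T)) S * wedge xs S)"
      using r by (intro sum.cong refl) (simp add: alternating_basis_tuple[OF f])
    finally show "lookup x r * f (e r # xs) =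
      lookup x r * (\<Sum>S\<in>Pow R. iota r (\<lambda>T. f (basis_tuple T)) S * wedge xs S)" by simp
  qed
  also have "\<dots> = (\<Sum>S\<in>Pow R. con x (\<lambda>T. f (basis_tuple T)) S * wedge xs S)"
    by (simp add: con_def pointwise sum_distrib_left sum_distrib_right sum.swap[of _ R] mult.assoc)
  also have "\<dots> = (\<Sum>S\<in>Pow R. f (basis_tuple S) * wedge (x # xs) S)"
    by (simp add: ext_adjoint)
  finally show ?case .
qed

section \<open>Coordinates of forms and of chains\<close>

definition form :: "('k set \<Rightarrow> 'a) \<Rightarrow> ('k \<Rightarrow>\<^sub>0 'a) list \<Rightarrow> 'a" where
  "form u xs = (if set xs \<subseteq> lie_carrier A then \<Sum>S\<in>Pow R. u S * wedge xs S else 0)"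

definition form_coord :: "(('k \<Rightarrow>\<^sub>0 'a) list \<Rightarrow> 'a) \<Rightarrow> 'k set \<Rightarrow> 'a" where
  "form_coord f S = (if S \<subseteq> R then f (basis_tuple S) else 0)"

definition coord :: "(('k \<Rightarrow>\<^sub>0 'a) list \<Rightarrow>\<^sub>0 'a) \<Rightarrow> 'k set \<Rightarrow> 'a" where
  "coord z S = pairing z (\<lambda>xs. wedge xs S)"

text \<open>A section of \<open>coord\<close> (see \<open>coord_chain\<close>): the representative
  supported on increasing basis tuples.\<close>

definition chain :: "('k set \<Rightarrow> 'a) \<Rightarrow> ('k \<Rightarrow>\<^sub>0 'a) list \<Rightarrow>\<^sub>0 'a" where
  "chain w = (\<Sum>S\<in>Pow R. single (basis_tuple S) (w S))"

lemma form_linear: "form (u + v) = form u + form v" "form (fun_scale c u) = fun_scale c (form u)"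
  "form 0 = 0"
  by (auto simp: form_def pointwise fun_eq_iff algebra_simps sum.distrib sum_distrib_left)

lemma form_coord_linear:
  "form_coord (f + h) = form_coord f + form_coord h"
  "form_coord (fun_scale c f) = fun_scale c (form_coord f)"
  by (auto simp: form_coord_def pointwise fun_eq_iff)

lemma coord_linear:
  "coord (z + w) = coord z + coord w" "coord (pm_scale c z) = fun_scale c (coord z)"
  "coord (z - w) = coord z - coord w" "coord 0 = 0"
  by (auto simp: coord_def pointwise fun_eq_iff pairing_add_left pairing_scale_left
      pairing_diff_left)

lemma coord_single: "coord (single xs c) = fun_scale c (wedge xs)"
  by (auto simp: coord_def pointwise fun_eq_iff)

lemma chain_linear:
  "chain (u + v) = chain u + chain v" "chain (fun_scale c u) = pm_scale c (chain u)"
  by (simp_all add: chain_def pointwise single_add sum.distrib pm.scale_sum_right)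

lemma pairing_chain: "pairing (chain w) f = (\<Sum>S\<in>Pow R. w S * f (basis_tuple S))"
  by (simp add: chain_def pairing_sum_left)

lemma coord_chain:
  assumes "\<And>S. w S \<noteq> 0 \<Longrightarrow> S \<subseteq> R"
  shows "coord (chain w) = w"
proof
  fix T
  have "coord (chain w) T = (\<Sum>S\<in>Pow R. w S * wedge (basis_tuple S) T)"
    by (simp add: coord_def pairing_chain)
  also have "\<dots> = (\<Sum>S\<in>Pow R. if S = T then w T else 0)"
    by (intro sum.cong) (auto simp: wedge_basis_tuple)
  also have "\<dots> = w T" using assms[of T] finite_R by auto
  finally show "coord (chain w) T = w T" .
qed

lemma keys_chain:
  assumes "\<And>S. w S \<noteq> 0 \<Longrightarrow> card S = k"
  shows "keys (chain w) \<subseteq> tuples k"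
  unfolding chain_def
proof (rule keys_sum_subset)
  fix S assume "S \<in> Pow R"
  then show "keys (single (basis_tuple S) (w S)) \<subseteq> tuples k"
    using assms[of S] basis_tuple_in_tuples[of S k] by (cases "w S = 0") auto
qed

text \<open>Reduces evaluation on representatives to the dot product of coordinates, where boundary
  and differential are known to be transposes.\<close>

lemma pairing_form:
  assumes "keys z \<subseteq> tuples k"
  shows "pairing z (form u) = (\<Sum>S\<in>Pow R. u S * coord z S)"
proof -
  have "pairing z (form u) = pairing z (\<lambda>xs. \<Sum>S\<in>Pow R. fun_scale (u S) (\<lambda>xs. wedge xs S) xs)"
    using assms by (intro pairing_cong) (auto simp: form_def pointwise tuples_def)
  also have "\<dots> = (\<Sum>S\<in>Pow R. u S * coord z S)"
    by (simp add: pairing_sum_right pairing_scale_right coord_def)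
  finally show ?thesis .
qed

lemma form_coord_form:
  assumes "\<And>S. u S \<noteq> 0 \<Longrightarrow> S \<subseteq> R"
  shows "form_coord (form u) = u"
proof
  fix T
  show "form_coord (form u) T = u T"
  proof (cases "T \<subseteq> R")
    case True
    have "form u (basis_tuple T) = (\<Sum>S\<in>Pow R. if S = T then u T else 0)"
      using True by (auto simp: form_def wedge_basis_tuple set_basis_tuple intro!: sum.cong)
    then show ?thesis using True finite_R by (simp add: form_coord_def)
  qed (use assms[of T] in \<open>auto simp: form_coord_def\<close>)
qed

lemma form_alternating:
  assumes "\<And>S. u S \<noteq> 0 \<Longrightarrow> card S = k"
  shows "form u \<in> alternating_forms A k"
  unfolding alternating_forms_def
proof (intro CollectI conjI allI impI)
  fix xs assume *: "\<not> (length xs = k \<and> set xs \<subseteq> lie_carrier A)"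
  show "form u xs = 0"
  proof (cases "set xs \<subseteq> lie_carrier A")
    case True
    \<comment> \<open>A tuple of the wrong length has wedge coordinates only at sets of that other
      size, where \<open>u\<close> vanishes.\<close>
    then have "u S * wedge xs S = 0" for S
      using * assms[of S] wedge_nonzero(2)[of xs S] by (metis mult_eq_0_iff)
    then show ?thesis by (simp only: form_def sum.neutral_const if_cancel)
  qed (simp add: form_def)
next
  fix us vs x y
  assume *: "length us + 1 + length vs = k \<and> set us \<union> set vs \<union> {x, y} \<subseteq> lie_carrier A"
  then have "x + y \<in> lie_carrier A" using carrier_add by auto
  with * show "form u (us @ (x + y) # vs) = form u (us @ x # vs) + form u (us @ y # vs)"
    by (simp add: form_def wedge_append_linear pointwise algebra_simps sum.distrib
        del: carrier_iff)
next
  fix us vs c x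
  assume *: "length us + 1 + length vs = k \<and> set us \<union> set vs \<union> {x} \<subseteq> lie_carrier A"
  then have "pm_scale c x \<in> lie_carrier A" using carrier_scale by auto
  with * show "form u (us @ pm_scale c x # vs) = c * form u (us @ x # vs)"
    by (simp add: form_def wedge_append_linear pointwise algebra_simps sum_distrib_left
        del: carrier_iff)
next
  fix xs assume "length xs = k \<and> set xs \<subseteq> lie_carrier A \<and> \<not> distinct xs"
  then show "form u xs = 0" by (simp add: form_def wedge_not_distinct pointwise)
qed

lemma form_form_coord:
  assumes "f \<in> alternating_forms A k"
  shows "form (form_coord f) = f"
proof
  fix xs
  have card: "card S = k" if "form_coord f S \<noteq> 0" for S
    using that alternating_outside[OF assms, of "basis_tuple S"]
    by (auto simp: form_coord_def tuples_def split: if_splits)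
  show "form (form_coord f) xs = f xs"
  proof (cases "xs \<in> tuples k")
    case True
    then show ?thesis
      using alternating_expand[OF assms True] by (simp add: form_def form_coord_def tuples_def)
  next
    case False
    then show ?thesis
      using alternating_outside[OF assms] alternating_outside[OF form_alternating[OF card]] by simp
  qed
qed

section \<open>Cochains, cocycles and coboundaries in coordinates\<close>

lemma homogeneous_iff:
  "homogeneous A xs gs \<longleftrightarrow> list_all2 (\<lambda>x h. keys x \<subseteq> {r \<in> R. gr r = h}) xs gs"
  by (simp add: homogeneous_def piece_eq)

lemma homogeneous_carrier:
  assumes "homogeneous A xs gs"
  shows "set xs \<subseteq> lie_carrier A"
proof
  fix x assume "x \<in> set xs"
  then obtain i where "i < length xs" "x = xs ! i" by (auto simp: in_set_conv_nth)
  then have "keys x \<subseteq> {r \<in> R. gr r = gs ! i}"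
    using assms by (auto simp: homogeneous_iff list_all2_conv_all_nth)
  then show "x \<in> lie_carrier A" by auto
qed

lemma homogeneous_basis_tuple:
  assumes "S \<subseteq> R"
  obtains gs where "homogeneous A (basis_tuple S) gs" "sum_list gs = sum gr S"
proof
  have fin: "finite S" using assms finite_R finite_subset by blast
  show "homogeneous A (basis_tuple S) (map gr (sorted_list_of_set S))"
    using assms fin
    by (auto simp: homogeneous_iff basis_tuple_def list_all2_map1 list_all2_map2
        intro!: list.rel_refl_strong)
  show "sum_list (map gr (sorted_list_of_set S)) = sum gr S"
    using fin by (simp add: sum_list_distinct_conv_sum_set)
qed

lemma form_in_cochains:
  assumes "homog gr k g u"
  shows "form u \<in> cochains A k g"
  unfolding cochains_def
proof (intro CollectI conjI allI impI)
  show "form u \<in> alternating_forms A k"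
    using assms by (intro form_alternating) (auto simp: homog_def)
  fix xs gs assume *: "length xs = k \<and> homogeneous A xs gs \<and> sum_list gs \<noteq> g"
  then have "homog gr k (sum_list gs) (wedge xs)"
    using homog_wedge[of gr xs gs] by (auto simp: homogeneous_iff)
  then have "u S * wedge xs S = 0" for S
    using assms * unfolding homog_def by (metis mult_eq_0_iff)
  then show "form u xs = 0" by (simp only: form_def sum.neutral_const if_cancel)
qed

text \<open>Increasing basis tuples are themselves homogeneous, so the vanishing condition on
  cochains applies to them directly.\<close>

lemma homog_form_coord:
  assumes "f \<in> cochains A k g"
  shows "homog gr k g (form_coord f)"
  unfolding homog_def
proof (intro allI impI)
  fix S assume "form_coord f S \<noteq> 0"
  then have S: "S \<subseteq> R" and f: "f (basis_tuple S) \<noteq> 0"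
    by (auto simp: form_coord_def split: if_splits)
  have alt: "f \<in> alternating_forms A k" using assms by (simp add: cochains_def)
  have "card S = k"
    using f alternating_outside[OF alt, of "basis_tuple S"] by (auto simp: tuples_def)
  moreover obtain gs where "homogeneous A (basis_tuple S) gs" "sum_list gs = sum gr S"
    using homogeneous_basis_tuple[OF S] .
  ultimately have "sum gr S = g"
    using f assms unfolding cochains_def by (metis (mono_tags, lifting) length_basis_tuple mem_Collect_eq)
  then show "S \<subseteq> R \<and> card S = k \<and> sum gr S = g" using S \<open>card S = k\<close> by simp
qed

lemma cochains_form:
  assumes "f \<in> cochains A k g"
  shows "form (form_coord f) = f"
  using assms by (intro form_form_coord[of _ k]) (simp add: cochains_def)

lemma form_coord_form_homog: "homog gr k g u \<Longrightarrow> form_coord (form u) = u"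
  by (rule form_coord_form) (auto simp: homog_def)

lemma cochains_iff: "f \<in> cochains A k g \<longleftrightarrow> (\<exists>u. homog gr k g u \<and> f = form u)"
  using homog_form_coord cochains_form form_in_cochains by metis

lemma contract_in_tuples:
  assumes "xs \<in> tuples k" "i < j" "j < length xs"
  shows "contract A xs i j \<in> tuples (k - 1)"
proof -
  have "xs ! i \<in> lie_carrier A" "xs ! j \<in> lie_carrier A" "set (nths xs (- {i, j})) \<subseteq> lie_carrier A"
    using assms set_nths_subset[of xs "- {i, j}"] by (auto simp: tuples_def simp del: carrier_iff)
  moreover have "length (nths xs (- {i, j})) = length xs - 2"
  proof -
    have "{l. l < length xs \<and> l \<in> - {i, j}} = {..<length xs} - {i, j}" by auto
    then show ?thesis using assms by (simp add: length_nths card_Diff_subset)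
  qed
  ultimately show ?thesis
    using assms br_closed by (auto simp: tuples_def contract_def)
qed

text \<open>The wedges of the contracted tuples add up to the boundary by \<open>bnd_wedge\<close>;
  transposing it gives the differential of the coordinates.\<close>

lemma ce_differential_form: "ce_differential A (form u) = form (cobnd u)"
proof
  fix xs
  show "ce_differential A (form u) xs = form (cobnd u) xs"
  proof (cases "set xs \<subseteq> lie_carrier A")
    case True
    then have xs: "xs \<in> tuples (length xs)" by (simp add: tuples_def)
    have "form u (contract A xs i j) = (\<Sum>S\<in>Pow R. u S * wedge (contract A xs i j) S)"
      if "i < j" "j < length xs" for i j
      using contract_in_tuples[OF xs that] by (simp add: form_def tuples_def)
    then have "ce_differential A (form u) xs = (\<Sum>j<length xs. \<Sum>i<j. (-1) ^ (i + j) *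
        (\<Sum>S\<in>Pow R. u S * wedge (contract A xs i j) S))"
      using True by (simp add: ce_differential_def)
    also have "\<dots> = (\<Sum>S\<in>Pow R. u S * bnd (wedge xs) S)"
      using True by (subst bnd_wedge, metis carrier_iff subsetD)
        (simp add: pointwise sum_distrib_left sum.swap[of _ "Pow R"] algebra_simps)
    also have "\<dots> = form (cobnd u) xs"
      using True by (simp add: bnd_adjoint form_def)
    finally show ?thesis .
  qed (simp add: ce_differential_def form_def)
qed

lemma cocycles_iff:
  "f \<in> cocycles A k g \<longleftrightarrow> (\<exists>u. homog gr k g u \<and> cobnd u = 0 \<and> f = form u)"
proof
  assume "f \<in> cocycles A k g"
  then obtain u where u: "homog gr k g u" "f = form u" "form (cobnd u) = 0"
    by (auto simp: cocycles_def cochains_iff ce_differential_form)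
  then have "cobnd u = form_coord 0"
    using form_coord_form_homog[OF homog_cobnd[OF u(1)]] by simp
  also have "\<dots> = 0" by (simp add: form_coord_def pointwise fun_eq_iff)
  finally show "\<exists>u. homog gr k g u \<and> cobnd u = 0 \<and> f = form u" using u by blast
next
  assume "\<exists>u. homog gr k g u \<and> cobnd u = 0 \<and> f = form u"
  then show "f \<in> cocycles A k g"
    by (auto simp: cocycles_def cochains_iff ce_differential_form form_linear)
qed

text \<open>In degree 0 the zero space is encoded by \<open>w = 0\<close>, because natural
  subtraction would make \<open>k - 1\<close> equal to 0 again.\<close>

lemma coboundaries_iff:
  "f \<in> coboundaries A k g \<longleftrightarrow>
    (\<exists>w. (if k = 0 then w = 0 else homog gr (k - 1) g w) \<and> f = form (cobnd w))"
  by (auto simp: coboundaries_def image_iff Bex_def cochains_iff ce_differential_form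
      cobnd_linear form_linear)

lemma coboundaries_subset: "coboundaries A k g \<subseteq> cocycles A k g"
proof
  fix f assume "f \<in> coboundaries A k g"
  then obtain w where w: "if k = 0 then w = 0 else homog gr (k - 1) g w" "f = form (cobnd w)"
    by (auto simp: coboundaries_iff)
  show "f \<in> cocycles A k g"
  proof (cases k)
    case 0
    then show ?thesis using w by (auto simp: cocycles_iff cobnd_linear intro!: exI[of _ 0])
  next
    case (Suc l)
    then show ?thesis
      using w homog_cobnd[of l g w] cobnd_cobnd[of l g w] by (auto simp: cocycles_iff)
  qed
qed

lemma subspace_cocycles: "fn.subspace (cocycles A k g)"
proof (rule fn.subspaceI)
  show "0 \<in> cocycles A k g"
    by (auto simp: cocycles_iff form_linear cobnd_linear intro!: exI[of _ 0])
  fix f h assume "f \<in> cocycles A k g" "h \<in> cocycles A k g"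
  then obtain u v where "homog gr k g u" "cobnd u = 0" "f = form u"
    "homog gr k g v" "cobnd v = 0" "h = form v" by (auto simp: cocycles_iff)
  then show "f + h \<in> cocycles A k g"
    unfolding cocycles_iff
    by (intro exI[of _ "u + v"]) (simp add: homog_add form_linear cobnd_linear)
next
  fix c f assume "f \<in> cocycles A k g"
  then obtain u where "homog gr k g u" "cobnd u = 0" "f = form u" by (auto simp: cocycles_iff)
  then show "fun_scale c f \<in> cocycles A k g"
    unfolding cocycles_iff
    by (intro exI[of _ "fun_scale c u"]) (simp add: homog_scale form_linear cobnd_linear)
qed

lemma subspace_coboundaries: "fn.subspace (coboundaries A k g)"
proof (rule fn.subspaceI)
  show "0 \<in> coboundaries A k g"
    by (auto simp: coboundaries_iff form_linear cobnd_linear intro!: exI[of _ 0])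
  fix f h assume "f \<in> coboundaries A k g" "h \<in> coboundaries A k g"
  then obtain u v where "if k = 0 then u = 0 else homog gr (k - 1) g u" "f = form (cobnd u)"
    "if k = 0 then v = 0 else homog gr (k - 1) g v" "h = form (cobnd v)"
    by (auto simp: coboundaries_iff)
  then show "f + h \<in> coboundaries A k g"
    unfolding coboundaries_iff
    by (intro exI[of _ "u + v"]) (simp add: homog_add form_linear cobnd_linear split: if_splits)
next
  fix c f assume "f \<in> coboundaries A k g"
  then obtain u where "if k = 0 then u = 0 else homog gr (k - 1) g u" "f = form (cobnd u)"
    by (auto simp: coboundaries_iff)
  then show "fun_scale c f \<in> coboundaries A k g"
    unfolding coboundaries_iff
    by (intro exI[of _ "fun_scale c u"])
      (simp add: homog_scale form_linear cobnd_linear split: if_splits)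
qed

section \<open>The exterior power as a quotient of the free space\<close>

lemma keys_span:
  assumes "z \<in> pm.span B" "\<And>b. b \<in> B \<Longrightarrow> keys b \<subseteq> X"
  shows "keys z \<subseteq> X"
  using assms
proof (induction rule: pm.span_induct_alt)
  case (step c x y)
  then show ?case using keys_add[of "pm_scale c x" y] keys_pm_scale_subset[of c x] by blast
qed simp

lemma tuples_keys: "xs \<in> tuples k \<Longrightarrow> y \<in> set xs \<Longrightarrow> keys y \<subseteq> R"
  unfolding tuples_def carrier_eq by blast

lemma keys_single_subset: "x \<in> X \<Longrightarrow> keys (single x c) \<subseteq> X"
  by (cases "c = 0") auto

lemma keys_diff_subset: "keys x \<subseteq> X \<Longrightarrow> keys y \<subseteq> X \<Longrightarrow> keys (x - y :: 'b \<Rightarrow>\<^sub>0 'a) \<subseteq> X"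
  using keys_diff[of x y] by blast

lemma keys_wedge_relations:
  assumes "z \<in> wedge_relations A k"
  shows "keys z \<subseteq> tuples k"
  using assms unfolding wedge_relations_def
proof (elim UnE CollectE exE conjE)
  fix us vs x y
  assume z: "z = single (us @ (x + y) # vs) 1 - single (us @ x # vs) 1 - single (us @ y # vs) 1"
    and "length us + 1 + length vs = k" "set us \<union> set vs \<union> {x, y} \<subseteq> lie_carrier A"
  moreover from this have "x + y \<in> lie_carrier A" by (simp add: carrier_add)
  ultimately show "keys z \<subseteq> tuples k"
    unfolding z by (intro keys_diff_subset keys_single_subset) (auto simp: tuples_def simp del: carrier_iff)
next
  fix us vs c x
  assume z: "z = single (us @ pm_scale c x # vs) 1 - pm_scale c (single (us @ x # vs) 1)"
    and "length us + 1 + length vs = k" "set us \<union> set vs \<union> {x} \<subseteq> lie_carrier A"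
  moreover from this have "pm_scale c x \<in> lie_carrier A" by (simp add: carrier_scale)
  ultimately show "keys z \<subseteq> tuples k"
    unfolding z pm_scale_single
    by (intro keys_diff_subset keys_single_subset) (auto simp: tuples_def simp del: carrier_iff)
next
  fix xs
  assume "z = single xs 1" "length xs = k" "set xs \<subseteq> lie_carrier A"
  then show "keys z \<subseteq> tuples k"
    by (simp add: tuples_def)
qed

lemma keys_span_relations: "z \<in> pm.span (wedge_relations A k) \<Longrightarrow> keys z \<subseteq> tuples k"
  by (erule keys_span) (rule keys_wedge_relations)

lemma coord_wedge_relations:
  assumes "z \<in> wedge_relations A k"
  shows "coord z = 0"
  using assms
  by (auto simp: wedge_relations_def coord_linear coord_single wedge_append_linear
      wedge_not_distinct simp del: pm_scale_single)

lemma coord_span_relations: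
  assumes "z \<in> pm.span (wedge_relations A k)"
  shows "coord z = 0"
  using assms
  by (induction rule: pm.span_induct_alt) (auto simp: coord_linear coord_wedge_relations)

text \<open>A functional killing all relations is, on \<open>tuples k\<close>, an alternating form;
  its value on \<open>z\<close> therefore depends only on the coordinates of \<open>z\<close>. If
  these vanish, no functional separates \<open>z\<close> from the relations.\<close>

lemma span_relations_iff:
  "z \<in> pm.span (wedge_relations A k) \<longleftrightarrow> keys z \<subseteq> tuples k \<and> coord z = 0"
proof
  assume z: "keys z \<subseteq> tuples k \<and> coord z = 0"
  show "z \<in> pm.span (wedge_relations A k)"
  proof (rule ccontr)
    assume "z \<notin> pm.span (wedge_relations A k)"
    then obtain f where f: "\<And>b. b \<in> wedge_relations A k \<Longrightarrow> pairing b f = 0" "pairing z f \<noteq> 0"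
      using separating_functional by blast
    \<comment> \<open>The separating functional is arbitrary on lists outside
      \<open>tuples k\<close>; forms must vanish there.\<close>
    define h where "h xs = (if xs \<in> tuples k then f xs else 0)" for xs
    have fh: "pairing b h = pairing b f" if "keys b \<subseteq> tuples k" for b
      using that by (intro pairing_cong) (auto simp: h_def)
    have rel: "pairing b h = 0" if "b \<in> wedge_relations A k" for b
      using that f(1) fh keys_wedge_relations by simp
    have "h \<in> alternating_forms A k"
      unfolding alternating_forms_def
    proof (intro CollectI conjI allI impI)
      fix xs assume "\<not> (length xs = k \<and> set xs \<subseteq> lie_carrier A)"
      then show "h xs = 0" by (auto simp: h_def tuples_def)
    next
      fix us vs x y
      assume "length us + 1 + length vs = k \<and> set us \<union> set vs \<union> {x, y} \<subseteq> lie_carrier A"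
      then have "single (us @ (x + y) # vs) 1 - single (us @ x # vs) 1 - single (us @ y # vs) 1
          \<in> wedge_relations A k"
        unfolding wedge_relations_def by blast
      from rel[OF this] show "h (us @ (x + y) # vs) = h (us @ x # vs) + h (us @ y # vs)"
        by (simp add: pairing_diff_left pairing_add_left algebra_simps)
    next
      fix us vs c x
      assume "length us + 1 + length vs = k \<and> set us \<union> set vs \<union> {x} \<subseteq> lie_carrier A"
      then have "single (us @ pm_scale c x # vs) 1 - pm_scale c (single (us @ x # vs) 1)
          \<in> wedge_relations A k"
        unfolding wedge_relations_def by blast
      from rel[OF this] show "h (us @ pm_scale c x # vs) = c * h (us @ x # vs)"
        by (simp add: pairing_diff_left)
    next
      fix xs assume "length xs = k \<and> set xs \<subseteq> lie_carrier A \<and> \<not> distinct xs"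
      then have "single xs 1 \<in> wedge_relations A k"
        unfolding wedge_relations_def by blast
      from rel[OF this] show "h xs = 0" by simp
    qed
    then have "h = form (form_coord h)" by (simp add: form_form_coord)
    then have "pairing z h = 0"
      using pairing_form[of z k "form_coord h"] z by (simp add: pointwise)
    then show False using f(2) fh z by simp
  qed
qed (auto dest: keys_span_relations coord_span_relations)

lemma homog_coord_chains_aux:
  assumes "z \<in> chains A k g"
  shows "keys z \<subseteq> tuples k \<and> homog gr k g (coord z)"
  using assms unfolding chains_def
proof (induction rule: pm.span_induct_alt)
  case base
  show ?case by (simp add: coord_linear)
next
  case (step c x y)
  have "keys x \<subseteq> tuples k \<and> homog gr k g (coord x)"
  proof (cases "x \<in> wedge_relations A k")
    case True
    then show ?thesis by (simp add: keys_wedge_relations coord_wedge_relations)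
  next
    case False
    then obtain xs gs where x: "x = single xs 1" "length xs = k" "homogeneous A xs gs"
      "sum_list gs = g" using step.hyps by blast
    then have "homog gr k g (wedge xs)"
      using homog_wedge[of gr xs gs] by (simp add: homogeneous_iff)
    then show ?thesis
      using x homogeneous_carrier[OF x(3)] by (simp add: coord_single tuples_def)
  qed
  moreover have "keys (pm_scale c x + y) \<subseteq> keys x \<union> keys y"
    using keys_add[of "pm_scale c x" y] keys_pm_scale_subset[of c x] by blast
  ultimately show ?case
    using step.IH by (auto simp: coord_linear homog_add homog_scale)
qed

lemma chain_in_chains:
  assumes "homog gr k g w"
  shows "chain w \<in> chains A k g"
  unfolding chain_def chains_def
proof (intro pm.span_sum)
  fix S assume S: "S \<in> Pow R"
  obtain gs where gs: "homogeneous A (basis_tuple S) gs" "sum_list gs = sum gr S"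
    using homogeneous_basis_tuple S by blast
  let ?B = "{single xs 1 | xs gs. length xs = k \<and> homogeneous A xs gs \<and> sum_list gs = g}
    \<union> wedge_relations A k"
  show "single (basis_tuple S) (w S) \<in> pm.span ?B"
  proof (cases "w S = 0")
    case False
    then have "card S = k" "sum gr S = g" using assms by (auto simp: homog_def)
    then have "single (basis_tuple S) 1 \<in> ?B" using gs by auto
    then have "pm_scale (w S) (single (basis_tuple S) 1) \<in> pm.span ?B"
      by (intro pm.span_scale pm.span_base)
    then show ?thesis by simp
  qed (simp add: pm.span_zero)
qed

lemma span_relations_subset_chains: "pm.span (wedge_relations A k) \<subseteq> chains A k g"
  unfolding chains_def by (intro pm.span_mono) auto

lemma diff_chain_coord:
  assumes "keys z \<subseteq> tuples k" "homog gr k g (coord z)"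
  shows "z - chain (coord z) \<in> pm.span (wedge_relations A k)"
  unfolding span_relations_iff
proof
  have "keys (chain (coord z)) \<subseteq> tuples k"
    using assms(2) by (intro keys_chain) (auto simp: homog_def)
  then show "keys (z - chain (coord z)) \<subseteq> tuples k"
    using assms(1) keys_diff[of z "chain (coord z)"] by blast
  have "coord (chain (coord z)) = coord z"
    using assms(2) by (intro coord_chain) (auto simp: homog_def)
  then show "coord (z - chain (coord z)) = 0" by (simp add: coord_linear)
qed

text \<open>Modulo the relations, \<open>z\<close> equals the representative
  \<open>chain (coord z)\<close>, which visibly has the right degree and grade.\<close>

lemma chains_iff: "z \<in> chains A k g \<longleftrightarrow> keys z \<subseteq> tuples k \<and> homog gr k g (coord z)"
proof
  assume *: "keys z \<subseteq> tuples k \<and> homog gr k g (coord z)"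
  then have "z - chain (coord z) \<in> chains A k g" "chain (coord z) \<in> chains A k g"
    using diff_chain_coord chain_in_chains span_relations_subset_chains by blast+
  then have "(z - chain (coord z)) + chain (coord z) \<in> chains A k g"
    unfolding chains_def by (rule pm.span_add)
  then show "z \<in> chains A k g" by simp
qed (rule homog_coord_chains_aux)

section \<open>Cycles and boundaries in coordinates\<close>

lemma pairing_ce_boundary:
  "pairing (ce_boundary A z) f =
    pairing z (\<lambda>xs. \<Sum>j<length xs. \<Sum>i<j. (-1) ^ (i + j) * f (contract A xs i j))"
  by (simp add: ce_boundary_def pairing_sum_left pairing_scale_left pairing_def[of z])

lemma coord_ce_boundary:
  assumes "keys z \<subseteq> tuples k"
  shows "coord (ce_boundary A z) = bnd (coord z)"
proof -
  have z: "coord z = (\<Sum>xs\<in>keys z. fun_scale (lookup z xs) (wedge xs))"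
    by (simp add: coord_def pairing_def pointwise fun_eq_iff)
  have "bnd (coord z) = (\<Sum>xs\<in>keys z. fun_scale (lookup z xs) (bnd (wedge xs)))"
    unfolding z by (simp add: bnd_linear)
  also have "\<dots> = (\<Sum>xs\<in>keys z. fun_scale (lookup z xs)
      (\<Sum>j<length xs. \<Sum>i<j. fun_scale ((-1) ^ (i + j)) (wedge (contract A xs i j))))"
  proof (rule sum.cong[OF refl])
    fix xs assume "xs \<in> keys z"
    then have "xs \<in> tuples k" using assms by blast
    then show "fun_scale (lookup z xs) (bnd (wedge xs)) = fun_scale (lookup z xs)
      (\<Sum>j<length xs. \<Sum>i<j. fun_scale ((-1) ^ (i + j)) (wedge (contract A xs i j)))"
      by (subst bnd_wedge) (rule tuples_keys, assumption+, rule refl)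
  qed
  also have "\<dots> = coord (ce_boundary A z)"
    unfolding coord_def pairing_ce_boundary by (simp add: pairing_def pointwise fun_eq_iff)
  finally show ?thesis ..
qed

lemma keys_ce_boundary:
  assumes "keys z \<subseteq> tuples k"
  shows "keys (ce_boundary A z) \<subseteq> tuples (k - 1)"
  unfolding ce_boundary_def
proof (intro keys_sum_subset)
  fix xs assume "xs \<in> keys z"
  then have xs: "xs \<in> tuples k" using assms by blast
  have "keys (\<Sum>j<length xs. \<Sum>i<j. single (contract A xs i j) ((-1) ^ (i + j) :: 'a))
    \<subseteq> tuples (k - 1)"
    using contract_in_tuples[OF xs] by (intro keys_sum_subset) auto
  then show "keys (pm_scale (lookup z xs)
      (\<Sum>j<length xs. \<Sum>i<j. single (contract A xs i j) ((-1) ^ (i + j)))) \<subseteq> tuples (k - 1)"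
    by (rule order_trans[OF keys_pm_scale_subset])
qed

lemma ce_boundary_in_chains:
  assumes "z \<in> chains A (Suc k) g"
  shows "ce_boundary A z \<in> chains A k g"
  using assms keys_ce_boundary[of z "Suc k"] coord_ce_boundary[of z "Suc k"]
  by (auto simp: chains_iff homog_bnd)

lemma cycles_iff: "z \<in> cycles A k g \<longleftrightarrow> z \<in> chains A k g \<and> bnd (coord z) = 0"
  using keys_ce_boundary[of z k] coord_ce_boundary[of z k]
  by (auto simp: cycles_def chains_iff span_relations_iff)

lemma boundaries_iff:
  "z \<in> boundaries A k g \<longleftrightarrow> keys z \<subseteq> tuples k \<and> (\<exists>w. homog gr (Suc k) g w \<and> coord z = bnd w)"
proof
  assume "z \<in> boundaries A k g"
  then show "keys z \<subseteq> tuples k \<and> (\<exists>w. homog gr (Suc k) g w \<and> coord z = bnd w)"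
    unfolding boundaries_def
  proof (induction rule: pm.span_induct_alt)
    case base
    show ?case by (auto simp: coord_linear bnd_linear intro!: exI[of _ 0])
  next
    case (step c x y)
    have "keys x \<subseteq> tuples k \<and> (\<exists>w. homog gr (Suc k) g w \<and> coord x = bnd w)"
    proof (cases "x \<in> wedge_relations A k")
      case True
      then show ?thesis
        by (auto simp: keys_wedge_relations coord_wedge_relations bnd_linear intro!: exI[of _ 0])
    next
      case False
      then obtain z' where z': "x = ce_boundary A z'" "z' \<in> chains A (Suc k) g"
        using step.hyps by blast
      then have "keys z' \<subseteq> tuples (Suc k)" "homog gr (Suc k) g (coord z')"
        by (auto simp: chains_iff)
      then show ?thesis
        using keys_ce_boundary[of z' "Suc k"] coord_ce_boundary[of z' "Suc k"] z' by auto
    qed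
    then obtain w where w: "keys x \<subseteq> tuples k" "homog gr (Suc k) g w" "coord x = bnd w" by blast
    obtain w' where w': "keys y \<subseteq> tuples k" "homog gr (Suc k) g w'" "coord y = bnd w'"
      using step.IH by blast
    have "keys (pm_scale c x + y) \<subseteq> tuples k"
      using keys_add[of "pm_scale c x" y] keys_pm_scale_subset[of c x] w(1) w'(1) by blast
    moreover have "homog gr (Suc k) g (fun_scale c w + w')"
      using w w' by (intro homog_add homog_scale)
    moreover have "coord (pm_scale c x + y) = bnd (fun_scale c w + w')"
      by (simp only: coord_linear bnd_linear w w')
    ultimately show ?case by blast
  qed
next
  assume "keys z \<subseteq> tuples k \<and> (\<exists>w. homog gr (Suc k) g w \<and> coord z = bnd w)"
  then obtain w where w: "keys z \<subseteq> tuples k" "homog gr (Suc k) g w" "coord z = bnd w" by blast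
  have cw: "chain w \<in> chains A (Suc k) g" using w(2) by (rule chain_in_chains)
  then have kw: "keys (chain w) \<subseteq> tuples (Suc k)" by (simp add: chains_iff)
  have "coord (chain w) = w" using w(2) by (intro coord_chain) (auto simp: homog_def)
  \<comment> \<open>The coordinate preimage \<open>w\<close> is lifted to a chain; the boundary of
    the lift differs from \<open>z\<close> by relations only.\<close>
  then have "coord (z - ce_boundary A (chain w)) = 0"
    by (simp only: coord_linear coord_ce_boundary[OF kw] w(3) diff_self)
  moreover have "keys (z - ce_boundary A (chain w)) \<subseteq> tuples k"
    using keys_diff[of z "ce_boundary A (chain w)"] keys_ce_boundary[OF kw] w(1) by auto
  ultimately have "z - ce_boundary A (chain w) \<in> pm.span (wedge_relations A k)"
    by (simp only: span_relations_iff)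
  then have "z - ce_boundary A (chain w) \<in> boundaries A k g"
    unfolding boundaries_def using pm.span_mono by blast
  moreover have "ce_boundary A (chain w) \<in> boundaries A k g"
    unfolding boundaries_def using cw by (intro pm.span_base) auto
  ultimately have "(z - ce_boundary A (chain w)) + ce_boundary A (chain w) \<in> boundaries A k g"
    unfolding boundaries_def by (rule pm.span_add)
  then show "z \<in> boundaries A k g" by simp
qed

lemma subspace_boundaries: "pm.subspace (boundaries A k g)"
  unfolding boundaries_def by (rule pm.subspace_span)

lemma subspace_cycles: "pm.subspace (cycles A k g)"
proof (rule pm.subspaceI)
  have sub: "pm.subspace (chains A k g)" unfolding chains_def by (rule pm.subspace_span)
  show "0 \<in> cycles A k g"
    using pm.subspace_0[OF sub] by (simp add: cycles_iff coord_linear bnd_linear)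
  fix x y assume "x \<in> cycles A k g" "y \<in> cycles A k g"
  then show "x + y \<in> cycles A k g"
    using pm.subspace_add[OF sub] by (simp add: cycles_iff coord_linear bnd_linear)
next
  have sub: "pm.subspace (chains A k g)" unfolding chains_def by (rule pm.subspace_span)
  fix c x assume "x \<in> cycles A k g"
  then show "pm_scale c x \<in> cycles A k g"
    using pm.subspace_scale[OF sub] by (simp add: cycles_iff coord_linear bnd_linear)
qed

section \<open>Duality\<close>

text \<open>The star acts on coordinates, so a form is first read off on increasing tuples and the
  result is lifted by \<open>chain\<close>; the lift is onto only modulo the relations, which
  \<open>quot_space_isomorphic\<close> allows.\<close>

theorem cohomology_isomorphic_homology_compl:
  assumes "k \<le> card R"
  shows "isomorphic (cohomology A k g) (homology A (card R - k) (sum gr R - g))"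
  unfolding cohomology_def homology_def
proof (rule quot_space_isomorphic)
  define D where "D f = chain (star (form_coord f))" for f
  define n where "n = card R - k"
  define g' where "g' = sum gr R - g"
  show "vector_space (fun_scale :: 'a \<Rightarrow> (('k \<Rightarrow>\<^sub>0 'a) list \<Rightarrow> 'a) \<Rightarrow> _)" by (rule vector_space_fun_scale)
  show "vector_space (pm_scale :: 'a \<Rightarrow> (('k \<Rightarrow>\<^sub>0 'a) list \<Rightarrow>\<^sub>0 'a) \<Rightarrow> _)"
    by (rule pm.vector_space_axioms)
  show "fn.subspace (cocycles A k g)" "fn.subspace (coboundaries A k g)"
    "pm.subspace (cycles A (card R - k) (sum gr R - g))"
    "pm.subspace (boundaries A (card R - k) (sum gr R - g))"
    by (rule subspace_cocycles subspace_coboundaries subspace_cycles subspace_boundaries)+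
  show "D (f + h) = D f + D h" "D (fun_scale c f) = pm_scale c (D f)" for f h c
    by (simp_all add: D_def form_coord_linear star_linear chain_linear)
  have supp: "homog gr l h v \<Longrightarrow> v S \<noteq> 0 \<Longrightarrow> S \<subseteq> R" for l h v S
    by (auto simp: homog_def)
  have hstar: "homog gr n g' (star u)" if "homog gr k g u" for u
    using homog_star[OF that] by (simp add: n_def g'_def)
  have D: "D (form u) = chain (star u)" if "homog gr k g u" for u
    using that by (simp add: D_def form_coord_form_homog)
  have coordD: "coord (D (form u)) = star u" if "homog gr k g u" for u
    unfolding D[OF that] using supp[OF hstar[OF that]] by (rule coord_chain)
  have chainsD: "D (form u) \<in> chains A n g'" if "homog gr k g u" for u
    unfolding D[OF that] using hstar[OF that] by (rule chain_in_chains)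
  show "D f \<in> cycles A (card R - k) (sum gr R - g)" if f: "f \<in> cocycles A k g" for f
  proof -
    from f obtain u where u: "homog gr k g u" "cobnd u = 0" "f = form u"
      by (auto simp: cocycles_iff)
    have "bnd (star u) = 0"
      by (simp add: bnd_star[OF u(1)] u(2) star_linear)
    then have "D f \<in> cycles A n g'"
      using chainsD[OF u(1)] by (simp add: cycles_iff u(3) coordD[OF u(1)])
    then show ?thesis by (simp add: n_def g'_def)
  qed
  have star_inv: "star (fun_scale (star_sign R) (star v)) = v" if "homog gr l h v" for v l h
  proof -
    have "star (star v) = fun_scale (star_sign R) v" by (rule star_star) (rule supp[OF that])
    then show ?thesis by (simp add: star_linear)
  qed
  show "D f \<in> boundaries A (card R - k) (sum gr R - g) \<longleftrightarrow> f \<in> coboundaries A k g"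
    if f: "f \<in> cocycles A k g" for f
  proof -
    from f obtain u where u: "homog gr k g u" "f = form u" by (auto simp: cocycles_iff)
    have fc: "form_coord f = u" using u by (simp add: form_coord_form_homog)
    have keysD: "keys (D f) \<subseteq> tuples n" using chainsD[OF u(1)] u(2) by (simp add: chains_iff)
    have "D f \<in> boundaries A n g' \<longleftrightarrow> (\<exists>w. homog gr (Suc n) g' w \<and> star u = bnd w)"
      using keysD by (simp add: boundaries_iff u(2) coordD[OF u(1)])
    also have "\<dots> \<longleftrightarrow> (\<exists>v. (if k = 0 then v = 0 else homog gr (k - 1) g v) \<and> u = cobnd v)"
    proof
      assume "\<exists>w. homog gr (Suc n) g' w \<and> star u = bnd w"
      then obtain w where w: "homog gr (Suc n) g' w" "star u = bnd w" by blast
      \<comment> \<open>The preimage of \<open>w\<close> under the star, negated to compensate the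
        sign in \<open>cobnd_star\<close>.\<close>
      define v where "v = - fun_scale (star_sign R) (star w)"
      have "homog gr (card R - Suc n) (sum gr R - g') v"
        unfolding v_def by (intro homog_neg homog_scale homog_star w)
      then have hv: "homog gr (card R - Suc n) g v" by (simp add: g'_def)
      have "u = star (fun_scale (star_sign R) (star u))" using star_inv[OF u(1)] by simp
      also have "\<dots> = cobnd v"
        by (simp add: v_def w(2) star_linear cobnd_linear cobnd_star)
      finally have uv: "u = cobnd v" .
      show "\<exists>v. (if k = 0 then v = 0 else homog gr (k - 1) g v) \<and> u = cobnd v"
      proof (cases "k = 0")
        \<comment> \<open>For \<open>k = 0\<close> the function \<open>w\<close> would have degree
          \<open>card R + 1\<close>, hence it is 0.\<close>
        case True
        then have "w = 0" using homog_empty[OF w(1)] by (simp add: n_def)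
        then have "v = 0" by (simp add: v_def star_linear)
        with uv True show ?thesis by auto
      next
        case False
        then have "card R - Suc n = k - 1" using assms by (simp add: n_def)
        with hv uv False show ?thesis by auto
      qed
    next
      assume "\<exists>v. (if k = 0 then v = 0 else homog gr (k - 1) g v) \<and> u = cobnd v"
      then obtain v where v: "if k = 0 then v = 0 else homog gr (k - 1) g v" "u = cobnd v" by blast
      show "\<exists>w. homog gr (Suc n) g' w \<and> star u = bnd w"
      proof (cases "k = 0")
        case True
        then have "star u = bnd 0" using v by (simp add: cobnd_linear star_linear bnd_linear)
        then show ?thesis using homog_0 by blast
      next
        case False
        then have hv: "homog gr (k - 1) g v" using v by simp
        have "star u = bnd (- star v)"
          using bnd_star[OF hv] v(2) by (simp add: bnd_linear)
        moreover have "card R - (k - 1) = Suc n" using False assms by (simp add: n_def)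
        then have "homog gr (Suc n) g' (- star v)"
          using homog_neg[OF homog_star[OF hv]] by (simp add: g'_def)
        ultimately show ?thesis by blast
      qed
    qed
    also have "\<dots> \<longleftrightarrow> f \<in> coboundaries A k g"
    proof -
      have "form_coord (form (cobnd v)) = cobnd v"
        if "if k = 0 then v = 0 else homog gr (k - 1) g v" for v
      proof -
        have "homog gr (Suc (k - 1)) g (cobnd v)"
          using that homog_cobnd[of "k - 1" g v] by (cases "k = 0") (simp_all add: cobnd_linear)
        then show ?thesis by (rule form_coord_form_homog)
      qed
      then show ?thesis
        using fc u(2) unfolding coboundaries_iff by metis
    qed
    finally show ?thesis by (simp add: n_def g'_def)
  qed
  show "\<exists>f\<in>cocycles A k g. z - D f \<in> boundaries A (card R - k) (sum gr R - g)"
    if z: "z \<in> cycles A (card R - k) (sum gr R - g)" for z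
  proof -
    have zc: "keys z \<subseteq> tuples n" "homog gr n g' (coord z)" "bnd (coord z) = 0"
      using z by (auto simp: cycles_iff chains_iff n_def g'_def)
    \<comment> \<open>Chosen so that its star is \<open>coord z\<close>; then
      \<open>D (form u)\<close> is the standard chain with the coordinates of
      \<open>z\<close>.\<close>
    define u where "u = fun_scale (star_sign R) (star (coord z))"
    have hu: "homog gr k g u"
      unfolding u_def using homog_scale[OF homog_star[OF zc(2)]] assms by (simp add: n_def g'_def)
    have su: "star u = coord z" unfolding u_def using zc(2) by (rule star_inv)
    have "cobnd u = 0"
      by (simp add: u_def cobnd_linear cobnd_star zc(3) star_linear)
    then have "form u \<in> cocycles A k g" using hu by (auto simp: cocycles_iff)
    moreover have "z - D (form u) \<in> pm.span (wedge_relations A n)"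
      unfolding D[OF hu] su using zc(1,2) by (rule diff_chain_coord)
    then have "z - D (form u) \<in> boundaries A n g'"
      unfolding boundaries_def using pm.span_mono by blast
    ultimately show ?thesis by (auto simp: n_def g'_def)
  qed
qed

section \<open>The Kronecker pairing of homology and cohomology\<close>

lemma pairing_boundary_cocycle:
  assumes "z \<in> boundaries A k g" "f \<in> cocycles A k g"
  shows "pairing z f = 0"
proof -
  obtain w where w: "keys z \<subseteq> tuples k" "coord z = bnd w"
    using assms(1) by (auto simp: boundaries_iff)
  obtain u where u: "cobnd u = 0" "f = form u" using assms(2) by (auto simp: cocycles_iff)
  show ?thesis
    unfolding u(2) pairing_form[OF w(1)] w(2) bnd_adjoint u(1) by (simp add: pointwise)
qed

lemma pairing_cycle_coboundary:
  assumes "z \<in> cycles A k g" "f \<in> coboundaries A k g"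
  shows "pairing z f = 0"
proof -
  have z: "keys z \<subseteq> tuples k" "bnd (coord z) = 0"
    using assms(1) by (auto simp: cycles_iff chains_iff)
  obtain w where "f = form (cobnd w)" using assms(2) by (auto simp: coboundaries_iff)
  then show ?thesis
    using pairing_form[OF z(1), of "cobnd w"] by (simp add: z(2) pointwise flip: bnd_adjoint)
qed

text \<open>Nondegeneracy on the side of homology: a functional separating \<open>z\<close> from the
  boundaries is, on chains, evaluation of a cochain, and this is a cocycle because the functional
  kills boundaries.\<close>

lemma boundary_if_pairing_eq_0:
  assumes z: "z \<in> cycles A k g" and orth: "\<And>f. f \<in> cocycles A k g \<Longrightarrow> pairing z f = 0"
  shows "z \<in> boundaries A k g"
proof (rule ccontr)
  assume "z \<notin> boundaries A k g"
  then obtain f where f: "pairing z f \<noteq> 0"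
    and bd: "\<And>b. b \<in> ce_boundary A ` chains A (Suc k) g \<union> wedge_relations A k \<Longrightarrow> pairing b f = 0"
    unfolding boundaries_def using separating_functional by blast
  \<comment> \<open>The separating functional is unconstrained off \<open>tuples k\<close> and in
    other grades; cutting its values on basis tuples down to degree \<open>k\<close> and grade
    \<open>g\<close> gives a cochain without changing it on \<open>chains A k g\<close>.\<close>
  define u where "u S = (if S \<subseteq> R \<and> card S = k \<and> sum gr S = g then f (basis_tuple S) else 0)" for S
  have hu: "homog gr k g u" by (auto simp: homog_def u_def)
  have agree: "pairing z' f = pairing z' (form u)" if "z' \<in> chains A k g" for z'
  proof -
    have z': "keys z' \<subseteq> tuples k" "homog gr k g (coord z')" using that by (auto simp: chains_iff)
    have "pairing (z' - chain (coord z')) f = 0"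
      by (rule pairing_span_eq_0[OF diff_chain_coord[OF z']]) (rule bd, simp)
    then have "pairing z' f = (\<Sum>S\<in>Pow R. coord z' S * f (basis_tuple S))"
      by (simp add: pairing_diff_left pairing_chain)
    also have "\<dots> = (\<Sum>S\<in>Pow R. u S * coord z' S)"
    proof (intro sum.cong refl)
      fix S
      show "coord z' S * f (basis_tuple S) = u S * coord z' S"
        using z'(2) by (cases "coord z' S = 0") (auto simp: u_def homog_def)
    qed
    also have "\<dots> = pairing z' (form u)" using z'(1) by (simp add: pairing_form)
    finally show ?thesis .
  qed
  have "cobnd u = 0"
  proof
    fix S
    show "cobnd u S = 0 S"
    proof (cases "S \<subseteq> R \<and> card S = Suc k \<and> sum gr S = g")
      case True
      \<comment> \<open>The unit vector at \<open>S\<close> picks out \<open>cobnd u S\<close>,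
        which thereby becomes the value of \<open>f\<close> on the boundary of a chain.\<close>
      define v :: "'k set \<Rightarrow> 'a" where "v T = (if T = S then 1 else 0)" for T
      have v: "homog gr (Suc k) g v" using True by (simp add: v_def homog_def)
      let ?b = "ce_boundary A (chain v)"
      have cv: "chain v \<in> chains A (Suc k) g" using v by (rule chain_in_chains)
      then have kv: "keys (chain v) \<subseteq> tuples (Suc k)" by (simp add: chains_iff)
      have b: "?b \<in> chains A k g" using cv by (rule ce_boundary_in_chains)
      have coordv: "coord (chain v) = v" using v by (intro coord_chain) (auto simp: homog_def)
      have "cobnd u S = (\<Sum>T\<in>Pow R. if T = S then cobnd u S else 0)"
        using True finite_R by simp
      also have "\<dots> = (\<Sum>T\<in>Pow R. cobnd u T * v T)"
        by (intro sum.cong) (auto simp: v_def)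
      also have "\<dots> = (\<Sum>T\<in>Pow R. u T * bnd v T)" by (rule bnd_adjoint[symmetric])
      also have "\<dots> = pairing ?b (form u)"
        using b by (simp add: pairing_form[of ?b k] chains_iff coord_ce_boundary[OF kv] coordv)
      also have "\<dots> = pairing ?b f" using agree[OF b] by simp
      also have "\<dots> = 0" using bd cv by blast
      finally show ?thesis by (simp add: pointwise)
    next
      case False
      then show ?thesis using homog_cobnd[OF hu] by (auto simp: homog_def pointwise)
    qed
  qed
  then have "form u \<in> cocycles A k g" using hu by (auto simp: cocycles_iff)
  then have "pairing z (form u) = 0" by (rule orth)
  then show False using f agree z by (simp add: cycles_iff)
qed

text \<open>Nondegeneracy on the side of cohomology: cochains have finitely many coordinates, so a
  functional is the dot product with its values \<open>w\<close> on the dual basis, and vanishing on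
  coboundaries says by transposition that \<open>bnd w = 0\<close>.\<close>

lemma cycle_of_functional:
  fixes h :: "(('k \<Rightarrow>\<^sub>0 'a) list \<Rightarrow> 'a) \<Rightarrow> 'a"
  assumes add: "\<And>x y. h (x + y) = h x + h y" and scl: "\<And>c x. h (fun_scale c x) = c * h x"
    and zero: "\<And>f. f \<in> coboundaries A k g \<Longrightarrow> h f = 0"
  obtains z where "z \<in> cycles A k g" "\<And>f. f \<in> cocycles A k g \<Longrightarrow> pairing z f = h f"
proof -
  define \<delta> :: "'k set \<Rightarrow> 'k set \<Rightarrow> 'a" where "\<delta> S T = (if T = S then 1 else 0)" for S T
  define w where "w S = (if S \<subseteq> R \<and> card S = k \<and> sum gr S = g then h (form (\<delta> S)) else 0)" for S
  have hw: "homog gr k g w" by (auto simp: homog_def w_def)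
  have h_sum: "h (\<Sum>i\<in>I. fun_scale (c i) (f i)) = (\<Sum>i\<in>I. c i * h (f i))" if "finite I"
    for I :: "'k set set" and c f
    using that
  proof (induction I rule: finite_induct)
    case empty
    show ?case using scl[of 0 0] by simp
  qed (simp add: add scl)
  have pair: "(\<Sum>S\<in>Pow R. u S * w S) = h (form u)" if u: "homog gr k g u" for u
  proof -
    have "form u = (\<Sum>S\<in>Pow R. fun_scale (u S) (form (\<delta> S)))"
    proof
      fix xs
      show "form u xs = (\<Sum>S\<in>Pow R. fun_scale (u S) (form (\<delta> S))) xs"
        using finite_R
        by (auto simp: form_def pointwise \<delta>_def if_distrib[of "\<lambda>x. x * _"] sum.delta cong: if_cong)
    qed
    then have "h (form u) = (\<Sum>S\<in>Pow R. u S * h (form (\<delta> S)))"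
      using finite_R by (simp add: h_sum)
    also have "\<dots> = (\<Sum>S\<in>Pow R. u S * w S)"
    proof (intro sum.cong refl)
      fix S
      show "u S * h (form (\<delta> S)) = u S * w S"
        using u by (cases "u S = 0") (auto simp: w_def homog_def)
    qed
    finally show ?thesis ..
  qed
  have cw: "chain w \<in> chains A k g" using hw by (rule chain_in_chains)
  have coordw: "coord (chain w) = w" using hw by (intro coord_chain) (auto simp: homog_def)
  have "bnd w = 0"
  proof (cases k)
    case 0
    then show ?thesis using hw homog_0_bnd by simp
  next
    case (Suc l)
    have hb: "homog gr l g (bnd w)" using hw Suc homog_bnd by simp
    show ?thesis
    proof
      fix S
      show "bnd w S = 0 S"
      proof (cases "S \<subseteq> R \<and> card S = l \<and> sum gr S = g")
        case True
        then have h\<delta>: "homog gr l g (\<delta> S)" by (auto simp: homog_def \<delta>_def)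
        then have "form (cobnd (\<delta> S)) \<in> coboundaries A k g" by (auto simp: coboundaries_iff Suc)
        then have "h (form (cobnd (\<delta> S))) = 0" by (rule zero)
        then have "(\<Sum>T\<in>Pow R. cobnd (\<delta> S) T * w T) = 0"
          using pair[of "cobnd (\<delta> S)"] homog_cobnd[OF h\<delta>] Suc by simp
        then have "(\<Sum>T\<in>Pow R. \<delta> S T * bnd w T) = 0" by (simp add: bnd_adjoint)
        moreover have "(\<Sum>T\<in>Pow R. \<delta> S T * bnd w T) = (\<Sum>T\<in>Pow R. if T = S then bnd w S else 0)"
          by (intro sum.cong) (auto simp: \<delta>_def)
        ultimately show ?thesis using True finite_R by (simp add: pointwise)
      next
        case False
        then show ?thesis using hb by (auto simp: homog_def pointwise)
      qed
    qed
  qed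
  then have zc: "chain w \<in> cycles A k g" using cw by (simp add: cycles_iff coordw)
  show thesis
  proof (rule that[OF zc])
    fix f assume "f \<in> cocycles A k g"
    then obtain u where u: "homog gr k g u" "f = form u" by (auto simp: cocycles_iff)
    have "pairing (chain w) f = (\<Sum>S\<in>Pow R. u S * w S)"
      using cw u(2) pairing_form[of "chain w" k u] by (simp add: chains_iff coordw)
    then show "pairing (chain w) f = h f" using pair[OF u(1)] u(2) by simp
  qed
qed

text \<open>No dimensions are compared: injectivity comes from
  \<open>boundary_if_pairing_eq_0\<close> and surjectivity from
  \<open>cycle_of_functional\<close>.\<close>

theorem kronecker_linear_iso:
  "linear_iso (homology A k g) (dual_space (cohomology A k g)) (kronecker A k g)"
proof -
  let ?Z = "cycles A k g" and ?B = "boundaries A k g"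
  let ?Z' = "cocycles A k g" and ?B' = "coboundaries A k g"
  let ?H = "cohomology A k g"
  note cB = pm.coset_eq_iff[OF subspace_boundaries] pm.mem_coset_iff[OF subspace_boundaries]
  note cB' = fn.coset_eq_iff[OF subspace_coboundaries] fn.mem_coset_iff[OF subspace_coboundaries]
  have carrier: "vcarrier ?H = coset ?B' ` ?Z'" "vcarrier (homology A k g) = coset ?B ` ?Z"
    by (simp_all add: cohomology_def homology_def quot_space_def)
  have addH: "vadd (homology A k g) (coset ?B x) (coset ?B y) = coset ?B (x + y)" for x y
    by (simp add: homology_def quot_space_def pm.coset_add[OF subspace_boundaries])
  have sclH: "vsmult (homology A k g) c (coset ?B x) = coset ?B (pm_scale c x)" for c x
    by (simp add: homology_def quot_space_def pm.coset_scale[OF subspace_boundaries])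
  have addH': "vadd ?H (coset ?B' x) (coset ?B' y) = coset ?B' (x + y)" for x y
    by (simp add: cohomology_def quot_space_def fn.coset_add[OF subspace_coboundaries])
  have sclH': "vsmult ?H c (coset ?B' x) = coset ?B' (fun_scale c x)" for c x
    by (simp add: cohomology_def quot_space_def fn.coset_scale[OF subspace_coboundaries])
  have kr: "kronecker A k g (coset ?B z) (coset ?B' f) = pairing z f"
    if z: "z \<in> ?Z" and f: "f \<in> ?Z'" for z f
  proof -
    have inv: "pairing z1 f1 = pairing z f" if "z1 \<in> coset ?B z" "f1 \<in> coset ?B' f" for z1 f1
    proof -
      have zb: "z1 - z \<in> ?B" and fb: "f1 - f \<in> ?B'" using that by (simp_all add: cB cB')
      have f1: "f1 \<in> ?Z'"
        using fn.subspace_add[OF subspace_cocycles f subsetD[OF coboundaries_subset fb]] by simp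
      have "pairing z1 f1 = pairing (z1 - z) f1 + pairing z (f1 - f) + pairing z f"
        by (simp add: pairing_diff_left pairing_diff_right)
      then show ?thesis
        using pairing_boundary_cocycle[OF zb f1] pairing_cycle_coboundary[OF z fb] by simp
    qed
    have mem: "z \<in> coset ?B z" "f \<in> coset ?B' f"
      using pm.subspace_0[OF subspace_boundaries] fn.subspace_0[OF subspace_coboundaries]
      by (simp_all add: cB cB')
    have "(THE t. \<exists>z1\<in>coset ?B z. \<exists>f1\<in>coset ?B' f. t = pairing z1 f1) = pairing z f"
      using mem inv by (intro the_equality) blast+
    then show ?thesis using f carrier by (auto simp: kronecker_def pairing_def)
  qed
  have out: "kronecker A k g X \<Phi> = 0" if "\<Phi> \<notin> vcarrier ?H" for X \<Phi>
    using that by (simp add: kronecker_def)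
  have Zadd: "x + y \<in> ?Z" if "x \<in> ?Z" "y \<in> ?Z" for x y
    using that by (rule pm.subspace_add[OF subspace_cycles])
  have Zscl: "pm_scale c x \<in> ?Z" if "x \<in> ?Z" for c x
    using that by (rule pm.subspace_scale[OF subspace_cycles])
  have Z'add: "x + y \<in> ?Z'" if "x \<in> ?Z'" "y \<in> ?Z'" for x y
    using that by (rule fn.subspace_add[OF subspace_cocycles])
  have Z'scl: "fun_scale c x \<in> ?Z'" if "x \<in> ?Z'" for c x
    using that by (rule fn.subspace_scale[OF subspace_cocycles])
  have dual: "kronecker A k g (coset ?B z) \<in> vcarrier (dual_space ?H)" if z: "z \<in> ?Z" for z
    using z by (auto simp: dual_space_def carrier(1) addH' sclH' kr Z'add Z'scl pairing_add_right
        pairing_scale_right out)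
  have inj: "inj_on (kronecker A k g) (coset ?B ` ?Z)"
  proof (intro inj_onI; clarify)
    fix z y assume z: "z \<in> ?Z" and y: "y \<in> ?Z"
      and eq: "kronecker A k g (coset ?B z) = kronecker A k g (coset ?B y)"
    have "z - y \<in> ?B"
    proof (rule boundary_if_pairing_eq_0)
      show "z - y \<in> ?Z" using z y by (rule pm.subspace_diff[OF subspace_cycles])
      fix f assume f: "f \<in> ?Z'"
      show "pairing (z - y) f = 0"
        using kr[OF z f] kr[OF y f] eq by (simp add: pairing_diff_left)
    qed
    then show "coset ?B z = coset ?B y" by (simp add: cB)
  qed
  have surj: "\<psi> \<in> kronecker A k g ` coset ?B ` ?Z" if \<psi>: "\<psi> \<in> vcarrier (dual_space ?H)" for \<psi>
  proof -
    have \<psi>add: "\<psi> (coset ?B' (x + y)) = \<psi> (coset ?B' x) + \<psi> (coset ?B' y)"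
      if "x \<in> ?Z'" "y \<in> ?Z'" for x y
      using \<psi> that by (auto simp: dual_space_def carrier(1) simp flip: addH')
    have \<psi>scl: "\<psi> (coset ?B' (fun_scale c x)) = c * \<psi> (coset ?B' x)" if "x \<in> ?Z'" for c x
      using \<psi> that by (auto simp: dual_space_def carrier(1) simp flip: sclH')
    have \<psi>out: "\<psi> \<Phi> = 0" if "\<Phi> \<notin> vcarrier ?H" for \<Phi>
      using \<psi> that by (simp add: dual_space_def)
    \<comment> \<open>A functional on classes is known on cocycles only; it is extended to all
      functions so that it can be evaluated on the dual basis.\<close>
    obtain h where h: "\<And>x y. h (x + y) = h x + h y" "\<And>c x. h (fun_scale c x) = c * h x"
      "\<And>f. f \<in> ?Z' \<Longrightarrow> h f = \<psi> (coset ?B' f)"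
      using extend_functional[OF vector_space_fun_scale subspace_cocycles,
          of k g "\<lambda>f. \<psi> (coset ?B' f)", OF \<psi>add \<psi>scl] by blast
    have "h f = 0" if f: "f \<in> ?B'" for f
    proof -
      have "f \<in> ?Z'" using f coboundaries_subset by blast
      moreover have "0 \<in> ?Z'" by (rule fn.subspace_0[OF subspace_cocycles])
      moreover have "coset ?B' f = coset ?B' 0" using f by (simp add: cB')
      moreover have "h 0 = 0" using h(2)[of 0 0] by simp
      ultimately show ?thesis using h(3) by metis
    qed
    then obtain z where z: "z \<in> ?Z" "\<And>f. f \<in> ?Z' \<Longrightarrow> pairing z f = h f"
      using cycle_of_functional[OF h(1,2)] by blast
    have "kronecker A k g (coset ?B z) = \<psi>"
    proof
      fix \<Phi>
      show "kronecker A k g (coset ?B z) \<Phi> = \<psi> \<Phi>"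
      proof (cases "\<Phi> \<in> vcarrier ?H")
        case True
        then obtain f where "f \<in> ?Z'" "\<Phi> = coset ?B' f" by (auto simp: carrier(1))
        then show ?thesis using kr z h(3) by simp
      qed (simp add: out \<psi>out)
    qed
    then show ?thesis using z(1) by blast
  qed
  show ?thesis
    unfolding linear_iso_def
  proof (intro conjI allI ballI)
    show "bij_betw (kronecker A k g) (vcarrier (homology A k g)) (vcarrier (dual_space ?H))"
      unfolding bij_betw_def carrier(2) using inj dual surj by blast
    fix X assume "X \<in> vcarrier (homology A k g)"
    then obtain z where z: "z \<in> ?Z" "X = coset ?B z" by (auto simp: carrier(2))
    {
      fix Y assume "Y \<in> vcarrier (homology A k g)"
      then obtain y where y: "y \<in> ?Z" "Y = coset ?B y" by (auto simp: carrier(2))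
      show "kronecker A k g (vadd (homology A k g) X Y)
        = vadd (dual_space ?H) (kronecker A k g X) (kronecker A k g Y)"
      proof
        fix \<Phi>
        show "kronecker A k g (vadd (homology A k g) X Y) \<Phi>
          = vadd (dual_space ?H) (kronecker A k g X) (kronecker A k g Y) \<Phi>"
        proof (cases "\<Phi> \<in> vcarrier ?H")
          case True
          then obtain f where "f \<in> ?Z'" "\<Phi> = coset ?B' f" by (auto simp: carrier(1))
          then show ?thesis
            using z y by (simp add: addH kr Zadd dual_space_def pointwise pairing_add_left)
        qed (simp add: out dual_space_def pointwise)
      qed
    }
    fix c
    show "kronecker A k g (vsmult (homology A k g) c X)
      = vsmult (dual_space ?H) c (kronecker A k g X)"
    proof
      fix \<Phi>
      show "kronecker A k g (vsmult (homology A k g) c X) \<Phi>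
        = vsmult (dual_space ?H) c (kronecker A k g X) \<Phi>"
      proof (cases "\<Phi> \<in> vcarrier ?H")
        case True
        then obtain f where "f \<in> ?Z'" "\<Phi> = coset ?B' f" by (auto simp: carrier(1))
        then show ?thesis
          using z by (simp add: sclH kr Zscl dual_space_def pointwise pairing_scale_left)
      qed (simp add: out dual_space_def pointwise)
    qed
  qed
qed

text \<open>Pullback along a grade-reversing automorphism. As \<open>\<phi>\<close> is an
  involution, so is the pullback, and this yields the kernel and surjectivity conditions.\<close>

theorem cohomology_isomorphic_neg:
  assumes add: "\<And>x y. \<phi> (x + y) = \<phi> x + \<phi> y" and scl: "\<And>c x. \<phi> (pm_scale c x) = pm_scale c (\<phi> x)"
    and inv: "\<And>x. \<phi> (\<phi> x) = x"
    and hom: "\<And>x y. keys x \<subseteq> R \<Longrightarrow> keys y \<subseteq> R \<Longrightarrow> \<phi> (br x y) = br (\<phi> x) (\<phi> y)"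
    and piece: "\<And>h x. x \<in> lie_piece A h \<Longrightarrow> \<phi> x \<in> lie_piece A (- h)"
    and carrier: "\<And>x. x \<in> lie_carrier A \<Longrightarrow> \<phi> x \<in> lie_carrier A"
  shows "isomorphic (cohomology A k g) (cohomology A k (- g))"
  unfolding cohomology_def
proof (rule quot_space_isomorphic)
  define T :: "(('k \<Rightarrow>\<^sub>0 'a) list \<Rightarrow> 'a) \<Rightarrow> ('k \<Rightarrow>\<^sub>0 'a) list \<Rightarrow> 'a" where "T f = (\<lambda>xs. f (map \<phi> xs))" for f
  show vs: "vector_space (fun_scale :: 'a \<Rightarrow> (('k \<Rightarrow>\<^sub>0 'a) list \<Rightarrow> 'a) \<Rightarrow> _)" by (rule vector_space_fun_scale)
  then show "vector_space (fun_scale :: 'a \<Rightarrow> (('k \<Rightarrow>\<^sub>0 'a) list \<Rightarrow> 'a) \<Rightarrow> _)" .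
  show "fn.subspace (cocycles A k g)" "fn.subspace (coboundaries A k g)"
    "fn.subspace (cocycles A k (- g))" "fn.subspace (coboundaries A k (- g))"
    by (rule subspace_cocycles subspace_coboundaries)+
  show T_add: "T (f + h) = T f + T h" and "T (fun_scale c f) = fun_scale c (T f)" for f h c
    by (simp_all add: T_def fun_eq_iff pointwise)
  have TT: "T (T f) = f" for f by (simp add: T_def inv comp_def)
  have car: "\<phi> x \<in> lie_carrier A \<longleftrightarrow> x \<in> lie_carrier A" for x
    using carrier[of x] carrier[of "\<phi> x"] inv by metis
  have \<phi>_sub: "\<phi> ` X \<subseteq> lie_carrier A \<longleftrightarrow> X \<subseteq> lie_carrier A" for X
    using car by blast
  have \<phi>_inj: "distinct (map \<phi> xs) \<longleftrightarrow> distinct xs" for xs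
    using inv by (metis distinct_map inj_on_inverseI)
  have Tcochain: "T f \<in> cochains A l (- h)" if f: "f \<in> cochains A l h" for f l h
  proof -
    have alt: "f \<in> alternating_forms A l" using f by (simp add: cochains_def)
    show ?thesis
      unfolding cochains_def alternating_forms_def
    proof (intro CollectI conjI allI impI)
      fix xs assume "\<not> (length xs = l \<and> set xs \<subseteq> lie_carrier A)"
      then show "T f xs = 0"
        unfolding T_def by (intro alternating_outside[OF alt]) (simp add: tuples_def \<phi>_sub)
    next
      fix us vs x y
      assume "length us + 1 + length vs = l \<and> set us \<union> set vs \<union> {x, y} \<subseteq> lie_carrier A"
      then show "T f (us @ (x + y) # vs) = T f (us @ x # vs) + T f (us @ y # vs)"
        unfolding T_def map_append list.map add
        by (intro alternating_add[OF alt]) (auto simp: \<phi>_sub car simp del: carrier_iff)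
    next
      fix us vs c x
      assume "length us + 1 + length vs = l \<and> set us \<union> set vs \<union> {x} \<subseteq> lie_carrier A"
      then show "T f (us @ pm_scale c x # vs) = c * T f (us @ x # vs)"
        unfolding T_def map_append list.map scl
        by (intro alternating_scale[OF alt]) (auto simp: \<phi>_sub car simp del: carrier_iff)
    next
      fix xs assume "length xs = l \<and> set xs \<subseteq> lie_carrier A \<and> \<not> distinct xs"
      then show "T f xs = 0"
        unfolding T_def by (intro alternating_not_distinct[OF alt]) (simp add: \<phi>_inj)
    next
      fix xs gs assume *: "length xs = l \<and> homogeneous A xs gs \<and> sum_list gs \<noteq> - h"
      have "homogeneous A (map \<phi> xs) (map uminus gs)"
        using * piece by (auto simp: homogeneous_def list_all2_conv_all_nth)
      moreover have "sum_list (map uminus gs) = - sum_list gs"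
        by (induction gs) auto
      moreover have "sum_list (map uminus gs) \<noteq> h" using * calculation(2) by auto
      moreover have "length (map \<phi> xs) = l" using * by simp
      ultimately show "T f xs = 0"
        using f unfolding T_def cochains_def by blast
    qed
  qed
  have Td: "ce_differential A (T f) = T (ce_differential A f)" for f
  proof
    fix xs
    have "map \<phi> (contract A xs i j) = contract A (map \<phi> xs) i j"
      if "set xs \<subseteq> lie_carrier A" "i < j" "j < length xs" for i j
    proof -
      have "xs ! i \<in> lie_carrier A" "xs ! j \<in> lie_carrier A"
        using that by (auto simp del: carrier_iff)
      then show ?thesis using that by (simp add: contract_def hom nths_map)
    qed
    then show "ce_differential A (T f) xs = T (ce_differential A f) xs"
      by (auto simp: ce_differential_def T_def \<phi>_sub simp del: carrier_iff intro!: sum.cong)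
  qed
  have T0: "T 0 = 0" by (simp add: T_def zero_fun_def)
  have cocyc: "T f \<in> cocycles A k (- h)" if "f \<in> cocycles A k h" for f h
    using that Tcochain by (simp add: cocycles_def Td T0)
  have cobd: "T f \<in> coboundaries A k (- h)" if "f \<in> coboundaries A k h" for f h
    using that Tcochain[of _ "k - 1" h]
    by (auto simp: coboundaries_def T0 image_iff Td[symmetric] split: if_splits)
  show "T f \<in> cocycles A k (- g)" if "f \<in> cocycles A k g" for f using that by (rule cocyc)
  show "T f \<in> coboundaries A k (- g) \<longleftrightarrow> f \<in> coboundaries A k g" for f
    using cobd[of f g] cobd[of "T f" "- g"] TT by auto
  show "\<exists>f\<in>cocycles A k g. h - T f \<in> coboundaries A k (- g)" if "h \<in> cocycles A k (- g)" for h
  proof (rule bexI[of _ "T h"])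
    show "T h \<in> cocycles A k g" using cocyc[OF that] by simp
    show "h - T (T h) \<in> coboundaries A k (- g)"
      using fn.subspace_0[OF subspace_coboundaries] by (simp add: TT)
  qed
qed

end

section \<open>Divided powers\<close>

declare pointwise [simp]

text \<open>Reduces identities that are linear in each argument to basis elements, one argument at a
  time.\<close>

lemma divpow_induct [case_names basis add]:
  assumes "\<And>c r. P (pm_scale c (divmono r))" "\<And>f h. P f \<Longrightarrow> P h \<Longrightarrow> P (f + h)"
  shows "P (f :: 'a::field divpow)"
proof -
  have "P (\<Sum>r\<in>I. single r (lookup f r))" if "finite I" for I
    using that
  proof (induction I rule: finite_induct)
    case empty
    show ?case using assms(1)[of 0 0] by simp
  next
    case (insert r I)
    then show ?case using assms(2)[OF assms(1)[of "lookup f r" r]] by (simp add: divmono_def)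
  qed
  from this[OF finite_keys[of f]] show ?thesis by (simp flip: pm_expand)
qed

text \<open>Keys may cancel in a sum, so additivity is read off from sums over a common finite
  superset of the keys.\<close>

lemma dp_mult_superset:
  assumes "finite X" "finite Y" "keys f \<subseteq> X" "keys h \<subseteq> Y"
  shows "dp_mult f h = (\<Sum>r\<in>X. \<Sum>s\<in>Y.
    pm_scale (lookup f r * lookup h s * of_nat (multibinom r s)) (divmono (r + s)))"
proof -
  have "dp_mult f h = (\<Sum>r\<in>keys f. \<Sum>s\<in>Y.
      pm_scale (lookup f r * lookup h s * of_nat (multibinom r s)) (divmono (r + s)))"
    unfolding dp_mult_def using assms
    by (intro sum.cong sum.mono_neutral_left) (auto simp: in_keys_iff)
  also have "\<dots> = (\<Sum>r\<in>X. \<Sum>s\<in>Y.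
      pm_scale (lookup f r * lookup h s * of_nat (multibinom r s)) (divmono (r + s)))"
    using assms by (intro sum.mono_neutral_left) (auto simp: in_keys_iff)
  finally show ?thesis .
qed

lemma dp_mult_add_left: "dp_mult (f + f') h = dp_mult f h + dp_mult f' h"
proof -
  let ?X = "keys f \<union> keys f'"
  have "keys (f + f') \<subseteq> ?X" by (rule keys_add)
  then show ?thesis
    by (simp add: dp_mult_superset[of ?X "keys h"] lookup_add algebra_simps sum.distrib
        pm.scale_left_distrib)
qed

lemma dp_mult_add_right: "dp_mult f (h + h') = dp_mult f h + dp_mult f h'"
proof -
  let ?X = "keys h \<union> keys h'"
  have "keys (h + h') \<subseteq> ?X" by (rule keys_add)
  then show ?thesis
    by (simp add: dp_mult_superset[of "keys f" ?X] lookup_add algebra_simps sum.distrib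
        pm.scale_left_distrib)
qed

lemma dp_mult_scale_left: "dp_mult (pm_scale c f) h = pm_scale c (dp_mult f h)"
  using keys_pm_scale_subset[of c f]
  by (simp add: dp_mult_superset[of "keys f" "keys h"] pm.scale_sum_right mult.assoc
      del: pm_scale_single)

lemma dp_mult_scale_right: "dp_mult f (pm_scale c h) = pm_scale c (dp_mult f h)"
  using keys_pm_scale_subset[of c h]
  by (simp add: dp_mult_superset[of "keys f" "keys h"] pm.scale_sum_right mult.left_commute mult.assoc
      del: pm_scale_single)

lemma dp_mult_uminus:
  "dp_mult (- f) h = - dp_mult f h" "dp_mult f (- h) = - dp_mult f h"
  using dp_mult_scale_left[of "- 1" f h] dp_mult_scale_right[of f "- 1" h] by simp_all

lemma dp_mult_diff:
  "dp_mult (f - f') h = dp_mult f h - dp_mult f' h"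
  "dp_mult f (h - h') = dp_mult f h - dp_mult f h'"
  using dp_mult_add_left[of f "- f'" h] dp_mult_add_right[of f h "- h'"]
  by (simp_all add: dp_mult_uminus)

lemma dp_mult_zero [simp]: "dp_mult 0 h = 0" "dp_mult f 0 = 0"
  by (simp_all add: dp_mult_def)

lemma dp_mult_sum_right: "dp_mult f (sum h I) = (\<Sum>i\<in>I. dp_mult f (h i))"
  by (induction I rule: infinite_finite_induct) (auto simp: dp_mult_add_right)

lemma multibinom_commute: "multibinom r s = multibinom s r"
  unfolding multibinom_def
  by (intro prod.cong)
    (auto simp: add.commute binomial_symmetric[of "lookup r _" "lookup r _ + lookup s _"])

text \<open>Factor by factor, both sides are the trinomial coefficient.\<close>

lemma multibinom_assoc:
  "multibinom r s * multibinom (r + s) t = multibinom s t * multibinom r (s + t)"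
proof -
  define I where "I = keys r \<union> keys s \<union> keys t"
  have I: "finite I" "keys r \<subseteq> I" "keys s \<subseteq> I" "keys t \<subseteq> I" "keys (r + s) \<subseteq> I" "keys (s + t) \<subseteq> I"
    using keys_add[of r s] keys_add[of s t] by (auto simp: I_def)
  have "(a + b choose a) * (a + b + c choose (a + b)) = (b + c choose b) * (a + (b + c) choose a)"
    for a b c :: nat
    using choose_mult[of a "a + b" "a + b + c"] by (simp add: ac_simps)
  then show ?thesis
    using I by (simp add: multibinom_eq_prod[of I] lookup_add flip: prod.distrib)
qed

lemma dp_mult_commute: "dp_mult f h = dp_mult h f"
proof (induction f rule: divpow_induct)
  case (basis c r)
  show ?case
  proof (induction h rule: divpow_induct)
    case (basis d s)
    show ?case
      by (simp add: dp_mult_scale_left dp_mult_scale_right dp_mult_divmono multibinom_commute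
          add.commute mult.left_commute)
  qed (simp add: dp_mult_add_left dp_mult_add_right)
qed (simp add: dp_mult_add_left dp_mult_add_right)

lemma dp_mult_assoc: "dp_mult (dp_mult f h) k = dp_mult f (dp_mult h k)"
proof (induction f rule: divpow_induct)
  case (basis c r)
  show ?case
  proof (induction h rule: divpow_induct)
    case (basis d s)
    show ?case
    proof (induction k rule: divpow_induct)
      case (basis b t)
      have "(of_nat (multibinom r s) * of_nat (multibinom (r + s) t) :: 'a) =
          of_nat (multibinom s t) * of_nat (multibinom r (s + t))"
        by (simp only: multibinom_assoc flip: of_nat_mult)
      then show ?case
        by (simp add: dp_mult_scale_left dp_mult_scale_right dp_mult_divmono add.assoc
            mult.left_commute)
    qed (simp add: dp_mult_add_right)
  qed (simp add: dp_mult_add_left dp_mult_add_right)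
qed (simp add: dp_mult_add_left)

lemma dp_mult_left_commute: "dp_mult f (dp_mult h k) = dp_mult h (dp_mult f k)"
  by (metis dp_mult_assoc dp_mult_commute)

lemmas dp_mult_ac = dp_mult_assoc dp_mult_commute dp_mult_left_commute

text \<open>The condition on the binomial is kept because in prime characteristic it is what makes
  products of truncated elements truncated.\<close>

lemma keys_dp_mult:
  fixes f h :: "'a::field divpow"
  shows "keys (dp_mult f h) \<subseteq>
    {r + s | r s. r \<in> keys f \<and> s \<in> keys h \<and> of_nat (multibinom r s) \<noteq> (0 :: 'a)}"
proof
  fix t assume "t \<in> keys (dp_mult f h)"
  then have "(\<Sum>r\<in>keys f. \<Sum>s\<in>keys h. lookup f r * lookup h s * of_nat (multibinom r s)
      * lookup (divmono (r + s)) t) \<noteq> 0"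
    by (simp add: dp_mult_def in_keys_iff lookup_sum)
  then obtain r where r: "r \<in> keys f" and "(\<Sum>s\<in>keys h. lookup f r * lookup h s *
      of_nat (multibinom r s) * lookup (divmono (r + s)) t) \<noteq> 0"
    by (meson sum.neutral)
  then obtain s where s: "s \<in> keys h" and
    "lookup f r * lookup h s * of_nat (multibinom r s) * lookup (divmono (r + s)) t \<noteq> 0"
    by (meson sum.neutral)
  then have "of_nat (multibinom r s) \<noteq> (0 :: 'a)" "t = r + s"
    by (auto simp: divmono_def lookup_single when_def split: if_splits)
  then show "t \<in> {r + s | r s. r \<in> keys f \<and> s \<in> keys h \<and> of_nat (multibinom r s) \<noteq> (0 :: 'a)}"
    using r s by blast
qed

lemma lookup_single_1: "lookup (single i (Suc 0)) j = (if i = j then 1 else 0)"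
  by (simp add: lookup_single when_def)

lemma exponent_minus_eq_iff:
  fixes r t :: exponent
  assumes "lookup r i \<noteq> 0"
  shows "r - single i 1 = t \<longleftrightarrow> r = t + single i 1"
proof -
  have "lookup r j - (if i = j then 1 else 0) + (if i = j then 1 else 0) = lookup r j" for j
    using assms by auto
  then have "r - single i 1 + single i 1 = r"
    by (intro poly_mapping_eqI) (simp add: lookup_add lookup_minus lookup_single_1)
  then show ?thesis by auto
qed

section \<open>The derivations and the Leibniz rule\<close>

lemma dp_deriv_superset:
  assumes "finite X" "keys f \<subseteq> X"
  shows "dp_deriv i f = (\<Sum>r\<in>X. pm_scale (lookup f r) (dp_deriv i (divmono r)))"
proof -
  have "dp_deriv i f = (\<Sum>r\<in>keys f. pm_scale (lookup f r) (dp_deriv i (divmono r)))"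
    unfolding dp_deriv_divmono by (auto simp: dp_deriv_def intro!: sum.cong)
  also have "\<dots> = (\<Sum>r\<in>X. pm_scale (lookup f r) (dp_deriv i (divmono r)))"
    using assms by (intro sum.mono_neutral_left) (auto simp: in_keys_iff)
  finally show ?thesis .
qed

text \<open>With divided powers a derivation only shifts coefficients, without numerical factors;
  linearity and commutation of the derivations are immediate from this.\<close>

lemma lookup_dp_deriv: "lookup (dp_deriv i f) t = lookup f (t + single i 1)"
proof -
  have "lookup (dp_deriv i f) t = (\<Sum>r\<in>keys f. lookup f r * lookup (dp_deriv i (divmono r)) t)"
    using dp_deriv_superset[of "keys f" f i] by (simp add: lookup_sum)
  also have "\<dots> = (\<Sum>r\<in>keys f. if r = t + single i 1 then lookup f (t + single i 1) else 0)"
  proof (intro sum.cong refl)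
    fix r assume "r \<in> keys f"
    show "lookup f r * lookup (dp_deriv i (divmono r)) t =
        (if r = t + single i 1 then lookup f (t + single i 1) else 0)"
    proof (cases "lookup r i = 0")
      case True
      then have "r \<noteq> t + single i 1" by (auto simp: lookup_add lookup_single_1)
      then show ?thesis using True by (simp add: dp_deriv_divmono)
    next
      case False
      then show ?thesis
        using exponent_minus_eq_iff[OF False, of t] unfolding dp_deriv_divmono
        by (auto simp: divmono_def lookup_single when_def)
    qed
  qed
  also have "\<dots> = lookup f (t + single i 1)" by (auto simp: in_keys_iff)
  finally show ?thesis .
qed

lemma dp_deriv_linear:
  "dp_deriv i (f + h) = dp_deriv i f + dp_deriv i h"
  "dp_deriv i (f - h) = dp_deriv i f - dp_deriv i h"
  "dp_deriv i (- f) = - dp_deriv i f"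
  "dp_deriv i (pm_scale c f) = pm_scale c (dp_deriv i f)"
  "dp_deriv i 0 = 0"
  by (auto intro!: poly_mapping_eqI simp: lookup_dp_deriv lookup_add lookup_minus)

lemma dp_deriv_sum: "dp_deriv i (sum f I) = (\<Sum>j\<in>I. dp_deriv i (f j))"
  by (induction I rule: infinite_finite_induct) (auto simp: dp_deriv_linear)

lemma dp_deriv_commute: "dp_deriv i (dp_deriv j f) = dp_deriv j (dp_deriv i f)"
  by (rule poly_mapping_eqI) (simp add: lookup_dp_deriv ac_simps)

lemma multibinom_split:
  "multibinom r s = ((lookup r i + lookup s i) choose lookup r i) *
    (\<Prod>j\<in>(keys r \<union> keys s) - {i}. (lookup r j + lookup s j) choose lookup r j)"
proof -
  have "multibinom r s = (\<Prod>j\<in>insert i (keys r \<union> keys s). (lookup r j + lookup s j) choose lookup r j)"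
    by (rule multibinom_eq_prod) auto
  also have "\<dots> = ((lookup r i + lookup s i) choose lookup r i) *
      (\<Prod>j\<in>insert i (keys r \<union> keys s) - {i}. (lookup r j + lookup s j) choose lookup r j)"
    by (rule prod.remove) auto
  also have "insert i (keys r \<union> keys s) - {i} = (keys r \<union> keys s) - {i}" by auto
  finally show ?thesis .
qed

text \<open>Pascal's rule in the factor at \<open>i\<close>; the product of the other factors is
  common to all three terms. The zero cases reflect that exponents cannot be lowered below
  0.\<close>

lemma multibinom_pascal:
  assumes "lookup (r + s) i \<noteq> 0"
  shows "multibinom r s =
    (if lookup r i = 0 then 0 else multibinom (r - single i 1) s) +
    (if lookup s i = 0 then 0 else multibinom r (s - single i 1))"
proof -
  define P where "P = (\<Prod>j\<in>(keys r \<union> keys s) - {i}. (lookup r j + lookup s j) choose lookup r j)"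
  have mb: "multibinom r' s' = ((lookup r' i + lookup s' i) choose lookup r' i) * P"
    if "\<And>j. j \<noteq> i \<Longrightarrow> lookup r' j = lookup r j" "\<And>j. j \<noteq> i \<Longrightarrow> lookup s' j = lookup s j" for r' s'
  proof -
    have "(keys r' \<union> keys s') - {i} = (keys r \<union> keys s) - {i}"
      using that by (auto simp: in_keys_iff)
    then have "(\<Prod>j\<in>(keys r' \<union> keys s') - {i}. (lookup r' j + lookup s' j) choose lookup r' j) = P"
      unfolding P_def using that by (intro prod.cong) auto
    then show ?thesis using multibinom_split[of r' s' i] by simp
  qed
  have 1: "multibinom r s = ((lookup r i + lookup s i) choose lookup r i) * P"
    and 2: "multibinom (r - single i 1) s =
      ((lookup r i - 1 + lookup s i) choose (lookup r i - 1)) * P"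
    and 3: "multibinom r (s - single i 1) =
      ((lookup r i + (lookup s i - 1)) choose lookup r i) * P"
    by (subst mb; simp add: lookup_minus lookup_single_1)+
  show ?thesis
    unfolding 1 2 3 using assms
    by (cases "lookup r i"; cases "lookup s i") (auto simp: lookup_add algebra_simps)
qed

lemma dp_deriv_mult:
  "dp_deriv i (dp_mult f h) = dp_mult (dp_deriv i f) h + dp_mult f (dp_deriv i h)"
proof (induction f rule: divpow_induct)
  case (basis c r)
  show ?case
  proof (induction h rule: divpow_induct)
    case (basis d s)
    have "dp_deriv i (dp_mult (divmono r) (divmono s)) =
      dp_mult (dp_deriv i (divmono r)) (divmono s) +
      (dp_mult (divmono r) (dp_deriv i (divmono s)) :: 'a divpow)"
    proof (cases "lookup (r + s) i = 0")
      case True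
      then show ?thesis
        by (simp add: dp_mult_divmono dp_deriv_linear dp_deriv_divmono lookup_add)
    next
      case False
      have 1: "r - single i 1 + s = r + s - single i 1" if "lookup r i \<noteq> 0"
        using that
        by (intro poly_mapping_eqI) (auto simp: lookup_add lookup_minus lookup_single_1)
      have 2: "r + (s - single i 1) = r + s - single i 1" if "lookup s i \<noteq> 0"
        using that
        by (intro poly_mapping_eqI) (auto simp: lookup_add lookup_minus lookup_single_1)
      show ?thesis
        using False 1 2 multibinom_pascal[OF False]
        by (simp add: dp_mult_divmono dp_deriv_linear dp_deriv_divmono pm.scale_left_distrib
            del: One_nat_def)
    qed
    then show ?case
      by (simp add: dp_mult_scale_left dp_mult_scale_right dp_deriv_linear pm.scale_right_distrib)
  qed (simp add: dp_mult_add_left dp_mult_add_right dp_deriv_linear)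
qed (simp add: dp_mult_add_left dp_mult_add_right dp_deriv_linear)

section \<open>The Poisson bracket\<close>

lemma poisson_linear:
  "poisson m (f + f') h = poisson m f h + poisson m f' h"
  "poisson m f (h + h') = poisson m f h + poisson m f h'"
  "poisson m (f - f') h = poisson m f h - poisson m f' h"
  "poisson m f (h - h') = poisson m f h - poisson m f h'"
  "poisson m (- f) h = - poisson m f h"
  "poisson m f (- h) = - poisson m f h"
  "poisson m (pm_scale c f) h = pm_scale c (poisson m f h)"
  "poisson m f (pm_scale c h) = pm_scale c (poisson m f h)"
  by (simp_all add: poisson_def dp_deriv_linear dp_mult_add_left dp_mult_add_right dp_mult_diff
      dp_mult_uminus dp_mult_scale_left dp_mult_scale_right algebra_simps sum.distrib sum_subtractf
      sum_negf pm.scale_sum_right pm.scale_right_diff_distrib)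

lemma poisson_self: "poisson m f f = 0"
  by (simp add: poisson_def dp_mult_commute)

lemma poisson_swap: "poisson m f h = - poisson m h f"
  by (simp add: poisson_def dp_mult_commute sum_negf[symmetric] del: sum_negf)

text \<open>By the Leibniz rule \<open>{f, {g, h}}\<close> is a sum of terms with second derivatives of \<open>g\<close> and terms
  with second derivatives of \<open>h\<close>; the Jacobi identity matches these with the terms of the other two
  double brackets, after exchanging the summation indices where necessary.\<close>

lemma poisson_jacobi:
  "poisson m f (poisson m g h) = poisson m (poisson m f g) h + poisson m g (poisson m f h)"
proof -
  define D1 where "D1 f g h i j =
    dp_mult (dp_deriv i f) (dp_mult (dp_deriv (i + m) (dp_deriv j g)) (dp_deriv (j + m) h))
    - dp_mult (dp_deriv i f) (dp_mult (dp_deriv (i + m) (dp_deriv (j + m) g)) (dp_deriv j h))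
    - dp_mult (dp_deriv (i + m) f) (dp_mult (dp_deriv i (dp_deriv j g)) (dp_deriv (j + m) h))
    + dp_mult (dp_deriv (i + m) f) (dp_mult (dp_deriv i (dp_deriv (j + m) g)) (dp_deriv j h))"
    for f g h :: "'a divpow" and i j
  define D2 where "D2 f g h i j =
    dp_mult (dp_deriv i f) (dp_mult (dp_deriv j g) (dp_deriv (i + m) (dp_deriv (j + m) h)))
    - dp_mult (dp_deriv i f) (dp_mult (dp_deriv (j + m) g) (dp_deriv (i + m) (dp_deriv j h)))
    - dp_mult (dp_deriv (i + m) f) (dp_mult (dp_deriv j g) (dp_deriv i (dp_deriv (j + m) h)))
    + dp_mult (dp_deriv (i + m) f) (dp_mult (dp_deriv (j + m) g) (dp_deriv i (dp_deriv j h)))"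
    for f g h :: "'a divpow" and i j
  have double: "poisson m f (poisson m g h) =
      (\<Sum>i=1..m. \<Sum>j=1..m. D1 f g h i j) + (\<Sum>i=1..m. \<Sum>j=1..m. D2 f g h i j)" for f g h
  proof -
    have "poisson m f (poisson m g h) = (\<Sum>i=1..m. \<Sum>j=1..m. D1 f g h i j + D2 f g h i j)"
      unfolding poisson_def[of m f] poisson_def[of m g] dp_deriv_sum dp_mult_sum_right
        sum_subtractf[symmetric]
      by (intro sum.cong refl)
        (simp add: D1_def D2_def dp_deriv_linear dp_deriv_mult dp_mult_diff dp_mult_add_right
          algebra_simps)
    then show ?thesis by (simp add: sum.distrib)
  qed
  have 1: "(\<Sum>i=1..m. \<Sum>j=1..m. D2 f g h i j) = (\<Sum>i=1..m. \<Sum>j=1..m. D2 g f h i j)"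
    by (subst sum.swap, intro sum.cong refl)
      (simp add: D2_def dp_mult_ac dp_deriv_commute algebra_simps)
  have 2: "(\<Sum>i=1..m. \<Sum>j=1..m. D1 f g h i j) = - (\<Sum>i=1..m. \<Sum>j=1..m. D2 h f g i j)"
    unfolding sum_negf[symmetric]
    by (subst sum.swap, intro sum.cong refl)
      (simp add: D1_def D2_def dp_mult_ac dp_deriv_commute algebra_simps)
  have 3: "(\<Sum>i=1..m. \<Sum>j=1..m. D1 g f h i j) = (\<Sum>i=1..m. \<Sum>j=1..m. D1 h f g i j)"
    by (subst sum.swap, intro sum.cong refl)
      (simp add: D1_def dp_mult_ac dp_deriv_commute algebra_simps)
  show ?thesis
    unfolding poisson_swap[of m "poisson m f g"] double 1 2 3 by simp
qed

section \<open>Truncated exponents\<close>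

lemma keys_dp_deriv: "keys (dp_deriv i f) \<subseteq> {t. t + single i 1 \<in> keys f}"
  by (auto simp: in_keys_iff lookup_dp_deriv)

text \<open>The prime divides the factorial of \<open>a + b\<close> but neither that of
  \<open>a\<close> nor that of \<open>b\<close>.\<close>

lemma prime_dvd_choose_add:
  fixes p :: nat
  assumes "prime p" "a < p" "b < p" "p \<le> a + b"
  shows "p dvd (a + b) choose a"
proof -
  have "p dvd fact (a + b)" using assms by (simp add: prime_dvd_fact_iff)
  then have "p dvd fact a * fact b * ((a + b) choose a)"
    using binomial_fact_lemma[of a "a + b"] by simp
  then show ?thesis using assms by (simp add: prime_dvd_mult_iff prime_dvd_fact_iff)
qed

text \<open>A derivation lowers a \<open>p\<close>-th divided power to exponent \<open>p - 1\<close>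
  or kills it, so such elements enter a bracket only through truncated derivatives.\<close>

lemma keys_deriv_truncated:
  assumes "keys f \<subseteq> truncated_exponents m p \<union> pth_exponents m p" "p > 0"
  shows "keys (dp_deriv i f) \<subseteq> truncated_exponents m p"
proof
  fix t assume "t \<in> keys (dp_deriv i f)"
  then have "t + single i 1 \<in> truncated_exponents m p \<union> pth_exponents m p"
    using keys_dp_deriv[of i f] assms(1) by blast
  then show "t \<in> truncated_exponents m p"
  proof
    assume t: "t + single i 1 \<in> truncated_exponents m p"
    have "lookup t j \<le> lookup (t + single i 1) j" for j by (simp add: lookup_add)
    moreover from this have "keys t \<subseteq> keys (t + single i 1)"
      by (metis in_keys_iff le_zero_eq subsetI)
    moreover have "keys (t + single i 1) \<subseteq> {1..2 * m}" "\<And>j. lookup (t + single i 1) j < p"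
      using t by (auto simp: truncated_exponents_def)
    ultimately show ?thesis
      unfolding truncated_exponents_def mem_Collect_eq by (meson le_less_trans order_trans)
  next
    assume "t + single i 1 \<in> pth_exponents m p"
    then obtain l where l: "l \<in> {1..2 * m}" "t + single i 1 = single l p"
      by (auto simp: pth_exponents_def)
    have eq: "lookup t j + (if i = j then 1 else 0) = (if l = j then p else 0)" for j
      using arg_cong[OF l(2), of "\<lambda>x. lookup x j"]
      by (auto simp: lookup_add lookup_single_1 lookup_single when_def split: if_splits)
    have "i = l" using eq[of i] by (simp split: if_splits)
    have "lookup t j < p \<and> (j \<noteq> l \<longrightarrow> lookup t j = 0)" for j
      using eq[of j] \<open>i = l\<close> assms(2) by (auto split: if_splits)
    moreover from this have "keys t \<subseteq> {l}" by (auto simp: in_keys_iff)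
    ultimately show ?thesis using l(1) unfolding truncated_exponents_def by blast
  qed
qed

text \<open>An exponent that reaches \<open>p\<close> comes with a binomial coefficient divisible by
  \<open>p\<close>.\<close>

lemma keys_mult_truncated:
  fixes f h :: "'a::field divpow"
  assumes "prime p" "CHAR('a) = p"
    and "keys f \<subseteq> truncated_exponents m p" "keys h \<subseteq> truncated_exponents m p"
  shows "keys (dp_mult f h) \<subseteq> truncated_exponents m p"
proof
  fix t assume "t \<in> keys (dp_mult f h)"
  then obtain r s where t: "t = r + s" and "r \<in> keys f" "s \<in> keys h"
    and nz: "of_nat (multibinom r s) \<noteq> (0 :: 'a)"
    using keys_dp_mult[of f h] by blast
  then have r: "keys r \<subseteq> {1..2 * m}" "\<And>i. lookup r i < p"
    and s: "keys s \<subseteq> {1..2 * m}" "\<And>i. lookup s i < p"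
    using assms(3,4) by (auto simp: truncated_exponents_def)
  have "lookup t i < p" for i
  proof (rule ccontr)
    assume *: "\<not> lookup t i < p"
    then have "p dvd (lookup r i + lookup s i) choose lookup r i"
      using assms(1) r(2)[of i] s(2)[of i] by (intro prime_dvd_choose_add) (auto simp: t lookup_add)
    then have "p dvd multibinom r s" by (subst multibinom_split[of r s i]) simp
    then show False using nz assms(2) by (simp add: of_nat_eq_0_iff_char_dvd)
  qed
  moreover have "keys t \<subseteq> {1..2 * m}" using r(1) s(1) keys_add[of r s] by (auto simp: t)
  ultimately show "t \<in> truncated_exponents m p" by (simp add: truncated_exponents_def)
qed

lemma keys_sum_diff_subset:
  assumes "\<And>i. i \<in> I \<Longrightarrow> keys (f i) \<subseteq> X" "\<And>i. i \<in> I \<Longrightarrow> keys (h i) \<subseteq> X"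
  shows "keys (\<Sum>i\<in>I. f i - h i :: 'k \<Rightarrow>\<^sub>0 'a::ab_group_add) \<subseteq> X"
  using keys_sum[of "\<lambda>i. f i - h i" I] keys_diff[of "f _" "h _"] assms by blast

lemma keys_poisson_truncated:
  fixes f h :: "'a::field divpow"
  assumes "prime p" "CHAR('a) = p"
    and "keys f \<subseteq> truncated_exponents m p \<union> pth_exponents m p"
    and "keys h \<subseteq> truncated_exponents m p \<union> pth_exponents m p"
  shows "keys (poisson m f h) \<subseteq> truncated_exponents m p"
  unfolding poisson_def using assms prime_gt_0_nat[OF assms(1)]
  by (intro keys_sum_diff_subset keys_mult_truncated keys_deriv_truncated) auto

text \<open>A bracket of truncated elements is a sum of derivatives of truncated elements, and these have
  no component in the top degree.\<close>

lemma lookup_poisson_top: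
  fixes f h :: "'a::field divpow"
  assumes "prime p" "CHAR('a) = p"
    and "keys f \<subseteq> truncated_exponents m p" "keys h \<subseteq> truncated_exponents m p"
    and top: "\<And>i. i \<in> {1..2 * m} \<Longrightarrow> lookup t i = p - 1"
  shows "lookup (poisson m f h) t = 0"
proof -
  have p: "p > 0" using assms(1) by (rule prime_gt_0_nat)
  have deriv: "lookup (dp_deriv i (dp_mult f (dp_deriv j h))) t = 0" if "i \<in> {1..2 * m}" for i j
  proof -
    have "keys (dp_mult f (dp_deriv j h)) \<subseteq> truncated_exponents m p"
      using assms p by (intro keys_mult_truncated keys_deriv_truncated) auto
    moreover have "lookup (t + single i 1) i = p"
      using top[OF that] p by (simp add: lookup_add)
    then have "t + single i 1 \<notin> truncated_exponents m p"
      by (auto simp: truncated_exponents_def)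
    ultimately show ?thesis by (auto simp: lookup_dp_deriv in_keys_iff)
  qed
  have "poisson m f h = (\<Sum>i=1..m. dp_deriv i (dp_mult f (dp_deriv (i + m) h))
      - dp_deriv (i + m) (dp_mult f (dp_deriv i h)))"
    unfolding poisson_def
    by (intro sum.cong refl) (simp add: dp_deriv_mult dp_deriv_commute)
  also have "lookup \<dots> t = 0"
    by (auto simp: lookup_sum lookup_minus deriv intro!: sum.neutral)
  finally show ?thesis .
qed

lemma sym_grade_add: "sym_grade m (r + s) = sym_grade m r + sym_grade m s"
  by (simp add: sym_grade_def lookup_add sum.distrib sum_subtractf)

lemma sym_grade_single:
  assumes "i \<in> {1..m}"
  shows "sym_grade m (single i 1) = - 1" "sym_grade m (single (i + m) 1) = 1"
proof -
  have "sym_grade m (single i 1) = (\<Sum>j=1..m. if j = i then - 1 else 0)"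
    "sym_grade m (single (i + m) 1) = (\<Sum>j=1..m. if j = i then 1 else 0)"
    unfolding sym_grade_def using assms
    by (intro sum.cong; auto simp: lookup_single when_def)+
  then show "sym_grade m (single i 1) = - 1" "sym_grade m (single (i + m) 1) = 1"
    using assms by simp_all
qed

text \<open>Each term of the bracket removes one unit at \<open>i\<close> and one at
  \<open>i + m\<close>, and the grades of these two cancel.\<close>

lemma sym_grade_poisson:
  assumes "t \<in> keys (poisson m (divmono r) (divmono s) :: 'a::field divpow)"
  shows "sym_grade m t = sym_grade m r + sym_grade m s"
proof -
  have "keys (poisson m (divmono r) (divmono s) :: 'a divpow)
    \<subseteq> {t. sym_grade m t = sym_grade m r + sym_grade m s}"
    unfolding poisson_def
  proof (intro keys_sum_diff_subset)
    fix i assume i: "i \<in> {1..m}"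
    have *: "keys (dp_mult (dp_deriv j (divmono r)) (dp_deriv l (divmono s)) :: 'a divpow)
      \<subseteq> {t. t + (single j 1 + single l 1) = r + s}" for j l
    proof
      fix t assume "t \<in> keys (dp_mult (dp_deriv j (divmono r)) (dp_deriv l (divmono s)) :: 'a divpow)"
      then obtain a b where t: "t = a + b" "a \<in> keys (dp_deriv j (divmono r :: 'a divpow))"
        "b \<in> keys (dp_deriv l (divmono s :: 'a divpow))"
        using keys_dp_mult[of "dp_deriv j (divmono r)" "dp_deriv l (divmono s) :: 'a divpow"] by blast
      then have "a + single j 1 = r" "b + single l 1 = s"
        using keys_dp_deriv[of j "divmono r :: 'a divpow"] keys_dp_deriv[of l "divmono s :: 'a divpow"]
        by (auto simp: divmono_def)
      then show "t \<in> {t. t + (single j 1 + single l 1) = r + s}"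
        using t(1) by (auto simp: ac_simps)
    qed
    have grade: "sym_grade m t = sym_grade m r + sym_grade m s"
      if "t + (single j 1 + single l 1) = r + s"
        "sym_grade m (single j 1) + sym_grade m (single l 1) = 0" for t j l
      using arg_cong[OF that(1), of "sym_grade m"] that(2) by (simp add: sym_grade_add)
    show "keys (dp_mult (dp_deriv i (divmono r)) (dp_deriv (i + m) (divmono s)) :: 'a divpow)
        \<subseteq> {t. sym_grade m t = sym_grade m r + sym_grade m s}"
      using *[of i "i + m"] grade[of _ i "i + m"] sym_grade_single[OF i] by auto
    show "keys (dp_mult (dp_deriv (i + m) (divmono r)) (dp_deriv i (divmono s)) :: 'a divpow)
        \<subseteq> {t. sym_grade m t = sym_grade m r + sym_grade m s}"
      using *[of "i + m" i] grade[of _ "i + m" i] sym_grade_single[OF i] by auto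
  qed
  then show ?thesis using assms by blast
qed

text \<open>The product is a multiple of the monomial with exponent \<open>r + s\<close> less one
  unit at \<open>i\<close> and at \<open>j\<close>, which is \<open>r\<close> only if
  \<open>s\<close> consists of these two units; the coefficient is then \<open>lookup r j\<close>
  choose 1. These are the diagonal entries needed for the traces of adjoint maps.\<close>

lemma lookup_mult_deriv_diagonal:
  assumes "i \<noteq> j"
  shows "lookup (dp_mult (dp_deriv i (divmono s)) (dp_deriv j (divmono r)) :: 'a::field divpow) r =
    (if s = single i 1 + single j 1 then of_nat (lookup r j) else 0)"
proof (cases "lookup s i = 0 \<or> lookup r j = 0")
  case True
  have "lookup (single i 1 + single j 1 :: exponent) i = 1"
    using assms by (simp add: lookup_add lookup_single_1)
  then show ?thesis using True by (auto simp: dp_deriv_divmono)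
next
  case False
  then have si: "lookup s i \<noteq> 0" and rj: "lookup r j \<noteq> 0" by auto
  define r' where "r' = r - single j 1"
  have r: "r = r' + single j 1" using exponent_minus_eq_iff[OF rj, of r'] by (simp add: r'_def)
  have iff: "s - single i 1 + r' = r \<longleftrightarrow> s = single i 1 + single j 1"
    using exponent_minus_eq_iff[OF si, of "single j 1"]
    by (subst r) (auto simp: add.commute)
  have "multibinom (single j 1) r' = lookup r j"
  proof -
    have "(\<Prod>l\<in>(keys (single j (1::nat)) \<union> keys r') - {j}.
        (lookup (single j 1) l + lookup r' l) choose lookup (single j 1) l) = 1"
      by (intro prod.neutral) (auto simp: lookup_single_1)
    then show ?thesis
      by (subst multibinom_split[of _ _ j]) (simp add: r lookup_add lookup_single_1)
  qed
  moreover have "s - single i 1 = single j 1" if "s = single i 1 + single j 1"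
    using exponent_minus_eq_iff[OF si, of "single j 1"] that by (simp add: add.commute)
  moreover have "dp_mult (dp_deriv i (divmono s)) (dp_deriv j (divmono r)) =
      (pm_scale (of_nat (multibinom (s - single i 1) r')) (divmono (s - single i 1 + r')) :: 'a divpow)"
    using si rj by (simp add: dp_deriv_divmono dp_mult_divmono r'_def)
  ultimately show ?thesis
    using iff by (auto simp: divmono_def lookup_single when_def)
qed

section \<open>Exchanging conjugate indeterminates\<close>

definition swap_index :: "nat \<Rightarrow> nat \<Rightarrow> nat" where
  "swap_index m i = (if i \<in> {1..m} then i + m else if i \<in> {m + 1..2 * m} then i - m else i)"

lemma swap_index_involution [simp]: "swap_index m (swap_index m i) = i"
  by (auto simp: swap_index_def)

lemma swap_index_simps [simp]:
  "i \<in> {1..m} \<Longrightarrow> swap_index m i = i + m" "i \<in> {1..m} \<Longrightarrow> swap_index m (i + m) = i"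
  by (auto simp: swap_index_def)

lemma swap_index_range: "swap_index m i \<in> {1..2 * m} \<longleftrightarrow> i \<in> {1..2 * m}"
  by (auto simp: swap_index_def)

lemma inj_swap_index: "inj (swap_index m)"
  by (metis injI swap_index_involution)

definition swap_exponent :: "nat \<Rightarrow> exponent \<Rightarrow> exponent" where
  "swap_exponent m = Poly_Mapping.map_key (swap_index m)"

lemma lookup_swap_exponent [simp]: "lookup (swap_exponent m r) i = lookup r (swap_index m i)"
  by (simp add: swap_exponent_def map_key.rep_eq[OF inj_swap_index])

lemma swap_exponent_involution [simp]: "swap_exponent m (swap_exponent m r) = r"
  by (rule poly_mapping_eqI) simp

lemma inj_swap_exponent: "inj (swap_exponent m)"
  by (metis injI swap_exponent_involution)

lemma swap_exponent_add: "swap_exponent m (r + s) = swap_exponent m r + swap_exponent m s"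
  by (rule poly_mapping_eqI) (simp add: lookup_add)

lemma swap_exponent_single: "swap_exponent m (single i c) = single (swap_index m i) c"
  by (rule poly_mapping_eqI) (auto simp: lookup_single when_def)

lemma keys_swap_exponent: "keys (swap_exponent m r) = swap_index m ` keys r"
  by (auto simp: in_keys_iff image_iff intro!: bexI[of _ "swap_index m _"])

lemma sum_swap_index: "(\<Sum>i\<in>swap_index m ` I. f (swap_index m i)) = (\<Sum>i\<in>I. f i)"
  by (subst sum.reindex) (auto intro: inj_on_subset[OF inj_swap_index])

lemma prod_swap_index: "(\<Prod>i\<in>swap_index m ` I. f (swap_index m i)) = (\<Prod>i\<in>I. f i)"
  by (subst prod.reindex) (auto intro: inj_on_subset[OF inj_swap_index])

lemma multibinom_swap: "multibinom (swap_exponent m r) (swap_exponent m s) = multibinom r s"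
  unfolding multibinom_def swap_exponent_add[symmetric] keys_swap_exponent lookup_swap_exponent
  by (rule prod_swap_index)

lemma total_degree_swap [simp]: "total_degree (swap_exponent m r) = total_degree r"
  unfolding total_degree_def keys_swap_exponent lookup_swap_exponent by (rule sum_swap_index)

lemma sym_grade_swap [simp]: "sym_grade m (swap_exponent m r) = - sym_grade m r"
  unfolding sym_grade_def lookup_swap_exponent sum_negf[symmetric]
  by (intro sum.cong refl) simp

lemma swap_exponent_truncated [simp]:
  "swap_exponent m r \<in> truncated_exponents m p \<longleftrightarrow> r \<in> truncated_exponents m p"
proof -
  have "swap_exponent m r \<in> truncated_exponents m p" if "r \<in> truncated_exponents m p" for r
    using that swap_index_range[of m]
    unfolding truncated_exponents_def mem_Collect_eq keys_swap_exponent lookup_swap_exponent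
    by blast
  from this[of r] this[of "swap_exponent m r"] show ?thesis by auto
qed

lemma swap_exponent_pth [simp]:
  "swap_exponent m r \<in> pth_exponents m p \<longleftrightarrow> r \<in> pth_exponents m p"
proof -
  have "swap_exponent m r \<in> pth_exponents m p" if r: "r \<in> pth_exponents m p" for r
  proof -
    obtain i where "i \<in> {1..2 * m}" "r = single i p" using r by (auto simp: pth_exponents_def)
    then show ?thesis
      unfolding pth_exponents_def
      by (intro CollectI exI[of _ "swap_index m i"])
        (simp add: swap_exponent_single swap_index_range del: atLeastAtMost_iff One_nat_def)
  qed
  from this[of r] this[of "swap_exponent m r"] show ?thesis by auto
qed

definition swap_divpow :: "nat \<Rightarrow> 'a::field divpow \<Rightarrow> 'a divpow" where
  "swap_divpow m = Poly_Mapping.map_key (swap_exponent m)"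

lemma lookup_swap_divpow [simp]: "lookup (swap_divpow m f) t = lookup f (swap_exponent m t)"
  by (simp add: swap_divpow_def map_key.rep_eq[OF inj_swap_exponent])

lemma swap_divpow_linear:
  "swap_divpow m (f + h) = swap_divpow m f + swap_divpow m h"
  "swap_divpow m (f - h) = swap_divpow m f - swap_divpow m h"
  "swap_divpow m (- f) = - swap_divpow m f"
  "swap_divpow m (pm_scale c f) = pm_scale c (swap_divpow m f)"
  "swap_divpow m 0 = 0"
  by (auto intro!: poly_mapping_eqI simp: lookup_add lookup_minus)

lemma swap_divpow_sum: "swap_divpow m (sum f I) = (\<Sum>i\<in>I. swap_divpow m (f i))"
  by (induction I rule: infinite_finite_induct) (auto simp: swap_divpow_linear)

lemma swap_divpow_involution [simp]: "swap_divpow m (swap_divpow m f) = f"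
  by (rule poly_mapping_eqI) simp

lemma swap_divpow_divmono [simp]: "swap_divpow m (divmono r) = divmono (swap_exponent m r)"
  by (rule poly_mapping_eqI) (auto simp: divmono_def lookup_single when_def)

lemma swap_divpow_mult:
  "swap_divpow m (dp_mult f h) = dp_mult (swap_divpow m f) (swap_divpow m h)"
proof (induction f rule: divpow_induct)
  case (basis c r)
  show ?case
  proof (induction h rule: divpow_induct)
    case (basis d s)
    show ?case
      by (simp add: dp_mult_scale_left dp_mult_scale_right dp_mult_divmono swap_divpow_linear
          multibinom_swap swap_exponent_add)
  qed (simp add: dp_mult_add_right swap_divpow_linear)
qed (simp add: dp_mult_add_left swap_divpow_linear)

lemma swap_divpow_deriv:
  "swap_divpow m (dp_deriv i f) = dp_deriv (swap_index m i) (swap_divpow m f)"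
  by (rule poly_mapping_eqI) (simp add: lookup_dp_deriv swap_exponent_add swap_exponent_single)

text \<open>The exchange reverses the symplectic form. Hence it is the negative of the exchange that
  serves as an automorphism of the bracket.\<close>

lemma swap_divpow_poisson:
  "swap_divpow m (poisson m f h) = - poisson m (swap_divpow m f) (swap_divpow m h)"
  unfolding poisson_def swap_divpow_sum sum_negf[symmetric]
  by (intro sum.cong refl)
    (simp add: swap_divpow_linear swap_divpow_mult swap_divpow_deriv dp_mult_commute)

section \<open>The truncated Poisson and Hamiltonian algebras\<close>

lemma span_divmono: "pm.span (divmono ` R) = {x :: 'a::field divpow. keys x \<subseteq> R}"
proof
  have "keys x \<subseteq> R" if "x \<in> pm.span (divmono ` R)" for x :: "'a divpow"
    using that
  proof (induction rule: pm.span_induct_alt)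
    case (step c x y)
    then have "keys x \<subseteq> R" by (auto simp: divmono_def)
    with step.IH show ?case
      using keys_add[of "pm_scale c x" y] keys_pm_scale_subset[of c x] by blast
  qed simp
  then show "pm.span (divmono ` R) \<subseteq> {x :: 'a divpow. keys x \<subseteq> R}" by blast
  show "{x :: 'a divpow. keys x \<subseteq> R} \<subseteq> pm.span (divmono ` R)"
  proof clarify
    fix x :: "'a divpow" assume x: "keys x \<subseteq> R"
    have "(\<Sum>r\<in>keys x. pm_scale (lookup x r) (divmono r)) \<in> pm.span (divmono ` R)"
      using x by (intro pm.span_sum pm.span_scale pm.span_base) auto
    then show "x \<in> pm.span (divmono ` R)"
      by (simp add: divmono_def flip: pm_expand)
  qed
qed

lemma inj_divmono: "inj (divmono :: exponent \<Rightarrow> 'a::field divpow)"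
proof (rule injI)
  fix r s assume "divmono r = (divmono s :: 'a divpow)"
  then have "keys (divmono r :: 'a divpow) = keys (divmono s :: 'a divpow)" by simp
  then show "r = s" by (simp add: divmono_def)
qed

lemma dim_span_divmono: "pm.dim (pm.span (divmono ` R :: 'a::field divpow set)) = card R"
proof -
  have "pm.independent (divmono ` R :: 'a divpow set)"
    unfolding pm.dependent_def
  proof safe
    fix r assume r: "r \<in> R" "divmono r \<in> pm.span (divmono ` R - {divmono r :: 'a divpow})"
    have "divmono ` R - {divmono r :: 'a divpow} = divmono ` (R - {r})"
      using inj_divmono[where 'a = 'a] by (auto dest: injD)
    then have "keys (divmono r :: 'a divpow) \<subseteq> R - {r}"
      using r(2) by (simp add: span_divmono)
    then show False by (simp add: divmono_def)
  qed
  then have "pm.dim (pm.span (divmono ` R :: 'a divpow set)) = card (divmono ` R :: 'a divpow set)"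
    by (rule pm.dim_span_eq_card_independent)
  also have "\<dots> = card R" by (rule card_image) (rule inj_on_subset[OF inj_divmono], simp)
  finally show ?thesis .
qed

lemma finite_truncated_exponents: "finite (truncated_exponents m p)"
proof -
  have "lookup ` truncated_exponents m p \<subseteq>
      {f. \<forall>i. (i \<in> {1..2 * m} \<longrightarrow> f i \<in> {..<p}) \<and> (i \<notin> {1..2 * m} \<longrightarrow> f i = 0)}"
    by (auto simp: truncated_exponents_def in_keys_iff subset_iff)
  moreover have "finite \<dots>" by (rule finite_set_of_finite_funs) auto
  ultimately have "finite (lookup ` truncated_exponents m p)" by (rule finite_subset)
  then show ?thesis
    by (rule finite_imageD) (auto intro!: inj_onI simp: lookup_inject)
qed

lemma finite_pth_exponents: "finite (pth_exponents m p)"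
proof -
  have "pth_exponents m p = (\<lambda>i. single i p) ` {1..2 * m}" by (auto simp: pth_exponents_def)
  then show ?thesis by simp
qed

lemma ham_bracket_linear:
  "ham_bracket m (f + f') h = ham_bracket m f h + ham_bracket m f' h"
  "ham_bracket m f (h + h') = ham_bracket m f h + ham_bracket m f h'"
  "ham_bracket m (- f) h = - ham_bracket m f h"
  "ham_bracket m f (- h) = - ham_bracket m f h"
  "ham_bracket m (pm_scale c f) h = pm_scale c (ham_bracket m f h)"
  "ham_bracket m f (pm_scale c h) = pm_scale c (ham_bracket m f h)"
  by (auto simp: ham_bracket_def poisson_linear lookup_add algebra_simps pm.scale_left_distrib
      pm.scale_right_diff_distrib divmono_def single_add single_uminus)

lemma lookup_ham_bracket:
  "lookup (ham_bracket m f h) t = (if t = 0 then 0 else lookup (poisson m f h) t)"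
  by (simp add: ham_bracket_def lookup_minus divmono_def lookup_one when_def)

lemma poisson_const: "poisson m f (divmono 0) = 0" "poisson m (divmono 0) h = 0"
  by (simp_all add: poisson_def dp_deriv_divmono)

text \<open>Constants are central, so the inner brackets may keep their constant terms; the Poisson
  identity is then compared coefficient by coefficient.\<close>

lemma ham_bracket_jacobi:
  "ham_bracket m f (ham_bracket m g h) =
    ham_bracket m (ham_bracket m f g) h + ham_bracket m g (ham_bracket m f h)"
proof -
  have "ham_bracket m f (ham_bracket m g h) = ham_bracket m f (poisson m g h)"
    "ham_bracket m (ham_bracket m f g) h = ham_bracket m (poisson m f g) h" for f g h :: "'a divpow"
    by (simp_all add: ham_bracket_def poisson_linear poisson_const del: pm_scale_single)
  moreover have "ham_bracket m f (poisson m g h) =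
      ham_bracket m (poisson m f g) h + ham_bracket m g (poisson m f h)"
    by (rule poly_mapping_eqI)
      (simp add: lookup_ham_bracket lookup_add poisson_jacobi[of m f g h])
  ultimately show ?thesis by simp
qed

lemma swap_exponent_0 [simp]: "swap_exponent m r = 0 \<longleftrightarrow> r = 0"
proof -
  have "swap_exponent m 0 = 0" by (rule poly_mapping_eqI) simp
  then show ?thesis by (metis swap_exponent_involution)
qed

lemma swap_divpow_ham_bracket:
  "swap_divpow m (ham_bracket m f h) = - ham_bracket m (swap_divpow m f) (swap_divpow m h)"
  using arg_cong[OF swap_divpow_poisson[of m f h], of lookup]
  by (auto intro!: poly_mapping_eqI simp: lookup_ham_bracket fun_eq_iff)

text \<open>Diagonal entries can only arise when \<open>divmono s\<close> is the product of two
  conjugate indeterminates. The entry at \<open>r\<close> is then the difference of the two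
  conjugate exponents of \<open>r\<close>, and over an \<open>R\<close> stable under the exchange
  these sum to 0.\<close>

lemma poisson_unimodular:
  assumes "finite R" "\<And>r. swap_exponent m r \<in> R \<longleftrightarrow> r \<in> R"
  shows "(\<Sum>r\<in>R. lookup (poisson m (divmono s) (divmono r) :: 'a::field divpow) r) = 0"
proof -
  have "lookup (poisson m (divmono s) (divmono r) :: 'a divpow) r =
      (\<Sum>i=1..m. if s = single i 1 + single (i + m) 1
        then of_nat (lookup r (i + m)) - of_nat (lookup r i) else 0)" for r
    unfolding poisson_def lookup_sum
  proof (intro sum.cong refl)
    fix i assume i: "i \<in> {1..m}"
    then have "i \<noteq> i + m" "i + m \<noteq> i" by auto
    from lookup_mult_deriv_diagonal[OF this(1), of s r, where 'a = 'a]
      lookup_mult_deriv_diagonal[OF this(2), of s r, where 'a = 'a]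
    show "lookup (dp_mult (dp_deriv i (divmono s)) (dp_deriv (i + m) (divmono r))
        - dp_mult (dp_deriv (i + m) (divmono s)) (dp_deriv i (divmono r)) :: 'a divpow) r =
      (if s = single i 1 + single (i + m) 1
        then of_nat (lookup r (i + m)) - of_nat (lookup r i) else 0)"
      by (simp add: lookup_minus add.commute)
  qed
  then have "(\<Sum>r\<in>R. lookup (poisson m (divmono s) (divmono r) :: 'a divpow) r) =
      (\<Sum>i=1..m. if s = single i 1 + single (i + m) 1
        then (\<Sum>r\<in>R. of_nat (lookup r (i + m))) - (\<Sum>r\<in>R. of_nat (lookup r i)) else 0)"
    by (simp only:, subst sum.swap, intro sum.cong refl) (simp add: sum_subtractf)
  also have "\<dots> = 0"
  proof (intro sum.neutral ballI)
    fix i assume i: "i \<in> {1..m}"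
    have "(\<Sum>r\<in>R. of_nat (lookup r (i + m)) :: 'a) = (\<Sum>r\<in>R. of_nat (lookup r i))"
      using assms(2) i
      by (intro sum.reindex_bij_witness[of _ "swap_exponent m" "swap_exponent m"]) simp_all
    then show "(if s = single i 1 + single (i + m) 1
        then (\<Sum>r\<in>R. of_nat (lookup r (i + m))) - (\<Sum>r\<in>R. of_nat (lookup r i)) else 0 :: 'a) = 0"
      by simp
  qed
  finally show ?thesis .
qed

text \<open>The common part of the four cases. For the Hamiltonian bracket the condition
  \<open>0 \<notin> R\<close> ensures that it has the same coefficients on \<open>R\<close> as the
  Poisson bracket, so grading and traces carry over.\<close>

theorem graded_algebra_duality:
  fixes br :: "'a::field divpow \<Rightarrow> 'a divpow \<Rightarrow> 'a divpow" and m k :: nat and g :: int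
  assumes R: "finite R" "\<And>r. swap_exponent m r \<in> R \<longleftrightarrow> r \<in> R"
    and br: "br = poisson m \<or> br = ham_bracket m \<and> 0 \<notin> R"
    and closed: "\<And>r s. r \<in> R \<Longrightarrow> s \<in> R \<Longrightarrow> keys (br (divmono r) (divmono s)) \<subseteq> R"
    and A: "A = graded_algebra m R br"
    and N: "N = pm.dim (lie_carrier A)" and k: "k \<le> N"
  shows "isomorphic (cohomology A k g) (dual_space (cohomology A (N - k) g))
       \<and> linear_iso (homology A (N - k) g) (dual_space (cohomology A (N - k) g))
           (kronecker A (N - k) g)
       \<and> isomorphic (cohomology A k g) (homology A (N - k) g)"
proof -
  have A_simps: "lie_carrier A = {x. keys x \<subseteq> R}" "lie_bracket A = br"
    "lie_piece A h = {x. keys x \<subseteq> {r \<in> R. sym_grade m r = h}}" for h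
    by (simp_all add: A graded_algebra_def span_divmono)
  have single: "single r 1 = (divmono r :: 'a divpow)" for r by (simp add: divmono_def)
  have lookup_br: "lookup (br f h) t = lookup (poisson m f h) t" if "t \<in> R" for f h t
    using br that by (auto simp: lookup_ham_bracket)
  interpret graded_lie_basis R A "sym_grade m"
  proof (unfold_locales, unfold A_simps single)
    show "finite R" by (rule R)
    show "{x :: 'a divpow. keys x \<subseteq> R} = {x. keys x \<subseteq> R}" ..
    show "{x :: 'a divpow. keys x \<subseteq> {r \<in> R. sym_grade m r = h}} =
        {x. keys x \<subseteq> {r \<in> R. sym_grade m r = h}}" for h ..
    show "br (x + y) z = br x z + br y z" "br x (y + z) = br x y + br x z"
      "br (pm_scale c x) y = pm_scale c (br x y)" "br x (pm_scale c y) = pm_scale c (br x y)" for x y z c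
      using br by (auto simp: poisson_linear ham_bracket_linear)
    show "br x x = 0" for x
      using br by (auto simp: poisson_self ham_bracket_def)
    show "br x (br y z) = br (br x y) z + br y (br x z)" for x y z
      using br poisson_jacobi ham_bracket_jacobi by metis
    show "keys (br (divmono r) (divmono s)) \<subseteq> {t \<in> R. sym_grade m t = sym_grade m r + sym_grade m s}"
      if "r \<in> R" "s \<in> R" for r s
    proof
      fix t assume t: "t \<in> keys (br (divmono r) (divmono s))"
      then have "t \<in> R" using closed[OF that] by blast
      moreover from this t have "t \<in> keys (poisson m (divmono r) (divmono s) :: 'a divpow)"
        by (simp add: in_keys_iff lookup_br)
      ultimately show "t \<in> {t \<in> R. sym_grade m t = sym_grade m r + sym_grade m s}"
        using sym_grade_poisson by blast
    qed
    show "(\<Sum>r\<in>R. lookup (br (divmono s) (divmono r)) r) = 0" for s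
      using poisson_unimodular[OF R, of s, where 'a = 'a] by (simp add: lookup_br)
  qed
  have card: "N = card R"
    using N dim_span_divmono[of R, where 'a = 'a] by (simp add: A graded_algebra_def del: pm.dim_span)
  \<comment> \<open>The exchange permutes \<open>R\<close> and negates grades. The total is an
    integer, so it vanishes whatever the characteristic.\<close>
  have "sum (sym_grade m) R = (\<Sum>r\<in>R. - sym_grade m r)"
    using R(2) by (intro sum.reindex_bij_witness[of _ "swap_exponent m" "swap_exponent m"]) simp_all
  then have total: "sum (sym_grade m) R = 0" by (simp add: sum_negf)
  have swap_keys: "keys (- swap_divpow m x) \<subseteq> {t. swap_exponent m t \<in> keys x}" for x :: "'a divpow"
    by (auto simp: in_keys_iff)
  have neg: "isomorphic (cohomology A k g) (cohomology A k (- g))"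
  proof (rule cohomology_isomorphic_neg[of "\<lambda>x. - swap_divpow m x"], unfold A_simps)
    show "- swap_divpow m (br x y) = br (- swap_divpow m x) (- swap_divpow m y)" for x y
      using br
      by (auto simp: poisson_linear ham_bracket_linear swap_divpow_poisson swap_divpow_ham_bracket)
    show "- swap_divpow m x \<in> {x. keys x \<subseteq> R}" if "x \<in> {x. keys x \<subseteq> R}" for x :: "'a divpow"
      using that swap_keys[of x] R(2) by blast
    show "- swap_divpow m x \<in> {x. keys x \<subseteq> {r \<in> R. sym_grade m r = - h}}"
      if "x \<in> {x. keys x \<subseteq> {r \<in> R. sym_grade m r = h}}" for h and x :: "'a divpow"
      using that swap_keys[of x] R(2) by force
  qed (simp_all add: swap_divpow_linear)
  \<comment> \<open>Complementary grades are opposite as the total is 0; starting from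
    \<open>- g\<close> therefore lands in \<open>g\<close>.\<close>
  have "isomorphic (cohomology A k (- g)) (homology A (N - k) g)"
    using cohomology_isomorphic_homology_compl[of k "- g"] k by (simp add: card total)
  with neg have iso: "isomorphic (cohomology A k g) (homology A (N - k) g)"
    by (rule isomorphic_trans)
  have kron: "linear_iso (homology A (N - k) g) (dual_space (cohomology A (N - k) g))
      (kronecker A (N - k) g)"
    by (rule kronecker_linear_iso)
  then have "isomorphic (homology A (N - k) g) (dual_space (cohomology A (N - k) g))"
    unfolding isomorphic_def by blast
  with iso have "isomorphic (cohomology A k g) (dual_space (cohomology A (N - k) g))"
    by (rule isomorphic_trans)
  with kron iso show ?thesis by blast
qed

text \<open>No exponent exceeds \<open>p - 1\<close>, so the bound on the degree is reached only if
  all of them attain it.\<close>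

lemma truncated_top_degree:
  assumes "t \<in> truncated_exponents m p" "2 * m * (p - 1) \<le> total_degree t" "i \<in> {1..2 * m}"
  shows "lookup t i = p - 1"
proof (rule ccontr)
  assume "lookup t i \<noteq> p - 1"
  have le: "lookup t j \<le> p - 1" for j
    using assms(1) by (auto simp: truncated_exponents_def dest: spec[of _ j])
  have "total_degree t = (\<Sum>j\<in>{1..2 * m}. lookup t j)"
    unfolding total_degree_def using assms(1)
    by (intro sum.mono_neutral_left) (auto simp: truncated_exponents_def in_keys_iff)
  also have "\<dots> < (\<Sum>j\<in>{1..2 * m}. p - 1)"
    using le le_neq_implies_less[OF le \<open>lookup t i \<noteq> p - 1\<close>] assms(3)
    by (intro sum_strict_mono_ex1) auto
  finally show False using assms(2) by simp
qed

lemma total_degree_pos_iff: "0 < total_degree r \<longleftrightarrow> r \<noteq> 0"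
proof -
  have "total_degree r = 0 \<longleftrightarrow> (\<forall>i\<in>keys r. lookup r i = 0)"
    by (simp add: total_degree_def)
  also have "\<dots> \<longleftrightarrow> r = 0" by (auto simp: in_keys_iff intro: poly_mapping_eqI)
  finally show ?thesis by auto
qed

theorem proposition2:
  fixes A :: "'a::field divpow graded_lie" and p m k N :: nat and g :: int
  assumes "prime p" and "CHAR('a) = p" and "m \<ge> 1"
    and "A \<in> {ham m p, ham2 m p, po m p, po2 m p}"
    and "N = pm.dim (lie_carrier A)" and "k \<le> N"
  shows "isomorphic (cohomology A k g) (dual_space (cohomology A (N - k) g))
       \<and> linear_iso (homology A (N - k) g) (dual_space (cohomology A (N - k) g))
           (kronecker A (N - k) g)
       \<and> isomorphic (cohomology A k g) (homology A (N - k) g)"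
proof -
  let ?T = "truncated_exponents m p" and ?P = "pth_exponents m p"
  have p: "p > 0" using assms(1) by (rule prime_gt_0_nat)
  have fin: "finite (?T \<union> ?P)" by (simp add: finite_truncated_exponents finite_pth_exponents)
  have keys: "keys (poisson m (divmono r) (divmono s) :: 'a divpow) \<subseteq> ?T"
    if "r \<in> ?T \<union> ?P" "s \<in> ?T \<union> ?P" for r s
    using that assms(1,2) by (intro keys_poisson_truncated) (auto simp: divmono_def)
  \<comment> \<open>This gives closure for \<open>ham2\<close> and \<open>po2\<close>, whose index
    sets leave out the top monomial.\<close>
  have top: "total_degree t < 2 * m * (p - 1)"
    if "r \<in> ?T" "s \<in> ?T" "t \<in> keys (poisson m (divmono r) (divmono s) :: 'a divpow)" for r s t
  proof (rule ccontr)
    assume "\<not> total_degree t < 2 * m * (p - 1)"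
    then have "lookup t i = p - 1" if "i \<in> {1..2 * m}" for i
      using truncated_top_degree[of t m p i] that keys \<open>r \<in> ?T\<close> \<open>s \<in> ?T\<close> \<open>t \<in> _\<close> by fastforce
    then have "lookup (poisson m (divmono r) (divmono s) :: 'a divpow) t = 0"
      using that assms(1,2) by (intro lookup_poisson_top) (auto simp: divmono_def)
    then show False using that(3) by (simp add: in_keys_iff)
  qed
  have ham: "t \<in> keys (ham_bracket m f h) \<longleftrightarrow> t \<noteq> 0 \<and> t \<in> keys (poisson m f h)"
    for t and f h :: "'a divpow"
    by (simp add: in_keys_iff lookup_ham_bracket)
  have P0: "0 \<notin> ?P" using p by (auto simp: pth_exponents_def) (metis lookup_single_eq lookup_zero less_irrefl)
  from assms(4) consider "A = ham m p" | "A = ham2 m p" | "A = po m p" | "A = po2 m p" by blast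
  then show ?thesis
  proof cases
    case 1
    show ?thesis
    proof (rule graded_algebra_duality[OF _ _ _ _ 1[unfolded ham_def] assms(5,6)])
      show "finite ({r \<in> ?T. 0 < total_degree r} \<union> ?P)" by (rule finite_subset[OF _ fin]) auto
      fix r s :: exponent
      assume "r \<in> {r \<in> ?T. 0 < total_degree r} \<union> ?P" "s \<in> {r \<in> ?T. 0 < total_degree r} \<union> ?P"
      then show "keys (ham_bracket m (divmono r) (divmono s) :: 'a divpow) \<subseteq>
          {r \<in> ?T. 0 < total_degree r} \<union> ?P"
        using keys[of r s] by (auto simp: ham total_degree_pos_iff)
    qed (use P0 in \<open>auto simp: total_degree_pos_iff\<close>)
  next
    case 2
    let ?R = "{r \<in> ?T. 0 < total_degree r \<and> total_degree r < 2 * m * (p - 1)}"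
    show ?thesis
    proof (rule graded_algebra_duality[OF _ _ _ _ 2[unfolded ham2_def] assms(5,6)])
      show "finite ?R" by (rule finite_subset[OF _ fin]) auto
      fix r s :: exponent
      assume "r \<in> ?R" "s \<in> ?R"
      then show "keys (ham_bracket m (divmono r) (divmono s) :: 'a divpow) \<subseteq> ?R"
        using keys[of r s] top[of r s] by (auto simp: ham total_degree_pos_iff)
    qed (auto simp: total_degree_pos_iff)
  next
    case 3
    show ?thesis
    proof (rule graded_algebra_duality[OF fin _ _ _ 3[unfolded po_def] assms(5,6)])
      fix r s :: exponent
      assume "r \<in> ?T \<union> ?P" "s \<in> ?T \<union> ?P"
      then show "keys (poisson m (divmono r) (divmono s) :: 'a divpow) \<subseteq> ?T \<union> ?P"
        using keys[of r s] by blast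
    qed auto
  next
    case 4
    let ?R = "{r \<in> ?T. total_degree r < 2 * m * (p - 1)}"
    show ?thesis
    proof (rule graded_algebra_duality[OF _ _ _ _ 4[unfolded po2_def] assms(5,6)])
      show "finite ?R" by (rule finite_subset[OF _ fin]) auto
      fix r s :: exponent
      assume "r \<in> ?R" "s \<in> ?R"
      then show "keys (poisson m (divmono r) (divmono s) :: 'a divpow) \<subseteq> ?R"
        using keys[of r s] top[of r s] by blast
    qed auto
  qed
qed

end
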